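(* Work in the discrete setting described in the context. For $0\le m\le M-1$ consider the following scheme: given $\vec X^m\in V_\partial^h$ and $\vec U^m$, find $\vec U^{m+1}\in\mathbb U^m$, $P^{m+1}\in\mathbb P^m$, $\vec X^{m+1}\in V_\partial^h$ and $\varkappa^{m+1}\in V^h$ such that for all $(\vec\chi,q,\zeta,\vec\eta)\in\mathbb U^m\times\mathbb P^m\times V^h\times V_\partial^h$: (i) $\tfrac12\Big[\big(\tfrac{\rho^m\vec U^{m+1}-I_0^m\rho^{m-1}I_2^m\vec U^m}{\Delta t},\vec\chi\,r\big)+\big(I_0^m\rho^{m-1}\tfrac{\vec U^{m+1}-I_2^m\vec U^m}{\Delta t},\vec\chi\,r\big)\Big]+\mathscr A(\rho^m,I_2^m\vec U^m;\vec U^{m+1},\vec\chi)+2\big(\mu^m\,\mathbb D_c(\vec U^{m+1}),\mathbb D_c(\vec\chi)\,r\big)+2\big(\mu^m r^{-1}[\vec U^{m+1}\cdot\vec e_1],[\vec\chi\cdot\vec e_1]\big)^\diamond-\big(P^{m+1},\nabla_c\cdot[r\vec\chi]\big)-\gamma\big\langle(\vec X^m\cdot\vec e_1)\,\varkappa^{m+1},\vec\nu^m\cdot\vec\chi\,|\vec X^m_\alpha|\big\rangle=\big(\rho^m\vec g,\vec\chi\,r\big)$; (ii) $\big(\nabla_c\cdot[r\vec U^{m+1}],q\big)=0$; (iii) $\tfrac1{\Delta t}\big\langle\vec X^{m+1}-\vec X^m,\zeta\,\vec f^{m+\frac12}\big\rangle-\big\langle(\vec X^m\cdot\vec e_1)\,\vec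 U^{m+1},\zeta\,\vec\nu^m|\vec X^m_\alpha|\big\rangle=0$; (iv) $\big\langle\varkappa^{m+1}\vec f^{m+\frac12},\vec\eta\big\rangle+\big\langle\vec\eta\cdot\vec e_1,|\vec X^{m+1}_\alpha|\big\rangle+\big\langle(\vec X^m\cdot\vec e_1)\vec X^{m+1}_\alpha,\vec\eta_\alpha|\vec X^m_\alpha|^{-1}\big\rangle=0$, where, with $\vec X^{m+\frac12}=\frac12(\vec X^m+\vec X^{m+1})$, $$\vec f^{m+\frac12}=-\tfrac16\big[(\vec X^m\cdot\vec e_1)\vec X^m_\alpha+4(\vec X^{m+\frac12}\cdot\vec e_1)\vec X^{m+\frac12}_\alpha+(\vec X^{m+1}\cdot\vec e_1)\vec X^{m+1}_\alpha\big]^\perp.$$ Let $(\vec U^{m+1},P^{m+1},\vec X^{m+1},\varkappa^{m+1})$ be a solution of (i)-(iv). Then: (a) for $m=0,\dots,M-1$ $$\tfrac1{2\pi}E(\rho^m,\vec U^{m+1},\vec X^{m+1})+2\Delta t\Big(\|\sqrt{\mu^m r}\,\mathbb D_c(\vec U^{m+1})\|^2+\|\sqrt{\mu^m r^{-1}}\,[\vec U^{m+1}\cdot\vec e_1]\|_\diamond^2\Big)\le\tfrac1{2\pi}E(I_0^m\rho^{m-1},I_2^m\vec U^m,\vec X^m)+\Delta t\,\big(\rho^m r\,\vec g,\vec U^{m+1}\big).$$ (b) If in addition $E(I_0^m\rho^{m-1},I_2^m\vec U^m,\vec X^m)\le E(\rho^{m-1},\vec U^m,\vec X^m)$ for $m=0,\dots,M-1$,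 then for $k=0,\dots,M-1$ $$\tfrac1{2\pi}E(\rho^k,\vec U^{k+1},\vec X^{k+1})+2\Delta t\sum_{m=0}^k\Big\{\|\sqrt{\mu^m r}\,\mathbb D_c(\vec U^{m+1})\|^2+\|\sqrt{\mu^m r^{-1}}\,[\vec U^{m+1}\cdot\vec e_1]\|_\diamond^2\Big\}\le\tfrac1{2\pi}E(\rho^0,\vec U^0,\vec X^0)+\Delta t\sum_{m=0}^k\big(\rho^m r\,\vec g,\vec U^{m+1}\big).$$ (c) If $1_{\mathcal R^m_-}-\omega^m\in\mathbb P^m$ for $m=0,\dots,M-1$, where $\omega^m=\int_{\mathcal R^m_-}r\,dr\,dz\big/\int_{\mathcal R}r\,dr\,dz$, then $$M(\vec X^{m+1})=M(\vec X^m),\qquad m=0,\dots,M-1.$$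
   Context: Domain. Points of the half-plane $\{r\ge0\}\subset\mathbb R^2$ are written $(r,z)$, with $\vec e_1=(1,0)^T$, $\vec e_2=(0,1)^T$. $\mathcal R\subset\{r>0\}$ is a bounded polygonal domain with boundary $\partial\mathcal R=\partial_1\mathcal R\cup\partial_2\mathcal R\cup\partial_z\mathcal R$, where $\partial_z\mathcal R$ is the part on the $z$-axis $\{r=0\}$; $\vec n$ is its outer unit normal. $\mathbb I=(0,1)$, $\partial\mathbb I=\{0,1\}$. $(\cdot,\cdot)$ and $\langle\cdot,\cdot\rangle$ are the $L^2$-inner products over $\mathcal R$ and $\mathbb I$ (for scalars, vectors, or matrices with the Frobenius product), and $\|\cdot\|$ is the norm induced by $(\cdot,\cdot)$. $\nabla_c=\vec e_1\partial_r+\vec e_2\partial_z$, $\mathbb D_c(\vec u)=\frac12[\nabla_c\vec u+(\nabla_c\vec u)^T]$, and $\mathscr A(\rho,\vec v;\vec u,\vec\chi)=\frac12\big(\rho\,r,[\vec v\cdot\nabla_c]\vec u\cdot\vec\chi-[\vec v\cdot\nabla_c]\vec\chi\cdot\vec u\big)$. Constants $\rho_\pm,\mu_\pm,\gamma>0$ and a body acceleration $\vec g$ with values in $\mathbb R^2$ (e.g. constant) are given. $1_A$ is the characteristic function of a set $A$. Spaces. $L^2_a(\mathcal R)=\{\chi:\int_{\mathcal R}r^a\chi^2\,dr\,dz<\infty\}$; $H^1_a(\mathcal R)=\{\chi\in L^2_a:\partial_r\chi,\partial_z\chi\in L^2_a\}$. $\mathbb U=\{\vec\chi\in[H^1_1(\mathcal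 R)]^2:\vec\chi\cdot\vec e_1\in L^2_{-1}(\mathcal R),\ \vec\chi=\vec0\text{ on }\partial_1\mathcal R,\ \vec\chi\cdot\vec n=0\text{ on }\partial_2\mathcal R\}$; $\mathbb P=\{\chi\in L^2_1(\mathcal R):\int_{\mathcal R}r\chi\,dr\,dz=0\}$; $V_\partial=\{\vec\eta\in[H^1(\mathbb I)]^2:\vec\eta\cdot\vec e_1=0\text{ on }\partial\mathbb I\}$. Discretization. $\Delta t=T/M$, $t_m=m\Delta t$. With $h=1/J_\Gamma$, $\alpha_j=jh$, $\mathbb I_j=[\alpha_{j-1},\alpha_j]$, $V^h$ is the space of continuous functions on $\overline{\mathbb I}$ that are affine on each $\mathbb I_j$, $1\le j\le J_\Gamma$, and $V^h_\partial=[V^h]^2\cap V_\partial$. Curves: $\vec X^m\in V^h_\partial$, $\Gamma^m=\vec X^m(\overline{\mathbb I})$, with standing assumption $\vec X^m\cdot\vec e_1>0$ in $\mathbb I$ and $|\vec X^m_\alpha|>0$ in $\mathbb I$ for $0\le m\le M$ (subscript $\alpha$ is differentiation in $\alpha$). $\vec\tau^m=\vec X^m_\alpha/|\vec X^m_\alpha|$, $\vec\nu^m=-(\vec\tau^m)^\perp$, where $\perp$ is clockwise rotation by $\pi/2$. $\Gamma^m$ divides $\mathcal R$ into $\mathcal R^m_-$ (enclosed by $\Gamma^m$ and $\partial_z\mathcal R$) and $\mathcal R^m_+$, and $\vec\nu^m$ points into $\mathcal R^m_+$. In integrals over $\mathbb I$, bulk functions such as $\vec U^{m+1}$, $\vec\chi$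 are evaluated at $\vec X^m(\alpha)$. For each $m$, $\mathscr T^m$ is a regular partition of $\overline{\mathcal R}$ into finitely many disjoint non-degenerate open triangles (not necessarily fitted to $\Gamma^m$). $S^m_k$ ($k\ge1$): continuous functions on $\overline{\mathcal R}$ that are polynomials of degree $\le k$ on each triangle; $S^m_0$: piecewise constants. $\mathbb U^m=[S^m_2]^2\cap\mathbb U$. $\mathbb P^m$ is either $S_1^m\cap\mathbb P$, or this space enriched by the single function $1_{\mathcal R^m_-}-\omega^m$ with $\omega^m=\int_{\mathcal R^m_-}r\,dr\,dz/\int_{\mathcal R}r\,dr\,dz$; in either case $\mathbb P^m\subset\mathbb P$. $I_2^m:[C(\overline{\mathcal R})]^2\to[S_2^m]^2$ is standard Lagrange interpolation; $I_0^m:L^1(\mathcal R)\to S^m_0$ is $(I_0^m\eta)|_o=|o|^{-1}\int_o\eta\,dr\,dz$. $\rho^m,\mu^m\in S_0^m$ equal $\rho_\pm,\mu_\pm$ on triangles contained in $\mathcal R^m_\pm$, and $\frac12(\rho_-+\rho_+)$, $\frac12(\mu_-+\mu_+)$ on triangles meeting $\Gamma^m$. Set $\rho^{-1}=\rho^0$. Initial data: $\vec U^0\in\mathbb U^0$, $\vec X^0\in V^h_\partial$; for $m\ge1$, $\vec U^m\in\mathbb U^{m-1}$ is the velocity computed at the previous step. $(\cdot,\cdot)^\diamond$ is an approximation of $(\cdot,\cdot)$ by an elementwise quadrature rule with nonnegative weights and only interior sampling points (so that terms with $r^{-1}$ are well defined), and $\|\cdot\|_\diamond$ is its induced (semi)norm.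 Energy: $E(\rho,\vec u,\vec X)=\pi(\rho|\vec u|^2,r)+2\pi\gamma\langle\vec X\cdot\vec e_1,|\vec X_\alpha|\rangle$. Enclosed volume: $M(\vec X)=\pi\langle(\vec X\cdot\vec e_1)^2\,\vec\nu,\vec e_1|\vec X_\alpha|\rangle$ with $\vec\nu|\vec X_\alpha|=-(\vec X_\alpha)^\perp$ (not to be confused with the number $M$ of time steps). *)

theory Defs
  imports "HOL-Analysis.Analysis"
begin

text \<open>
  A point of the meridian half-plane is a vector \<open>x :: real^2\<close> with \<open>x $ 1 = r\<close> and
  \<open>x $ 2 = z\<close>; matrices have type \<open>real^2^2\<close>, whose \<open>inner\<close> is the Frobenius product.
  Integrals are taken with respect to the completed Lebesgue measure, so that values on null sets
  (edges of a mesh, nodes of a curve, where the functions and derivatives below carry unspecified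
  values) are irrelevant.
\<close>

abbreviation e1 :: "real^2" where "e1 \<equiv> axis 1 1"

abbreviation unit_I :: "real set" where "unit_I \<equiv> {0<..<1}"

definition l2_inner :: "'a::euclidean_space set \<Rightarrow> ('a \<Rightarrow> 'b::real_inner) \<Rightarrow> ('a \<Rightarrow> 'b) \<Rightarrow> real"
  where "l2_inner S f g = (LINT x:S|lebesgue. f x \<bullet> g x)"

definition l2_norm :: "'a::euclidean_space set \<Rightarrow> ('a \<Rightarrow> 'b::real_inner) \<Rightarrow> real"
  where "l2_norm S f = sqrt (l2_inner S f f)"


section \<open>Differential operators\<close>

text \<open>
  Classical derivatives. They are only applied to continuous piecewise polynomial fields, for which
  they exist off a null set and coincide there with the weak derivatives.
\<close>

definition pd :: "2 \<Rightarrow> (real^2 \<Rightarrow> 'b::real_normed_vector) \<Rightarrow> real^2 \<Rightarrow> 'b"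
  where "pd i u x = frechet_derivative u (at x) (axis i 1)"

definition grad :: "(real^2 \<Rightarrow> real^2) \<Rightarrow> real^2 \<Rightarrow> real^2^2"
  where "grad u x = (\<chi> i j. pd i u x $ j)"

definition sym_grad :: "(real^2 \<Rightarrow> real^2) \<Rightarrow> real^2 \<Rightarrow> real^2^2"
  where "sym_grad u x = (1/2) *\<^sub>R (grad u x + transpose (grad u x))"

definition divergence :: "(real^2 \<Rightarrow> real^2) \<Rightarrow> real^2 \<Rightarrow> real"
  where "divergence u x = (\<Sum>i\<in>UNIV. pd i u x $ i)"

definition convective :: "(real^2 \<Rightarrow> real^2) \<Rightarrow> (real^2 \<Rightarrow> real^2) \<Rightarrow> real^2 \<Rightarrow> real^2"
  where "convective v u x = (\<Sum>i\<in>UNIV. v x $ i *\<^sub>R pd i u x)"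

definition adv_form :: "(real^2) set \<Rightarrow> (real^2 \<Rightarrow> real) \<Rightarrow> (real^2 \<Rightarrow> real^2) \<Rightarrow>
    (real^2 \<Rightarrow> real^2) \<Rightarrow> (real^2 \<Rightarrow> real^2) \<Rightarrow> real"
  where "adv_form R \<rho> v u w =
    1/2 * l2_inner R (\<lambda>x. \<rho> x * x $ 1) (\<lambda>x. convective v u x \<bullet> w x - convective v w x \<bullet> u x)"


section \<open>The domain\<close>

text \<open>\<open>interior (closure R) = R\<close> excludes slits and isolated boundary points.\<close>

definition polygonal_domain :: "(real^2) set \<Rightarrow> bool"
  where "polygonal_domain R \<longleftrightarrow>
    open R \<and> connected R \<and> bounded R \<and> R \<noteq> {} \<and> interior (closure R) = R \<and>
    (\<exists>E. finite E \<and> frontier R = (\<Union>(a, b)\<in>E. closed_segment a b))"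

definition axis_boundary :: "(real^2) set \<Rightarrow> (real^2) set"
  where "axis_boundary R = {x \<in> frontier R. x $ 1 = 0}"

text \<open>Exists (and is then unique) exactly at the boundary points that are not corners.\<close>

definition is_outer_normal :: "(real^2) set \<Rightarrow> real^2 \<Rightarrow> real^2 \<Rightarrow> bool"
  where "is_outer_normal R x n \<longleftrightarrow>
    norm n = 1 \<and> (\<exists>e>0. R \<inter> ball x e = {y \<in> ball x e. (y - x) \<bullet> n < 0})"


section \<open>Function spaces\<close>

coinductive smooth :: "('a::euclidean_space \<Rightarrow> real) \<Rightarrow> bool" where
  "(\<And>x. f differentiable (at x)) \<Longrightarrow> (\<And>v. smooth (\<lambda>x. frechet_derivative f (at x) v)) \<Longrightarrow> smooth f"

definition test_functions :: "'a::euclidean_space set \<Rightarrow> ('a \<Rightarrow> real) set"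
  where "test_functions S = {\<phi>. smooth \<phi> \<and> (\<exists>K. compact K \<and> K \<subseteq> S \<and> (\<forall>x. x \<notin> K \<longrightarrow> \<phi> x = 0))}"

definition has_weak_deriv :: "'a::euclidean_space set \<Rightarrow> ('a \<Rightarrow> real) \<Rightarrow> 'a \<Rightarrow> ('a \<Rightarrow> real) \<Rightarrow> bool"
  where "has_weak_deriv S f v g \<longleftrightarrow> (\<forall>\<phi>\<in>test_functions S.
    (LINT x:S|lebesgue. f x * frechet_derivative \<phi> (at x) v) = - (LINT x:S|lebesgue. g x * \<phi> x))"

definition L2 :: "'a::euclidean_space set \<Rightarrow> ('a \<Rightarrow> real) set"
  where "L2 S = {f. set_borel_measurable lebesgue S f \<and> set_integrable lebesgue S (\<lambda>x. (f x)\<^sup>2)}"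

definition H1_interval :: "(real \<Rightarrow> real) set"
  where "H1_interval = {f \<in> L2 unit_I. \<exists>g \<in> L2 unit_I. has_weak_deriv unit_I f 1 g}"

definition L2w :: "real \<Rightarrow> (real^2) set \<Rightarrow> (real^2 \<Rightarrow> real) set"
  where "L2w a S = {f. set_borel_measurable lebesgue S f \<and>
    set_integrable lebesgue S (\<lambda>x. x $ 1 powr a * (f x)\<^sup>2)}"

definition H1w :: "real \<Rightarrow> (real^2) set \<Rightarrow> (real^2 \<Rightarrow> real) set"
  where "H1w a S = {f \<in> L2w a S. \<forall>i. \<exists>g \<in> L2w a S. has_weak_deriv S f (axis i 1) g}"

text \<open>
  The members of the velocity space that are continuous up to the boundary, so that the boundary
  conditions hold pointwise instead of in the sense of traces. Only the intersection with a space
  of continuous finite element functions is used.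
\<close>

definition velocity_space ::
    "(real^2) set \<Rightarrow> (real^2) set \<Rightarrow> (real^2) set \<Rightarrow> (real^2 \<Rightarrow> real^2) set"
  where "velocity_space R D1 D2 = {u. continuous_on (closure R) u \<and>
    (\<forall>i. (\<lambda>x. u x $ i) \<in> H1w 1 R) \<and> (\<lambda>x. u x \<bullet> e1) \<in> L2w (-1) R \<and>
    (\<forall>x\<in>D1. u x = 0) \<and> (\<forall>x\<in>D2. \<forall>n. is_outer_normal R x n \<longrightarrow> u x \<bullet> n = 0)}"

definition pressure_space :: "(real^2) set \<Rightarrow> (real^2 \<Rightarrow> real) set"
  where "pressure_space R = {p \<in> L2w 1 R. (LINT x:R|lebesgue. x $ 1 * p x) = 0}"

text \<open>Elements of \<open>H\<^sup>1\<close> on the interval are identified with their continuous representatives.\<close>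

definition curve_space :: "(real \<Rightarrow> real^2) set"
  where "curve_space = {\<eta>. continuous_on {0..1} \<eta> \<and> (\<forall>i. (\<lambda>\<alpha>. \<eta> \<alpha> $ i) \<in> H1_interval) \<and>
    \<eta> 0 \<bullet> e1 = 0 \<and> \<eta> 1 \<bullet> e1 = 0}"


section \<open>Curves\<close>

definition Vh :: "nat \<Rightarrow> (real \<Rightarrow> 'b::real_normed_vector) set"
  where "Vh J = {f. continuous_on {0..1} f \<and>
    (\<forall>j\<in>{1..J}. \<exists>a b. \<forall>\<alpha>\<in>{(real j - 1) / real J .. real j / real J}. f \<alpha> = a + \<alpha> *\<^sub>R b)}"

definition Vh_bd :: "nat \<Rightarrow> (real \<Rightarrow> real^2) set"
  where "Vh_bd J = Vh J \<inter> curve_space"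

definition dcurve :: "(real \<Rightarrow> real^2) \<Rightarrow> real \<Rightarrow> real^2"
  where "dcurve X \<alpha> = vector_derivative X (at \<alpha>)"

text \<open>Clockwise rotation by \<open>\<pi>/2\<close>.\<close>

definition perp :: "real^2 \<Rightarrow> real^2"
  where "perp v = vector [v $ 2, - (v $ 1)]"

definition tangent :: "(real \<Rightarrow> real^2) \<Rightarrow> real \<Rightarrow> real^2"
  where "tangent X \<alpha> = dcurve X \<alpha> /\<^sub>R norm (dcurve X \<alpha>)"

definition normal :: "(real \<Rightarrow> real^2) \<Rightarrow> real \<Rightarrow> real^2"
  where "normal X \<alpha> = - perp (tangent X \<alpha>)"

definition f_half :: "(real \<Rightarrow> real^2) \<Rightarrow> (real \<Rightarrow> real^2) \<Rightarrow> real \<Rightarrow> real^2"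
  where "f_half X Y \<alpha> =
    (let Z = (\<lambda>\<beta>. (1/2) *\<^sub>R (X \<beta> + Y \<beta>)) in
      - (1/6) *\<^sub>R perp ((X \<alpha> \<bullet> e1) *\<^sub>R dcurve X \<alpha> + (4 * (Z \<alpha> \<bullet> e1)) *\<^sub>R dcurve Z \<alpha>
        + (Y \<alpha> \<bullet> e1) *\<^sub>R dcurve Y \<alpha>))"

definition energy :: "(real^2) set \<Rightarrow> real \<Rightarrow> (real^2 \<Rightarrow> real) \<Rightarrow> (real^2 \<Rightarrow> real^2) \<Rightarrow>
    (real \<Rightarrow> real^2) \<Rightarrow> real"
  where "energy R \<gamma> \<rho> u X =
    pi * l2_inner R (\<lambda>x. \<rho> x * (norm (u x))\<^sup>2) (\<lambda>x. x $ 1)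
    + 2 * pi * \<gamma> * l2_inner unit_I (\<lambda>\<alpha>. X \<alpha> \<bullet> e1) (\<lambda>\<alpha>. norm (dcurve X \<alpha>))"

definition enclosed_volume :: "(real \<Rightarrow> real^2) \<Rightarrow> real"
  where "enclosed_volume X = pi * l2_inner unit_I
    (\<lambda>\<alpha>. (X \<alpha> \<bullet> e1)\<^sup>2 *\<^sub>R normal X \<alpha>) (\<lambda>\<alpha>. norm (dcurve X \<alpha>) *\<^sub>R e1)"


section \<open>The two phases\<close>

definition inner_phase :: "(real^2) set \<Rightarrow> (real \<Rightarrow> real^2) \<Rightarrow> (real^2) set"
  where "inner_phase R X = R \<inter> inside (X ` {0..1} \<union> axis_boundary R)"

definition outer_phase :: "(real^2) set \<Rightarrow> (real \<Rightarrow> real^2) \<Rightarrow> (real^2) set"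
  where "outer_phase R X = R - X ` {0..1} - inner_phase R X"

text \<open>
  The curve is simple, lies in the domain (apart from its end points on the axis), and crossing it
  in the direction of the normal leads from the inner into the outer phase. An end point may in
  principle coincide with the other one.
\<close>

definition divides :: "(real \<Rightarrow> real^2) \<Rightarrow> (real^2) set \<Rightarrow> bool"
  where "divides X R \<longleftrightarrow> inj_on X unit_I \<and> X ` unit_I \<subseteq> R \<and>
    (\<forall>\<alpha>\<in>unit_I. X differentiable (at \<alpha>) \<longrightarrow>
      (\<forall>\<^sub>F e in at_right 0. X \<alpha> + e *\<^sub>R normal X \<alpha> \<in> outer_phase R X \<and>
                          X \<alpha> - e *\<^sub>R normal X \<alpha> \<in> inner_phase R X))"

definition omega :: "(real^2) set \<Rightarrow> (real \<Rightarrow> real^2) \<Rightarrow> real"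
  where "omega R X = (LINT x:inner_phase R X|lebesgue. x $ 1) / (LINT x:R|lebesgue. x $ 1)"

definition phase_function :: "(real^2) set \<Rightarrow> (real \<Rightarrow> real^2) \<Rightarrow> real^2 \<Rightarrow> real"
  where "phase_function R X x = indicator (inner_phase R X) x - omega R X"


section \<open>Finite elements\<close>

text \<open>
  A mesh is represented by its closed triangles \<open>K\<close>; the open triangles are their interiors.
  Conformity (two elements meet in a common face) is part of the library's \<open>triangulation\<close>.
\<close>

definition is_mesh :: "(real^2) set \<Rightarrow> (real^2) set set \<Rightarrow> bool"
  where "is_mesh R \<T> \<longleftrightarrow> triangulation \<T> \<and> (\<forall>K\<in>\<T>. 2 simplex K) \<and> \<Union>\<T> = closure R"

definition FE :: "(real^2) set \<Rightarrow> (real^2) set set \<Rightarrow> nat \<Rightarrow> (real^2 \<Rightarrow> real) set"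
  where "FE R \<T> k = {f. continuous_on (closure R) f \<and>
    (\<forall>K\<in>\<T>. \<exists>c :: nat \<Rightarrow> nat \<Rightarrow> real. \<forall>x\<in>K.
       f x = (\<Sum>i\<le>k. \<Sum>j\<le>k - i. c i j * (x $ 1) ^ i * (x $ 2) ^ j))}"

definition FEvec :: "(real^2) set \<Rightarrow> (real^2) set set \<Rightarrow> nat \<Rightarrow> (real^2 \<Rightarrow> real^2) set"
  where "FEvec R \<T> k = {u. \<forall>i. (\<lambda>x. u x $ i) \<in> FE R \<T> k}"

definition discrete_velocities ::
    "(real^2) set \<Rightarrow> (real^2) set \<Rightarrow> (real^2) set \<Rightarrow> (real^2) set set \<Rightarrow> (real^2 \<Rightarrow> real^2) set"
  where "discrete_velocities R D1 D2 \<T> = FEvec R \<T> 2 \<inter> velocity_space R D1 D2"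

definition P1_pressures :: "(real^2) set \<Rightarrow> (real^2) set set \<Rightarrow> (real^2 \<Rightarrow> real) set"
  where "P1_pressures R \<T> = FE R \<T> 1 \<inter> pressure_space R"

definition enriched_pressures ::
    "(real^2) set \<Rightarrow> (real^2) set set \<Rightarrow> (real \<Rightarrow> real^2) \<Rightarrow> (real^2 \<Rightarrow> real) set"
  where "enriched_pressures R \<T> X =
    {(\<lambda>x. p x + c * phase_function R X x) | p c. p \<in> P1_pressures R \<T>}"

text \<open>Vertices and edge midpoints, the vertices being the midpoints with \<open>a = b\<close>.\<close>

definition nodes2 :: "(real^2) set \<Rightarrow> (real^2) set"
  where "nodes2 K = {midpoint a b | a b. a extreme_point_of K \<and> b extreme_point_of K}"

text \<open>The choice is unique on \<open>closure R\<close>.\<close>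

definition lagrange2 ::
    "(real^2) set \<Rightarrow> (real^2) set set \<Rightarrow> (real^2 \<Rightarrow> real^2) \<Rightarrow> real^2 \<Rightarrow> real^2"
  where "lagrange2 R \<T> u = (SOME w. w \<in> FEvec R \<T> 2 \<and> (\<forall>K\<in>\<T>. \<forall>p\<in>nodes2 K. w p = u p))"

definition average0 :: "(real^2) set set \<Rightarrow> (real^2 \<Rightarrow> real) \<Rightarrow> real^2 \<Rightarrow> real"
  where "average0 \<T> f x = (\<Sum>K\<in>\<T>. indicator (interior K) x *
    ((LINT y:interior K|lebesgue. f y) / measure lebesgue (interior K)))"

text \<open>
  Under \<open>divides\<close>, an open triangle that lies in neither phase is one that meets the curve.
\<close>

definition phase_coeff :: "(real^2) set \<Rightarrow> (real^2) set set \<Rightarrow> (real \<Rightarrow> real^2) \<Rightarrow> real \<Rightarrow> real \<Rightarrow>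
    real^2 \<Rightarrow> real"
  where "phase_coeff R \<T> X cm cp x = (\<Sum>K\<in>\<T>. indicator (interior K) x *
    (if interior K \<subseteq> inner_phase R X then cm
     else if interior K \<subseteq> outer_phase R X then cp
     else (cm + cp) / 2))"

text \<open>Density of the previous time level, with the convention that level \<open>-1\<close> is level \<open>0\<close>.\<close>

definition prev :: "(nat \<Rightarrow> 'b) \<Rightarrow> nat \<Rightarrow> 'b"
  where "prev \<rho> m = (case m of 0 \<Rightarrow> \<rho> 0 | Suc k \<Rightarrow> \<rho> k)"

definition is_quadrature ::
    "(real^2) set set \<Rightarrow> ((real^2) set \<Rightarrow> (real^2) set) \<Rightarrow> ((real^2) set \<Rightarrow> real^2 \<Rightarrow> real) \<Rightarrow> bool"
  where "is_quadrature \<T> Q wt \<longleftrightarrow>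
    (\<forall>K\<in>\<T>. finite (Q K) \<and> Q K \<subseteq> interior K \<and> (\<forall>x\<in>Q K. wt K x \<ge> 0))"

definition quad_inner :: "(real^2) set set \<Rightarrow> ((real^2) set \<Rightarrow> (real^2) set) \<Rightarrow>
    ((real^2) set \<Rightarrow> real^2 \<Rightarrow> real) \<Rightarrow> (real^2 \<Rightarrow> real) \<Rightarrow> (real^2 \<Rightarrow> real) \<Rightarrow> real"
  where "quad_inner \<T> Q wt f g = (\<Sum>K\<in>\<T>. \<Sum>x\<in>Q K. wt K x * (f x * g x))"

definition quad_norm :: "(real^2) set set \<Rightarrow> ((real^2) set \<Rightarrow> (real^2) set) \<Rightarrow>
    ((real^2) set \<Rightarrow> real^2 \<Rightarrow> real) \<Rightarrow> (real^2 \<Rightarrow> real) \<Rightarrow> real"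
  where "quad_norm \<T> Q wt f = sqrt (quad_inner \<T> Q wt f f)"

end

theory Submission
  imports Defs
begin

text \<open>
  Testing the momentum equation with the new velocity, the kinematic equation with the new curvature
  and the curvature equation with the displacement of the curve cancels the pressure and the
  curvature terms. What remains is the kinetic increment, bounded below since
  \<open>\<rho> |u - v|\<^sup>2 \<ge> 0\<close>, and the area increment, bounded below pointwise by
  \<open>b \<bullet> (b - a) / |a| \<ge> |b| - |a|\<close>. All integrals must exist for this to make sense, so the
  Lagrange interpolant has to be constructed.

  The mean normal \<open>f_half\<close> is an exact Simpson rule for the volume difference, so that testing the
  kinematic equation with \<open>1\<close> reduces (c) to a vanishing flux of the weighted velocity through the curve.
  This follows from incompressibility tested with the phase function and the divergence theorem on
  the inner phase and on the whole domain. Both sets have a boundary contained in finitely many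
  straight lines, and for such sets the divergence theorem is Fubini plus the fundamental theorem of
  calculus on the intervals cut out of almost every axis-parallel line.
\<close>

section \<open>Quadratic Lagrange interpolation\<close>

text \<open>Since the integral of a non-integrable function is 0 by convention, every use of
  linearity must be paid for with integrability. The viscous and body-force terms are therefore kept
  as whole integrals. Classical derivatives have arbitrary values on mesh edges and at curve nodes,
  so integrands are exchanged almost everywhere. For (c) the obstacle is that the mesh is not fitted
  to the curve: the inner phase is not a union of triangles, and elementwise integration by parts
  does not match it. All lines through boundary edges, mesh edges and curve segments are put into
  one arrangement instead. The velocity is continuous and differentiable off these lines, which is
  enough for the fundamental theorem of calculus across them, so that mesh edges produce no boundary
  terms. Of the boundary of the inner phase only the curve carries flux: elsewhere the velocity, its
  normal component or the weight \<open>r\<close> vanishes. The flux through the whole boundary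
  enters because of the constant \<open>omega\<close> in the phase function. Which side of the curve
  is which comes from \<open>divides\<close>, so nothing about orientation has to be derived from
  topology.\<close>

lemma affine_interpolation_exists:
  fixes V :: "'a::euclidean_space set" and g :: "'a \<Rightarrow> real"
  assumes "\<not> affine_dependent V"
  shows "\<exists>b c. \<forall>v\<in>V. b \<bullet> v + c = g v"
proof (cases "V = {}")
  case False
  then obtain v0 where v0: "v0 \<in> V" by auto
  define B where "B = (\<lambda>v. v - v0) ` (V - {v0})"
  have "independent B"
    using assms v0 affine_dependent_iff_dependent2[OF v0] by (simp add: B_def)
  then obtain l :: "'a \<Rightarrow> real" where l: "linear l" "\<forall>x\<in>B. l x = g (x + v0) - g v0"
    using linear_independent_extend[of B "\<lambda>x. g (x + v0) - g v0"] by auto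
  \<comment> \<open>The vector that represents the linear form \<open>l\<close> through the inner
    product.\<close>
  define b where "b = adjoint l 1"
  have lb: "l x = b \<bullet> x" for x
    using adjoint_works[OF l(1), of x 1] by (simp add: b_def inner_commute)
  have "b \<bullet> v + (g v0 - b \<bullet> v0) = g v" if "v \<in> V" for v
  proof (cases "v = v0")
    case False
    then have "v - v0 \<in> B" using that by (auto simp: B_def)
    then have "l (v - v0) = g v - g v0" using l(2) by force
    then show ?thesis by (simp add: lb inner_diff_right)
  qed simp
  then show ?thesis by blast
qed simp

text \<open>The barycentric coordinate of \<open>v\<close> with respect to \<open>V\<close>,
  extended to an affine function on the whole space. For a proper face the extension is not unique,
  but its values on the affine hull of \<open>V\<close> are.\<close>

definition bary :: "'a::euclidean_space set \<Rightarrow> 'a \<Rightarrow> 'a \<Rightarrow> real"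
  where "bary V v = (SOME h. \<exists>b c. h = (\<lambda>x. b \<bullet> x + c) \<and> (\<forall>w\<in>V. h w = of_bool (w = v)))"

lemma bary_affine:
  assumes "\<not> affine_dependent V"
  obtains b c where "bary V v = (\<lambda>x. b \<bullet> x + c)" "\<And>w. w \<in> V \<Longrightarrow> b \<bullet> w + c = of_bool (w = v)"
proof -
  obtain b c where "\<forall>w\<in>V. b \<bullet> w + c = of_bool (w = v)"
    using affine_interpolation_exists[OF assms, of "\<lambda>w. of_bool (w = v)"] by blast
  then have "\<exists>h b c. h = (\<lambda>x. b \<bullet> x + c) \<and> (\<forall>w\<in>V. h w = of_bool (w = v))"
    by (intro exI[of _ "\<lambda>x. b \<bullet> x + c"] exI[of _ b] exI[of _ c]) simp
  then obtain b c where "bary V v = (\<lambda>x. b \<bullet> x + c)" "\<forall>w\<in>V. bary V v w = of_bool (w = v)"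
    unfolding bary_def by (elim someI_ex[THEN exE]) blast
  then show ?thesis using that[of b c] by simp
qed

lemma bary_eq_coefficient:
  assumes "\<not> affine_dependent V" "W \<subseteq> V" "finite W" "sum a W = 1"
  shows "bary V v (\<Sum>w\<in>W. a w *\<^sub>R w) = (if v \<in> W then a v else 0)"
proof -
  obtain b c where bc: "bary V v = (\<lambda>x. b \<bullet> x + c)" "\<And>w. w \<in> V \<Longrightarrow> b \<bullet> w + c = of_bool (w = v)"
    using bary_affine[OF assms(1)] by blast
  have "bary V v (\<Sum>w\<in>W. a w *\<^sub>R w) = (\<Sum>w\<in>W. a w * (b \<bullet> w + c))"
    using assms(4) by (simp add: bc inner_sum_right distrib_left sum.distrib flip: sum_distrib_right)
  also have "\<dots> = (\<Sum>w\<in>W. a w * of_bool (w = v))"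
    using assms(2) by (intro sum.cong) (auto simp: bc(2))
  also have "\<dots> = (if v \<in> W then a v else 0)"
    using assms(3) by (simp add: of_bool_def if_distrib cong: if_cong)
  finally show ?thesis .
qed

text \<open>A point of the face spanned by \<open>W\<close> is one and the same affine combination
  of vertices in both coordinate systems; the vertices outside \<open>W\<close> get coefficient
  0.\<close>

lemma bary_subset:
  assumes "\<not> affine_dependent V" "W \<subseteq> V" "finite V" "x \<in> convex hull W" "v \<in> V"
  shows "bary V v x = (if v \<in> W then bary W v x else 0)"
proof -
  have fin: "finite W" using assms finite_subset by blast
  obtain a where a: "sum a W = 1" "x = (\<Sum>w\<in>W. a w *\<^sub>R w)"
    using assms(4) fin by (auto simp: convex_hull_finite)
  have ind: "\<not> affine_dependent W" using assms(1) affine_dependent_subset[OF _ assms(2)] by auto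
  show ?thesis
    unfolding a(2) bary_eq_coefficient[OF assms(1,2) fin a(1)]
      bary_eq_coefficient[OF ind subset_refl fin a(1)] by simp
qed

text \<open>The quadratic Lagrange interpolant on the simplex with vertex set \<open>V\<close>: the diagonal terms
  \<open>v = w\<close> of the double sum turn \<open>- bary V v x\<close> into the usual \<open>\<lambda>\<^sub>v (2 \<lambda>\<^sub>v - 1)\<close>.\<close>

definition interp2 :: "'a::euclidean_space set \<Rightarrow> ('a \<Rightarrow> 'b::real_vector) \<Rightarrow> 'a \<Rightarrow> 'b"
  where "interp2 V u x = (\<Sum>v\<in>V. \<Sum>w\<in>V. (2 * bary V v x * bary V w x) *\<^sub>R u (midpoint v w))
    - (\<Sum>v\<in>V. bary V v x *\<^sub>R u v)"

text \<open>Every product of coordinates that involves a vertex outside \<open>W\<close> vanishes on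
  the face. This makes the interpolants of neighbouring triangles agree on a common edge or
  vertex.\<close>

lemma interp2_face:
  assumes "\<not> affine_dependent V" "W \<subseteq> V" "finite V" "x \<in> convex hull W"
  shows "interp2 V u x = interp2 W u x"
proof -
  note b = bary_subset[OF assms]
  have 1: "(\<Sum>v\<in>V. bary V v x *\<^sub>R h v) = (\<Sum>v\<in>W. bary W v x *\<^sub>R h v)" for h :: "'a \<Rightarrow> 'b"
    using assms by (intro sum.mono_neutral_cong_right) (auto simp: b)
  have 2: "(\<Sum>w\<in>V. (2 * bary V v x * bary V w x) *\<^sub>R h w) = (2 * bary V v x) *\<^sub>R (\<Sum>w\<in>V. bary V w x *\<^sub>R h w)"
    for v V and h :: "'a \<Rightarrow> 'b"
    by (simp add: scaleR_sum_right)
  have 3: "(\<Sum>v\<in>V. (2 * bary V v x) *\<^sub>R h v) = 2 *\<^sub>R (\<Sum>v\<in>V. bary V v x *\<^sub>R h v)" 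
    for V and h :: "'a \<Rightarrow> 'b"
    by (simp add: scaleR_sum_right)
  show ?thesis unfolding interp2_def 2 3 1 ..
qed

text \<open>With coordinate 1/2 at \<open>a\<close> and at \<open>b\<close>, the double sum is
  \<open>u (midpoint a b)\<close> plus the mean of \<open>u a\<close> and \<open>u b\<close>, and
  the subtracted sum removes this mean. The formula for the coordinates also covers
  \<open>a = b\<close>, that is, the vertices.\<close>

lemma interp2_node:
  assumes "\<not> affine_dependent V" "finite V" "a \<in> V" "b \<in> V"
  shows "interp2 V u (midpoint a b) = u (midpoint a b)"
proof -
  have b: "bary V v (midpoint a b) = (of_bool (v = a) + of_bool (v = b)) / 2" for v
  proof -
    obtain d c where dc: "bary V v = (\<lambda>x. d \<bullet> x + c)" "\<And>w. w \<in> V \<Longrightarrow> d \<bullet> w + c = of_bool (w = v)"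
      using bary_affine[OF assms(1)] by blast
    have "bary V v (midpoint a b) = ((d \<bullet> a + c) + (d \<bullet> b + c)) / 2"
      by (simp add: dc(1) midpoint_def inner_add_right field_simps)
    then show ?thesis using assms(3,4) by (simp add: dc(2) eq_commute)
  qed
  have s: "(\<Sum>v\<in>V. ((of_bool (v = a) + of_bool (v = b)) / 2) *\<^sub>R h v) = (1/2) *\<^sub>R (h a + h b)" 
    for h :: "'a \<Rightarrow> 'b"
  proof -
    have "(\<Sum>v\<in>V. ((of_bool (v = a) + of_bool (v = b)) / 2) *\<^sub>R h v)
      = (\<Sum>v\<in>V. (if v = a then (1/2) *\<^sub>R h v else 0)) + (\<Sum>v\<in>V. if v = b then (1/2) *\<^sub>R h v else 0)"
      unfolding sum.distrib[symmetric]
      by (intro sum.cong) (auto simp: scaleR_add_left[symmetric])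
    then show ?thesis using assms by (simp add: scaleR_add_right)
  qed
  have 2: "(\<Sum>v\<in>V. \<Sum>w\<in>V. (2 * k v * k w) *\<^sub>R h v w) = 2 *\<^sub>R (\<Sum>v\<in>V. k v *\<^sub>R (\<Sum>w\<in>V. k w *\<^sub>R h v w))"
    for k and h :: "'a \<Rightarrow> 'a \<Rightarrow> 'b"
    by (simp add: scaleR_sum_right mult.assoc)
  show ?thesis
    unfolding interp2_def 2 b s
    by (simp add: midpoint_sym[of b a] algebra_simps flip: scaleR_2)
qed

section \<open>Quadratic polynomials and the gluing of local interpolants\<close>

definition poly2 :: "(real^2 \<Rightarrow> real) \<Rightarrow> bool"
  where "poly2 f \<longleftrightarrow> (\<exists>c :: nat \<Rightarrow> nat \<Rightarrow> real. \<forall>x.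
    f x = (\<Sum>i\<le>2. \<Sum>j\<le>2 - i. c i j * (x $ 1) ^ i * (x $ 2) ^ j))"

lemma poly2_iff: "poly2 f \<longleftrightarrow> (\<exists>a b c d e k. \<forall>x. 
    f x = a + b * x $ 1 + c * x $ 2 + d * (x $ 1)\<^sup>2 + e * (x $ 1 * x $ 2) + k * (x $ 2)\<^sup>2)"
  (is "_ = ?R")
proof
  assume "poly2 f"
  then obtain c :: "nat \<Rightarrow> nat \<Rightarrow> real" where
    "\<forall>x. f x = (\<Sum>i\<le>2. \<Sum>j\<le>2 - i. c i j * (x $ 1) ^ i * (x $ 2) ^ j)"
    unfolding poly2_def by blast
  then have "\<forall>x. f x = c 0 0 + c 1 0 * x $ 1 + c 0 1 * x $ 2 + c 2 0 * (x $ 1)\<^sup>2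
      + c 1 1 * (x $ 1 * x $ 2) + c 0 2 * (x $ 2)\<^sup>2"
    by (simp add: numeral_2_eq_2 algebra_simps)
  then show ?R by blast
next
  assume ?R
  then obtain a b c d e k where f: "\<forall>x. 
    f x = a + b * x $ 1 + c * x $ 2 + d * (x $ 1)\<^sup>2 + e * (x $ 1 * x $ 2) + k * (x $ 2)\<^sup>2" by blast
  show "poly2 f"
    unfolding poly2_def
    by (rule exI[of _ "\<lambda>i j. if (i,j) = (0,0) then a else if (i,j) = (1,0) then b else if (i,j) = (0,1) then c
       else if (i,j) = (2,0) then d else if (i,j) = (1,1) then e else k"])
      (simp add: f numeral_2_eq_2 algebra_simps)
qed

lemma poly2_add: "poly2 f \<Longrightarrow> poly2 g \<Longrightarrow> poly2 (\<lambda>x. f x + g x)"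
  unfolding poly2_def
  apply (elim exE)
  subgoal for c d
    by (rule exI[of _ "\<lambda>i j. c i j + d i j"]) (simp add: sum.distrib distrib_right)
  done

lemma poly2_cmult: "poly2 f \<Longrightarrow> poly2 (\<lambda>x. f x * t)"
  unfolding poly2_def
  apply (elim exE)
  subgoal for c
    by (rule exI[of _ "\<lambda>i j. c i j * t"]) (simp add: sum_distrib_left sum_distrib_right mult_ac)
  done

lemma poly2_sum: "(\<And>i. i \<in> I \<Longrightarrow> poly2 (f i)) \<Longrightarrow> poly2 (\<lambda>x. \<Sum>i\<in>I. f i x)"
proof (induction I rule: infinite_finite_induct)
  case (insert i I)
  then show ?case by (simp add: poly2_add)
qed (auto simp: poly2_def intro!: exI[of _ "\<lambda>_ _. 0"])

lemma poly2_affine_mult: "poly2 (\<lambda>x. (b \<bullet> x + c) * (b' \<bullet> x + c'))"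
  unfolding poly2_iff
  by (rule exI[of _ "c * c'"], rule exI[of _ "b $ 1 * c' + b' $ 1 * c"], rule exI[of _ "b $ 2 * c' + b' $ 2 * c"],
      rule exI[of _ "b $ 1 * b' $ 1"], rule exI[of _ "b $ 1 * b' $ 2 + b $ 2 * b' $ 1"], rule exI[of _ "b $ 2 * b' $ 2"])
    (simp add: inner_vec_def sum_2 power2_eq_square algebra_simps)

lemma poly2_interp2:
  fixes V :: "(real^2) set" and u :: "real^2 \<Rightarrow> real^2"
  assumes "\<not> affine_dependent V"
  shows "poly2 (\<lambda>x. interp2 V u x $ i)"
proof -
  have 1: "poly2 (\<lambda>x. bary V v x * bary V w x)" for v w
  proof -
    obtain b c where "bary V v = (\<lambda>x. b \<bullet> x + c)" using bary_affine[OF assms] by blast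
    moreover obtain b' c' where "bary V w = (\<lambda>x. b' \<bullet> x + c')" using bary_affine[OF assms] by blast
    ultimately show ?thesis by (simp add: poly2_affine_mult)
  qed
  have 2: "poly2 (\<lambda>x. bary V v x)" for v
  proof -
    obtain b c where "bary V v = (\<lambda>x. b \<bullet> x + c)" using bary_affine[OF assms] by blast
    then show ?thesis using poly2_affine_mult[of b c 0 1] by simp
  qed
  have "poly2 (\<lambda>x. (\<Sum>v\<in>V. \<Sum>w\<in>V. (bary V v x * bary V w x) * (2 * u (midpoint v w) $ i)) 
    + (\<Sum>v\<in>V. bary V v x * (- u v $ i)))"
    by (intro poly2_add poly2_sum poly2_cmult 1 2)
  moreover have "interp2 V u x $ i = (\<Sum>v\<in>V. \<Sum>w\<in>V. (bary V v x * bary V w x) * (2 * u (midpoint v w) $ i)) 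
    + (\<Sum>v\<in>V. bary V v x * (- u v $ i))" for x
    unfolding interp2_def by (simp add: sum_negf) (simp only: mult.assoc mult.left_commute[of 2])
  ultimately show ?thesis by (simp only:)
qed

lemma poly2_continuous: "poly2 f \<Longrightarrow> continuous_on S f"
proof -
  assume "poly2 f"
  then obtain c :: "nat \<Rightarrow> nat \<Rightarrow> real" where
    "f = (\<lambda>x. \<Sum>i\<le>2. \<Sum>j\<le>2 - i. c i j * (x $ 1) ^ i * (x $ 2) ^ j)"
    unfolding poly2_def by blast
  then show ?thesis by (simp only:) (intro continuous_intros)
qed

text \<open>The vertex set in \<open>simplex\<close> is only asserted to exist, whereas
  \<open>nodes2\<close> speaks of extreme points; affine independence identifies the two.\<close>

lemma simplex_vertices:
  assumes "n simplex K"
  shows "\<not> affine_dependent {v. v extreme_point_of K}" "finite {v. v extreme_point_of K}"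
    "convex hull {v. v extreme_point_of K} = K"
proof -
  obtain C where C: "\<not> affine_dependent C" "K = convex hull C"
    using assms by (auto simp: simplex_def)
  have "{v. v extreme_point_of K} = C"
    using C extreme_point_of_convex_hull_affine_independent by blast
  then show "\<not> affine_dependent {v. v extreme_point_of K}" "finite {v. v extreme_point_of K}"
    "convex hull {v. v extreme_point_of K} = K" 
    using C aff_independent_finite by auto
qed

text \<open>The value at a point is taken from any triangle that contains it. The choice does not
  matter: two triangles of a triangulation meet in a common face, and there both local interpolants
  reduce to the one of the face. Continuity follows from finitely many closed pieces.\<close>

lemma lagrange2_exists:
  assumes "is_mesh R \<T>"
  shows "\<exists>w. w \<in> FEvec R \<T> 2 \<and> (\<forall>K\<in>\<T>. \<forall>p\<in>nodes2 K. w p = u p)"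
proof -
  have fin: "finite \<T>" and sx: "\<And>K. K \<in> \<T> \<Longrightarrow> 2 simplex K" and cover: "\<Union>\<T> = closure R"
    and face: "\<And>K L. K \<in> \<T> \<Longrightarrow> L \<in> \<T> \<Longrightarrow> (K \<inter> L) face_of K"
    using assms by (auto simp: is_mesh_def triangulation_def)
  define vert where "vert K = {v. v extreme_point_of K}" for K :: "(real^2) set"
  note vert = simplex_vertices[OF sx, folded vert_def]
  define w where "w x = interp2 (vert (SOME K. K \<in> \<T> \<and> x \<in> K)) u x" for x
  have restrict: "interp2 (vert K) u x = interp2 (vert (K \<inter> L)) u x"
    if "K \<in> \<T>" "x \<in> K" "x \<in> L" "(K \<inter> L) face_of K" for K L x
  proof -
    have "compact K" "convex K"
      using finite_imp_compact_convex_hull[OF vert(2)[OF that(1)]] convex_convex_hull[of "vert K"]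
      by (simp_all add: vert(3)[OF that(1)])
    then have "compact (K \<inter> L)" "convex (K \<inter> L)"
      using face_of_imp_compact[OF _ _ that(4)] face_of_imp_convex[OF that(4)] by auto
    \<comment> \<open>A face of a triangle is compact and convex, hence the hull of its own extreme
      points, and these are vertices of the triangle.\<close>
    then have "convex hull (vert (K \<inter> L)) = K \<inter> L"
      unfolding vert_def by (rule Krein_Milman_Minkowski[symmetric])
    moreover have "vert (K \<inter> L) \<subseteq> vert K"
      unfolding vert_def using extreme_point_of_face[OF that(4)] by blast
    ultimately show ?thesis
      using vert[OF that(1)] that(2,3) by (intro interp2_face) simp_all
  qed
  have w: "w x = interp2 (vert K) u x" if "K \<in> \<T>" "x \<in> K" for K x
  proof -
    define L where "L = (SOME K. K \<in> \<T> \<and> x \<in> K)"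
    have L: "L \<in> \<T> \<and> x \<in> L" unfolding L_def by (rule someI[of _ K]) (use that in auto)
    have "interp2 (vert K) u x = interp2 (vert (K \<inter> L)) u x"
      using restrict[of K x L] face[of K L] that L by blast
    also have "\<dots> = interp2 (vert L) u x"
      using restrict[of L x K] face[of L K] that L by (simp add: Int_commute)
    finally show ?thesis by (simp add: w_def L_def)
  qed
  have poly: "poly2 (\<lambda>x. interp2 (vert K) u x $ i)" if "K \<in> \<T>" for K i
    using poly2_interp2 vert that by blast
  have "continuous_on (\<Union>K\<in>\<T>. K) (\<lambda>x. w x $ i)" for i
  proof (rule continuous_on_closed_Union)
    show "closed K" if "K \<in> \<T>" for K
      using compact_imp_closed[OF finite_imp_compact_convex_hull[OF vert(2)[OF that]]]
      by (simp add: vert(3)[OF that])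
    show "continuous_on K (\<lambda>x. w x $ i)" if "K \<in> \<T>" for K
      using poly2_continuous[OF poly[OF that, of i]] by (rule continuous_on_eq) (simp add: w[OF that])
  qed (use fin in auto)
  then have "continuous_on (closure R) (\<lambda>x. w x $ i)" for i
    using cover by simp
  moreover have "\<exists>c :: nat \<Rightarrow> nat \<Rightarrow> real. \<forall>x\<in>K.
       w x $ i = (\<Sum>i\<le>2. \<Sum>j\<le>2 - i. c i j * (x $ 1) ^ i * (x $ 2) ^ j)" if K: "K \<in> \<T>" for K i
  proof -
    obtain c :: "nat \<Rightarrow> nat \<Rightarrow> real" where
      "\<forall>x. interp2 (vert K) u x $ i = (\<Sum>i\<le>2. \<Sum>j\<le>2 - i. c i j * (x $ 1) ^ i * (x $ 2) ^ j)"
      using poly[OF K, of i] unfolding poly2_def by blast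
    then show ?thesis by (intro exI[of _ c]) (simp add: w[OF K])
  qed
  ultimately have "w \<in> FEvec R \<T> 2"
    by (simp add: FEvec_def FE_def)
  moreover have "w p = u p" if K: "K \<in> \<T>" and p: "p \<in> nodes2 K" for K p
  proof -
    obtain a b where ab: "p = midpoint a b" "a \<in> vert K" "b \<in> vert K"
      using p by (auto simp: nodes2_def vert_def)
    then have "p \<in> K"
      using closed_segment_subset[OF hull_inc[OF ab(2)] hull_inc[OF ab(3)] convex_convex_hull]
        midpoint_in_closed_segment[of a b] vert(3)[OF K] by auto
    then show ?thesis
      using w[OF K] interp2_node[OF vert(1,2)[OF K] ab(2,3)] ab(1) by simp
  qed
  ultimately show ?thesis by blast
qed

text \<open>Without existence the choice in \<open>lagrange2\<close> would be unspecified. The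
  energy estimate needs the continuity of the interpolant on \<open>closure R\<close> that this
  membership contains.\<close>

lemma lagrange2_in_FEvec: "is_mesh R \<T> \<Longrightarrow> lagrange2 R \<T> u \<in> FEvec R \<T> 2"
  unfolding lagrange2_def using someI_ex[OF lagrange2_exists] by fast

section \<open>Piecewise affine curves\<close>

definition grid :: "nat \<Rightarrow> real set"
  where "grid J = (\<lambda>j. real j / real J) ` {0..J}"

abbreviation cell :: "nat \<Rightarrow> nat \<Rightarrow> real set"
  where "cell J j \<equiv> {(real j - 1) / real J<..<real j / real J}"

lemma finite_grid [simp]: "finite (grid J)"
  by (simp add: grid_def)

lemma cell_subset: 
  assumes "j \<in> {1..J}" shows "cell J j \<subseteq> unit_I"
proof -
  have "0 \<le> (real j - 1) / real J" "real j / real J \<le> 1" using assms by (auto simp: divide_simps)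
  then show ?thesis by (auto simp del: divide_le_eq_1 le_divide_eq_1 zero_le_divide_iff)
qed

lemma in_cellE:
  assumes "J \<ge> 1" "\<alpha> \<in> unit_I" "\<alpha> \<notin> grid J"
  obtains j where "j \<in> {1..J}" "\<alpha> \<in> cell J j"
proof -
  define j where "j = nat \<lceil>\<alpha> * real J\<rceil>"
  have J: "real J > 0" using assms(1) by simp
  have pos: "0 < \<alpha> * real J" "\<alpha> * real J < real J" using assms(2) J by auto
  have j: "real j \<ge> \<alpha> * real J" "real j - 1 < \<alpha> * real J" "j \<ge> 1" "j \<le> J"
    unfolding j_def using pos by linarith+
  moreover have "\<alpha> \<noteq> real j / real J"
    using assms(3) j by (auto simp: grid_def)
  ultimately have "j \<in> {1..J}" "\<alpha> \<in> cell J j" using J by (auto simp: field_simps)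
  then show ?thesis using that by blast
qed

lemma Vh_derivative:
  assumes "X \<in> Vh J" "j \<in> {1..J}"
  shows "\<exists>b. \<forall>\<alpha>\<in>cell J j. (X has_vector_derivative b) (at \<alpha>)"
proof -
  obtain a b where ab: "\<And>\<alpha>. \<alpha> \<in> {(real j - 1) / real J .. real j / real J} \<Longrightarrow> X \<alpha> = a + \<alpha> *\<^sub>R b"
    using assms unfolding Vh_def by blast
  have "(X has_vector_derivative b) (at \<alpha>)" if "\<alpha> \<in> cell J j" for \<alpha>
  proof (rule has_vector_derivative_transform_within_open[where S = "cell J j"])
    show "((\<lambda>\<alpha>. a + \<alpha> *\<^sub>R b) has_vector_derivative b) (at \<alpha>)"
      by (auto intro!: derivative_eq_intros)
  qed (use that in \<open>auto simp: ab\<close>)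
  then show ?thesis by blast
qed

text \<open>\<open>dcurve\<close> is defined by choice and means nothing where no derivative exists;
  off the finite grid it is a true derivative.\<close>

lemma Vh_dcurve:
  assumes "X \<in> Vh J" "J \<ge> 1" "\<alpha> \<in> unit_I" "\<alpha> \<notin> grid J"
  shows "(X has_vector_derivative dcurve X \<alpha>) (at \<alpha>)"
proof -
  obtain j where "j \<in> {1..J}" "\<alpha> \<in> cell J j" using in_cellE assms(2-4) by blast
  then obtain b where "(X has_vector_derivative b) (at \<alpha>)" using Vh_derivative[OF assms(1)] by blast
  then show ?thesis
    unfolding dcurve_def using differentiableI_vector vector_derivative_works by blast
qed

lemma Vh_continuous_affine:
  assumes "continuous_on {0..1} X" "j \<in> {1..J}"
  shows "continuous_on {(real j - 1) / real J .. real j / real J} X"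
proof (rule continuous_on_subset[OF assms(1)])
  have "0 \<le> (real j - 1) / real J" "real j / real J \<le> 1" using assms(2) by (auto simp: divide_simps)
  then show "{(real j - 1) / real J .. real j / real J} \<subseteq> {0..1}"
    by (auto simp del: divide_le_eq_1 le_divide_eq_1 zero_le_divide_iff)
qed

definition pw_const :: "nat \<Rightarrow> (real \<Rightarrow> 'b) \<Rightarrow> bool"
  where "pw_const J h \<longleftrightarrow> (\<forall>j\<in>{1..J}. \<exists>c. \<forall>\<alpha>\<in>cell J j. h \<alpha> = c)"

text \<open>Agreement with a function continuous on the closed cell gives boundedness there, hence
  integrability. Values at the grid points are left free, because \<open>dcurve\<close> is
  unspecified there.\<close>

definition pw_cont :: "nat \<Rightarrow> (real \<Rightarrow> 'b::topological_space) \<Rightarrow> bool"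
  where "pw_cont J h \<longleftrightarrow> (\<forall>j\<in>{1..J}. \<exists>k. continuous_on {(real j - 1) / real J .. real j / real J} k \<and>
    (\<forall>\<alpha>\<in>cell J j. h \<alpha> = k \<alpha>))"

lemma pw_const_dcurve: "X \<in> Vh J \<Longrightarrow> pw_const J (dcurve X)"
  unfolding pw_const_def
proof
  fix j assume "X \<in> Vh J" "j \<in> {1..J}"
  then obtain b where "\<forall>\<alpha>\<in>cell J j. (X has_vector_derivative b) (at \<alpha>)"
    using Vh_derivative by blast
  then show "\<exists>c. \<forall>\<alpha>\<in>cell J j. dcurve X \<alpha> = c"
    unfolding dcurve_def by (intro exI[of _ b]) (simp add: vector_derivative_at)
qed

text \<open>No continuity is asked of \<open>F\<close>, so that \<open>F\<close> may be the
  reciprocal of the norm, which is discontinuous at 0 but occurs in the curvature equation.\<close>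

lemma pw_const_comp: "pw_const J h \<Longrightarrow> pw_const J (\<lambda>\<alpha>. F (h \<alpha>))"
  unfolding pw_const_def
proof
  fix j assume "\<forall>j\<in>{1..J}. \<exists>c. \<forall>\<alpha>\<in>cell J j. h \<alpha> = c" "j \<in> {1..J}"
  then obtain c where "\<forall>\<alpha>\<in>cell J j. h \<alpha> = c" by blast
  then show "\<exists>c. \<forall>\<alpha>\<in>cell J j. F (h \<alpha>) = c"
    by (intro exI[of _ "F c"]) simp
qed

lemma pw_const_imp_cont: "pw_const J h \<Longrightarrow> pw_cont J h"
  unfolding pw_const_def pw_cont_def
proof
  fix j assume "\<forall>j\<in>{1..J}. \<exists>c. \<forall>\<alpha>\<in>cell J j. h \<alpha> = c" "j \<in> {1..J}"
  then obtain c where "\<forall>\<alpha>\<in>cell J j. h \<alpha> = c" by blast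
  then show "\<exists>k. continuous_on {(real j - 1) / real J .. real j / real J} k \<and> (\<forall>\<alpha>\<in>cell J j. h \<alpha> = k \<alpha>)"
    by (intro exI[of _ "\<lambda>_. c"]) simp
qed

lemma pw_cont_continuous: "continuous_on {0..1} h \<Longrightarrow> pw_cont J h"
  unfolding pw_cont_def
  by (intro ballI exI[of _ h] conjI Vh_continuous_affine) simp_all

lemma pw_cont_Pair:
  assumes "pw_cont J h" "pw_cont J k"
  shows "pw_cont J (\<lambda>\<alpha>. (h \<alpha>, k \<alpha>))"
  unfolding pw_cont_def
proof
  fix j assume j: "j \<in> {1..J}"
  let ?I = "{(real j - 1) / real J .. real j / real J}"
  obtain h' where *: "continuous_on ?I h'" "\<forall>\<alpha>\<in>cell J j. h \<alpha> = h' \<alpha>"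
    using assms(1)[unfolded pw_cont_def, rule_format, OF j] by (elim exE conjE)
  obtain k' where "continuous_on ?I k'" "\<forall>\<alpha>\<in>cell J j. k \<alpha> = k' \<alpha>"
    using assms(2)[unfolded pw_cont_def, rule_format, OF j] by (elim exE conjE)
  with * show "\<exists>k''. continuous_on ?I k'' \<and> (\<forall>\<alpha>\<in>cell J j. (h \<alpha>, k \<alpha>) = k'' \<alpha>)"
    by (intro exI[of _ "\<lambda>\<alpha>. (h' \<alpha>, k' \<alpha>)"]) (simp add: continuous_on_Pair)
qed

text \<open>Together with pairing this reduces closure under sums, products and inner products to
  the continuity of the operation.\<close>

lemma pw_cont_comp:
  assumes "pw_cont J h" "continuous_on UNIV F"
  shows "pw_cont J (\<lambda>\<alpha>. F (h \<alpha>))"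
  unfolding pw_cont_def
proof
  fix j assume j: "j \<in> {1..J}"
  let ?I = "{(real j - 1) / real J .. real j / real J}"
  obtain h' where *: "continuous_on ?I h'" "\<forall>\<alpha>\<in>cell J j. h \<alpha> = h' \<alpha>"
    using assms(1)[unfolded pw_cont_def, rule_format, OF j] by (elim exE conjE)
  have "continuous_on ?I (\<lambda>\<alpha>. F (h' \<alpha>))"
    by (rule continuous_on_compose2[OF assms(2) *(1)]) simp
  then show "\<exists>k''. continuous_on ?I k'' \<and> (\<forall>\<alpha>\<in>cell J j. F (h \<alpha>) = k'' \<alpha>)"
    using * by (intro exI[of _ "\<lambda>\<alpha>. F (h' \<alpha>)"]) simp
qed

lemma pw_cont_const: "pw_cont J (\<lambda>\<alpha>. c)"
  by (intro pw_cont_continuous) simp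

lemma pw_cont_add:
  fixes h k :: "real \<Rightarrow> 'b::real_normed_vector"
  assumes "pw_cont J h" "pw_cont J k" shows "pw_cont J (\<lambda>\<alpha>. h \<alpha> + k \<alpha>)"
proof -
  have "continuous_on UNIV (\<lambda>p::'b \<times> 'b. fst p + snd p)"
    by (intro continuous_intros)
  from pw_cont_comp[OF pw_cont_Pair[OF assms] this] show ?thesis by simp
qed

lemma pw_cont_diff:
  fixes h k :: "real \<Rightarrow> 'b::real_normed_vector"
  assumes "pw_cont J h" "pw_cont J k" shows "pw_cont J (\<lambda>\<alpha>. h \<alpha> - k \<alpha>)"
proof -
  have "continuous_on UNIV (\<lambda>p::'b \<times> 'b. fst p - snd p)"
    by (intro continuous_intros)
  from pw_cont_comp[OF pw_cont_Pair[OF assms] this] show ?thesis by simp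
qed

lemma pw_cont_inner:
  fixes h k :: "real \<Rightarrow> 'b::real_inner"
  assumes "pw_cont J h" "pw_cont J k" shows "pw_cont J (\<lambda>\<alpha>. h \<alpha> \<bullet> k \<alpha>)"
proof -
  have "continuous_on UNIV (\<lambda>p::'b \<times> 'b. fst p \<bullet> snd p)"
    by (intro continuous_intros)
  from pw_cont_comp[OF pw_cont_Pair[OF assms] this] show ?thesis by simp
qed

lemma pw_cont_scaleR:
  fixes k :: "real \<Rightarrow> 'b::real_normed_vector"
  assumes "pw_cont J h" "pw_cont J k" shows "pw_cont J (\<lambda>\<alpha>. h \<alpha> *\<^sub>R k \<alpha>)"
proof -
  have "continuous_on UNIV (\<lambda>p::real \<times> 'b. fst p *\<^sub>R snd p)"
    by (intro continuous_intros)
  from pw_cont_comp[OF pw_cont_Pair[OF assms] this] show ?thesis by simp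
qed

lemma pw_cont_mult:
  fixes h k :: "real \<Rightarrow> real"
  assumes "pw_cont J h" "pw_cont J k" shows "pw_cont J (\<lambda>\<alpha>. h \<alpha> * k \<alpha>)"
  using pw_cont_scaleR[OF assms] by simp

lemma pw_cont_uminus:
  fixes h :: "real \<Rightarrow> 'b::real_normed_vector"
  assumes "pw_cont J h" shows "pw_cont J (\<lambda>\<alpha>. - h \<alpha>)"
  using pw_cont_diff[OF pw_cont_const assms, of 0] by simp

lemmas pw_cont_intros = pw_cont_const pw_cont_uminus pw_cont_add pw_cont_diff pw_cont_inner pw_cont_scaleR pw_cont_mult

lemma negligible_grid: "negligible (grid J)"
  by (simp add: negligible_finite)

lemma AE_unit_grid: "AE \<alpha> in lebesgue. \<alpha> \<notin> grid J"
  using negligible_grid by (intro AE_not_in) (simp add: negligible_iff_null_sets)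

lemma unit_I_cells: "J \<ge> 1 \<Longrightarrow> unit_I - grid J \<subseteq> (\<Union>j\<in>{1..J}. cell J j)"
proof
  fix \<alpha> assume "J \<ge> 1" "\<alpha> \<in> unit_I - grid J"
  then obtain j where "j \<in> {1..J}" "\<alpha> \<in> cell J j" by (elim DiffE in_cellE) blast+
  then show "\<alpha> \<in> (\<Union>j\<in>{1..J}. cell J j)" by blast
qed

lemma pw_cont_integrable:
  fixes h :: "real \<Rightarrow> 'b::euclidean_space"
  assumes "pw_cont J h" "J \<ge> 1"
  shows "set_integrable lebesgue unit_I h"
proof -
  have "h absolutely_integrable_on cell J j" if j: "j \<in> {1..J}" for j
  proof -
    obtain k where k: "continuous_on {(real j - 1) / real J .. real j / real J} k" "\<forall>\<alpha>\<in>cell J j. h \<alpha> = k \<alpha>"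
      using assms(1)[unfolded pw_cont_def, rule_format, OF j] by (elim exE conjE)
    have "k absolutely_integrable_on {(real j - 1) / real J .. real j / real J}"
      using absolutely_integrable_continuous_real[OF k(1)] .
    then have "k absolutely_integrable_on cell J j"
      by (rule set_integrable_subset) auto
    then show ?thesis
      by (rule set_integrable_cong[THEN iffD1, rotated -1]) (use k in auto)
  qed
  then have "h absolutely_integrable_on (\<Union>j\<in>{1..J}. cell J j)"
    by (intro set_integrable_UN) auto
  then show ?thesis
  proof (rule absolutely_integrable_spike_set)
    show "negligible {x \<in> (\<Union>j\<in>{1..J}. cell J j) - unit_I. h x \<noteq> 0}"
      by (rule negligible_subset[of "{}"]) (use cell_subset in \<open>simp, blast\<close>)
    show "negligible {x \<in> unit_I - (\<Union>j\<in>{1..J}. cell J j). h x \<noteq> 0}"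
      by (rule negligible_subset[OF negligible_grid[of J]]) (use unit_I_cells[OF assms(2)] in blast)
  qed
qed

text \<open>The length element cancels the normalisation of the tangent; for a vanishing derivative
  both sides are 0. Weighted normals thereby become linear in the derivative.\<close>

lemma norm_dcurve_normal: "norm (dcurve X \<alpha>) *\<^sub>R normal X \<alpha> = - perp (dcurve X \<alpha>)"
  by (cases "dcurve X \<alpha> = 0") (auto simp: normal_def tangent_def perp_def vec_eq_iff forall_2)

lemma perp_inner: "perp v \<bullet> w = v $ 2 * w $ 1 - v $ 1 * w $ 2"
  by (simp add: perp_def inner_vec_def sum_2)

lemma inner_e1: "x \<bullet> e1 = x $ 1"
  by (simp add: inner_axis)


lemma dcurve_diff:
  assumes "X \<in> Vh J" "Y \<in> Vh J" "J \<ge> 1" "\<alpha> \<in> unit_I" "\<alpha> \<notin> grid J"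
  shows "dcurve (\<lambda>\<alpha>. X \<alpha> - Y \<alpha>) \<alpha> = dcurve X \<alpha> - dcurve Y \<alpha>"
  unfolding dcurve_def[of "\<lambda>\<alpha>. X \<alpha> - Y \<alpha>"]
  by (intro vector_derivative_at has_vector_derivative_diff Vh_dcurve[OF _ assms(3-5)] assms(1,2))

lemma Vh_diff:
  assumes "X \<in> Vh J" "Y \<in> Vh J"
  shows "(\<lambda>\<alpha>. X \<alpha> - Y \<alpha>) \<in> Vh J"
  unfolding Vh_def
proof (intro CollectI conjI ballI)
  show "continuous_on {0..1} (\<lambda>\<alpha>. X \<alpha> - Y \<alpha>)"
    using assms by (intro continuous_intros) (auto simp: Vh_def)
  fix j assume "j \<in> {1..J}"
  then obtain a b a' b' where "\<forall>\<alpha>\<in>{(real j - 1) / real J .. real j / real J}. X \<alpha> = a + \<alpha> *\<^sub>R b"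
    "\<forall>\<alpha>\<in>{(real j - 1) / real J .. real j / real J}. Y \<alpha> = a' + \<alpha> *\<^sub>R b'"
    using assms unfolding Vh_def by blast
  then show "\<exists>a b. \<forall>\<alpha>\<in>{(real j - 1) / real J .. real j / real J}. X \<alpha> - Y \<alpha> = a + \<alpha> *\<^sub>R b"
    by (intro exI[of _ "a - a'"] exI[of _ "b - b'"]) (simp add: algebra_simps)
qed

section \<open>Differences of curves as admissible test functions\<close>

lemma L2_diff:
  assumes "f \<in> L2 S" "g \<in> L2 S" 
  shows "(\<lambda>x. f x - g x) \<in> L2 S"
proof -
  have m: "set_borel_measurable lebesgue S f" "set_borel_measurable lebesgue S g"
    and i: "set_integrable lebesgue S (\<lambda>x. (f x)\<^sup>2)" "set_integrable lebesgue S (\<lambda>x. (g x)\<^sup>2)"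
    using assms by (auto simp: L2_def)
  have m': "set_borel_measurable lebesgue S (\<lambda>x. f x - g x)"
    using borel_measurable_diff[OF m[unfolded set_borel_measurable_def]]
    by (simp add: set_borel_measurable_def right_diff_distrib)
  have m'': "set_borel_measurable lebesgue S (\<lambda>x. (f x - g x)\<^sup>2)"
    using borel_measurable_power[OF m'[unfolded set_borel_measurable_def], of 2]
    by (simp add: set_borel_measurable_def power_mult_distrib power2_eq_square[of "indicator _ _ :: real"]
        flip: indicator_inter_arith)
  have "set_integrable lebesgue S (\<lambda>x. 2 * (f x)\<^sup>2 + 2 * (g x)\<^sup>2)"
    by (intro set_integral_add(1) set_integrable_mult_right i)
  then have "set_integrable lebesgue S (\<lambda>x. (f x - g x)\<^sup>2)"
  proof (rule set_integrable_bound[OF _ m''], intro AE_I2 impI)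
    fix x
    have "(f x - g x)\<^sup>2 \<le> 2 * (f x)\<^sup>2 + 2 * (g x)\<^sup>2"
      using zero_le_power2[of "f x + g x"] by (simp add: power2_sum power2_diff)
    then show "norm ((f x - g x)\<^sup>2) \<le> norm (2 * (f x)\<^sup>2 + 2 * (g x)\<^sup>2)"
      by simp
  qed
  then show ?thesis using m' by (simp add: L2_def)
qed

text \<open>On a set of finite measure the product is dominated by the integrable function
  \<open>(f x)\<^sup>2 + B\<^sup>2\<close>. It makes the two integrals in
  \<open>has_weak_deriv\<close> additive in the function and in its weak derivative.\<close>

lemma L2_mult_bounded_integrable:
  assumes "f \<in> L2 S" "S \<in> lmeasurable" "continuous_on UNIV h" "\<And>x. x \<in> S \<Longrightarrow> \<bar>h x\<bar> \<le> B"
  shows "set_integrable lebesgue S (\<lambda>x. f x * h x)"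
proof -
  have m: "set_borel_measurable lebesgue S f" and i: "set_integrable lebesgue S (\<lambda>x. (f x)\<^sup>2)"
    using assms by (auto simp: L2_def)
  have hm: "h \<in> borel_measurable lebesgue"
    using borel_measurable_continuous_onI[OF assms(3)] by (simp add: measurable_completion)
  have m': "set_borel_measurable lebesgue S (\<lambda>x. f x * h x)"
    using borel_measurable_times[OF m[unfolded set_borel_measurable_def] hm]
    by (simp add: set_borel_measurable_def mult.assoc)
  have "set_integrable lebesgue S (\<lambda>x. 1::real)"
    using assms(2) by (simp add: set_integrable_def lmeasurable_iff_integrable)
  then have "set_integrable lebesgue S (\<lambda>x. (f x)\<^sup>2 + B\<^sup>2 * 1)"
    by (intro set_integral_add(1) set_integrable_mult_right i)
  then show ?thesis
  proof (rule set_integrable_bound[OF _ m'], intro AE_I2 impI)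
    fix x assume x: "x \<in> S"
    have "\<bar>f x * h x\<bar> \<le> \<bar>f x\<bar> * B"
      using assms(4)[OF x] by (simp add: abs_mult mult_left_mono)
    also have "\<dots> \<le> (f x)\<^sup>2 + B\<^sup>2"
    proof -
      have "0 \<le> \<bar>f x\<bar> * B" using order_trans[OF abs_ge_zero assms(4)[OF x]] by simp
      then show ?thesis using sum_squares_bound[of "\<bar>f x\<bar>" B] unfolding power2_abs by linarith
    qed
    finally show "norm (f x * h x) \<le> norm ((f x)\<^sup>2 + B\<^sup>2 * 1)" by simp
  qed
qed

lemma smooth_continuous:
  assumes "smooth f" shows "continuous_on UNIV f"
  using assms by (auto elim!: smooth.cases intro!: differentiable_imp_continuous_on 
    simp: differentiable_on_def differentiable_at_withinI)

lemma smooth_deriv: "smooth f \<Longrightarrow> smooth (\<lambda>x. frechet_derivative f (at x) v)"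
  by (auto elim: smooth.cases)

lemma H1_interval_diff:
  assumes "f \<in> H1_interval" "g \<in> H1_interval"
  shows "(\<lambda>x. f x - g x) \<in> H1_interval"
proof -
  obtain f' g' where *: "f \<in> L2 unit_I" "g \<in> L2 unit_I" "f' \<in> L2 unit_I" "g' \<in> L2 unit_I"
    "has_weak_deriv unit_I f 1 f'" "has_weak_deriv unit_I g 1 g'"
    using assms by (auto simp: H1_interval_def)
  have int: "set_integrable lebesgue unit_I (\<lambda>x. k x * \<phi> x)" if "k \<in> L2 unit_I" "smooth \<phi>" for k \<phi>
  proof -
    have "compact (\<phi> ` {0..1})"
      using smooth_continuous[OF that(2)] by (meson compact_Icc compact_continuous_image continuous_on_subset subset_UNIV)
    then obtain B where "\<forall>y\<in>\<phi> ` {0..1}. norm y \<le> B"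
      using compact_imp_bounded bounded_iff by blast
    then show ?thesis
      by (intro L2_mult_bounded_integrable[OF that(1) _ smooth_continuous[OF that(2)], of B]) auto
  qed
  have "has_weak_deriv unit_I (\<lambda>x. f x - g x) 1 (\<lambda>x. f' x - g' x)"
    unfolding has_weak_deriv_def
  proof
    fix \<phi> assume t: "\<phi> \<in> test_functions unit_I"
    then have sm: "smooth \<phi>" by (simp add: test_functions_def)
    show "(LINT x:unit_I|lebesgue. (f x - g x) * frechet_derivative \<phi> (at x) 1) =
        - (LINT x:unit_I|lebesgue. (f' x - g' x) * \<phi> x)"
      using t *(5,6) by (simp add: left_diff_distrib has_weak_deriv_def
          set_integral_diff(2)[OF int[OF *(1) smooth_deriv[OF sm]] int[OF *(2) smooth_deriv[OF sm]]]
          set_integral_diff(2)[OF int[OF *(3) sm] int[OF *(4) sm]])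
  qed
  then show ?thesis
    using L2_diff[OF *(1,2)] L2_diff[OF *(3,4)] by (auto simp: H1_interval_def)
qed

text \<open>Needed to test the curvature equation with the displacement of the curve.\<close>

lemma Vh_bd_diff:
  assumes "X \<in> Vh_bd J" "Y \<in> Vh_bd J"
  shows "(\<lambda>\<alpha>. X \<alpha> - Y \<alpha>) \<in> Vh_bd J"
  using assms Vh_diff[of X J Y]
  by (auto simp: Vh_bd_def curve_space_def H1_interval_diff inner_diff_left intro!: continuous_intros)

lemma Vh_bdD:
  assumes "X \<in> Vh_bd J"
  shows "X \<in> Vh J" "continuous_on {0..1} X" "X 0 $ 1 = 0" "X 1 $ 1 = 0"
  using assms by (auto simp: Vh_bd_def Vh_def curve_space_def inner_e1)

section \<open>Exchanging integrands almost everywhere\<close>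

lemma borel_measurable_lebesgue_AE:
  assumes "f \<in> borel_measurable lebesgue" "AE x in lebesgue. f x = g x"
  shows "g \<in> borel_measurable lebesgue"
proof (rule measurableI)
  fix A :: "'b set" assume A: "A \<in> sets borel"
  have "f -` A \<inter> space lebesgue \<in> sets lebesgue"
    using assms(1) A by (rule measurable_sets)
  moreover have "AE x in lebesgue. (x \<in> f -` A \<inter> space lebesgue) = (x \<in> g -` A \<inter> space lebesgue)"
    using assms(2) by eventually_elim auto
  ultimately show "g -` A \<inter> space lebesgue \<in> sets lebesgue"
    using completion.in_sets_AE by blast
qed simp

text \<open>Measurability need not be assumed: the completed measure passes it from one function to
  the other, and if neither is measurable, both integrals are 0 by convention.\<close>

lemma integral_cong_AE_lebesgue:
  fixes f g :: "'a::euclidean_space \<Rightarrow> 'b::{banach, second_countable_topology}"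
  assumes "AE x in lebesgue. f x = g x"
  shows "integral\<^sup>L lebesgue f = integral\<^sup>L lebesgue g"
proof (cases "f \<in> borel_measurable lebesgue")
  case True
  then show ?thesis
    using assms borel_measurable_lebesgue_AE[OF True assms] by (intro integral_cong_AE)
next
  case False
  moreover have "AE x in lebesgue. g x = f x"
    using assms by eventually_elim simp
  ultimately have "g \<notin> borel_measurable lebesgue"
    using borel_measurable_lebesgue_AE by blast
  then show ?thesis
    using False by (metis borel_measurable_integrable not_integrable_integral_eq)
qed

lemma set_integral_cong_AE_lebesgue:
  fixes f g :: "'a::euclidean_space \<Rightarrow> 'b::{banach, second_countable_topology}"
  assumes "AE x in lebesgue. x \<in> S \<longrightarrow> f x = g x"
  shows "(LINT x:S|lebesgue. f x) = (LINT x:S|lebesgue. g x)"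
  unfolding set_lebesgue_integral_def
  by (rule integral_cong_AE_lebesgue) (use assms in eventually_elim, auto simp: indicator_def)

section \<open>Surface area and enclosed volume of polygonal curves\<close>

text \<open>Here \<open>r\<close> and \<open>s\<close> are the old and new distance to the axis,
  \<open>a\<close> and \<open>b\<close> the old and new derivative. Split the left side as
  \<open>(s - r) * norm b + r * (norm b - norm a)\<close>. By Cauchy-Schwarz,
  \<open>b \<bullet> (b - a)\<close> is at least \<open>norm b * (norm b - norm a)\<close>, which
  exceeds \<open>norm a * (norm b - norm a)\<close> by a square.\<close>

lemma area_pointwise:
  fixes a b :: "'a::real_inner" and r s :: real
  assumes "r \<ge> 0" "norm a > 0"
  shows "s * norm b - r * norm a \<le> (s - r) * norm b + (r *\<^sub>R b) \<bullet> ((b - a) /\<^sub>R norm a)"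
proof -
  have "norm b * norm b - norm b * norm a \<le> b \<bullet> (b - a)"
    using norm_cauchy_schwarz[of b a] by (simp add: inner_diff_right power2_norm_eq_inner[symmetric] power2_eq_square)
  moreover have "0 \<le> (norm b - norm a)\<^sup>2" by simp
  ultimately have "(norm b - norm a) * norm a \<le> b \<bullet> (b - a)"
    by (simp add: power2_eq_square algebra_simps)
  then have "norm b - norm a \<le> (b \<bullet> (b - a)) / norm a"
    using assms(2) by (simp add: field_simps)
  then have "r * (norm b - norm a) \<le> r * ((b \<bullet> (b - a)) / norm a)"
    using assms(1) by (rule mult_left_mono)
  then show ?thesis by (simp add: algebra_simps divide_inverse)
qed

text \<open>The right-hand side consists of the last two terms of the curvature equation for the
  test function \<open>Y - X\<close>, so that the equation turns it into the curvature term.\<close>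

lemma area_decrease:
  assumes X: "X \<in> Vh J" and Y: "Y \<in> Vh J" and J: "J \<ge> 1"
    and pos: "\<And>\<alpha>. \<alpha> \<in> unit_I \<Longrightarrow> X \<alpha> \<bullet> e1 > 0"
      "\<And>\<alpha>. \<alpha> \<in> unit_I \<Longrightarrow> X differentiable (at \<alpha>) \<Longrightarrow> norm (dcurve X \<alpha>) > 0"
  shows "l2_inner unit_I (\<lambda>\<alpha>. Y \<alpha> \<bullet> e1) (\<lambda>\<alpha>. norm (dcurve Y \<alpha>))
      - l2_inner unit_I (\<lambda>\<alpha>. X \<alpha> \<bullet> e1) (\<lambda>\<alpha>. norm (dcurve X \<alpha>))
    \<le> l2_inner unit_I (\<lambda>\<alpha>. (Y \<alpha> - X \<alpha>) \<bullet> e1) (\<lambda>\<alpha>. norm (dcurve Y \<alpha>))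
      + l2_inner unit_I (\<lambda>\<alpha>. (X \<alpha> \<bullet> e1) *\<^sub>R dcurve Y \<alpha>)
          (\<lambda>\<alpha>. dcurve (\<lambda>\<alpha>. Y \<alpha> - X \<alpha>) \<alpha> /\<^sub>R norm (dcurve X \<alpha>))"
proof -
  have cX: "pw_cont J X" and cY: "pw_cont J Y"
    using X Y by (auto simp: Vh_def intro: pw_cont_continuous)
  note dX = pw_const_dcurve[OF X] and dY = pw_const_dcurve[OF Y]
    and dZ = pw_const_dcurve[OF Vh_diff[OF Y X]]
  note i = pw_cont_integrable[OF _ J] 
  note pc = pw_cont_intros cX cY pw_const_imp_cont[OF pw_const_comp[OF dX, of norm]] 
    pw_const_imp_cont[OF pw_const_comp[OF dX, of "\<lambda>v. inverse (norm v)"]]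
    pw_const_imp_cont[OF pw_const_comp[OF dY, of norm]] pw_const_imp_cont[OF dY] pw_const_imp_cont[OF dZ]
  have i1: "set_integrable lebesgue unit_I (\<lambda>\<alpha>. (Y \<alpha> \<bullet> e1) \<bullet> norm (dcurve Y \<alpha>))"
    and i2: "set_integrable lebesgue unit_I (\<lambda>\<alpha>. (X \<alpha> \<bullet> e1) \<bullet> norm (dcurve X \<alpha>))"
    and i3: "set_integrable lebesgue unit_I (\<lambda>\<alpha>. ((Y \<alpha> - X \<alpha>) \<bullet> e1) \<bullet> norm (dcurve Y \<alpha>))"
    and i4: "set_integrable lebesgue unit_I (\<lambda>\<alpha>. ((X \<alpha> \<bullet> e1) *\<^sub>R dcurve Y \<alpha>)
        \<bullet> (dcurve (\<lambda>\<alpha>. Y \<alpha> - X \<alpha>) \<alpha> /\<^sub>R norm (dcurve X \<alpha>)))"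
    by (intro i pc)+
  show ?thesis
    unfolding l2_inner_def set_integral_diff(2)[OF i1 i2, symmetric] set_integral_add(2)[OF i3 i4, symmetric]
  proof (rule set_integral_mono_AE[OF set_integral_diff(1)[OF i1 i2] set_integral_add(1)[OF i3 i4]])
    show "AE \<alpha> in lebesgue. \<alpha> \<in> unit_I \<longrightarrow> (Y \<alpha> \<bullet> e1) \<bullet> norm (dcurve Y \<alpha>) - (X \<alpha> \<bullet> e1) \<bullet> norm (dcurve X \<alpha>)
      \<le> ((Y \<alpha> - X \<alpha>) \<bullet> e1) \<bullet> norm (dcurve Y \<alpha>) + ((X \<alpha> \<bullet> e1) *\<^sub>R dcurve Y \<alpha>)
        \<bullet> (dcurve (\<lambda>\<alpha>. Y \<alpha> - X \<alpha>) \<alpha> /\<^sub>R norm (dcurve X \<alpha>))"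
      using AE_unit_grid[of J]
    proof (eventually_elim, intro impI)
      fix \<alpha> :: real assume \<alpha>: "\<alpha> \<notin> grid J" "\<alpha> \<in> unit_I"
      have "X differentiable (at \<alpha>)"
        using Vh_dcurve[OF X J \<alpha>(2,1)] by (rule differentiableI_vector)
      then show "(Y \<alpha> \<bullet> e1) \<bullet> norm (dcurve Y \<alpha>) - (X \<alpha> \<bullet> e1) \<bullet> norm (dcurve X \<alpha>)
        \<le> ((Y \<alpha> - X \<alpha>) \<bullet> e1) \<bullet> norm (dcurve Y \<alpha>) + ((X \<alpha> \<bullet> e1) *\<^sub>R dcurve Y \<alpha>)
          \<bullet> (dcurve (\<lambda>\<alpha>. Y \<alpha> - X \<alpha>) \<alpha> /\<^sub>R norm (dcurve X \<alpha>))"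
        using area_pointwise[of "X \<alpha> \<bullet> e1" "dcurve X \<alpha>" "Y \<alpha> \<bullet> e1" "dcurve Y \<alpha>"] pos \<alpha>
        by (simp add: dcurve_diff[OF Y X J \<alpha>(2,1)] inner_diff_left less_imp_le)
    qed
  qed
qed

lemma enclosed_volume_alt:
  "enclosed_volume X = pi * (LINT \<alpha>:unit_I|lebesgue. - ((X \<alpha> $ 1)\<^sup>2 * dcurve X \<alpha> $ 2))"
proof -
  have "((X \<alpha> \<bullet> e1)\<^sup>2 *\<^sub>R normal X \<alpha>) \<bullet> (norm (dcurve X \<alpha>) *\<^sub>R e1)
      = (X \<alpha> \<bullet> e1)\<^sup>2 * ((norm (dcurve X \<alpha>) *\<^sub>R normal X \<alpha>) \<bullet> e1)" for \<alpha>
    by simp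
  then show ?thesis
    unfolding enclosed_volume_def l2_inner_def norm_dcurve_normal inner_e1
    by (simp add: perp_def)
qed

text \<open>Polynomial algebra, with index 0 for the old and 1 for the new curve and primes for
  derivatives. The doubled bracket is the Simpson mean tested with the displacement; the remainder
  is the derivative of \<open>- (z1 - z0) * (r0\<^sup>2 + r0 * r1 + r1\<^sup>2) / 3\<close>.\<close>

lemma volume_density_identity:
  fixes r0 :: real
  shows "- (r1\<^sup>2 * z1') - - (r0\<^sup>2 * z0') = 2 * (- (1/6) * ((r0 * z0' + (r0 + r1) * (z0' + z1') + r1 * z1') * (r1 - r0)
     - (r0 * r0' + (r0 + r1) * (r0' + r1') + r1 * r1') * (z1 - z0)))
   + (- (z1' - z0') * (r0\<^sup>2 + r0 * r1 + r1\<^sup>2) / 3 - (z1 - z0) * (2 * r0 * r0' + r0' * r1 + r0 * r1' + 2 * r1 * r1') / 3)"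
  by (simp add: power2_eq_square add_divide_distrib diff_divide_distrib algebra_simps)

text \<open>With \<open>X\<^sub>s = X + s (Y - X)\<close>, the derivative in \<open>s\<close> of the integrand \<open>- r\<^sup>2 z\<^sub>\<alpha>\<close> of the volume is
  \<open>- 2 r (Y - X) \<bullet> perp X\<^sub>s\<^sub>\<alpha>\<close> up to a derivative in \<open>\<alpha>\<close>. It is quadratic in \<open>s\<close>, so that Simpson's
  rule, which defines \<^const>\<open>f_half\<close>, is exact.\<close>

lemma enclosed_volume_diff:
  assumes X: "X \<in> Vh_bd J" and Y: "Y \<in> Vh_bd J" and J: "J \<ge> 1"
  shows "enclosed_volume Y - enclosed_volume X = 2 * pi * l2_inner unit_I (\<lambda>\<alpha>. Y \<alpha> - X \<alpha>) (f_half X Y)"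
proof -
  note Xh = Vh_bdD[OF X] and Yh = Vh_bdD[OF Y]
  \<comment> \<open>The function whose derivative separates the two integrands: the integral over
    \<open>s\<close> in [0,1] of \<open>- r\<^sup>2\<close> times the displacement in
    \<open>z\<close>, where \<open>r\<close> belongs to the interpolated curve at \<open>s\<close>.
    The mean of \<open>r\<^sup>2\<close> gives the third of the three products.\<close>
  define W where "W \<alpha> = - (Y \<alpha> $ 2 - X \<alpha> $ 2) * ((X \<alpha> $ 1)\<^sup>2 + X \<alpha> $ 1 * Y \<alpha> $ 1 + (Y \<alpha> $ 1)\<^sup>2) / 3" for \<alpha>
  define W' where "W' \<alpha> = - (dcurve Y \<alpha> $ 2 - dcurve X \<alpha> $ 2) * ((X \<alpha> $ 1)\<^sup>2 + X \<alpha> $ 1 * Y \<alpha> $ 1 + (Y \<alpha> $ 1)\<^sup>2) / 3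
     - (Y \<alpha> $ 2 - X \<alpha> $ 2) * (2 * X \<alpha> $ 1 * dcurve X \<alpha> $ 1 + dcurve X \<alpha> $ 1 * Y \<alpha> $ 1 + X \<alpha> $ 1 * dcurve Y \<alpha> $ 1
        + 2 * Y \<alpha> $ 1 * dcurve Y \<alpha> $ 1) / 3" for \<alpha>
  have c: "pw_cont J (\<lambda>\<alpha>. X \<alpha> $ i)" "pw_cont J (\<lambda>\<alpha>. Y \<alpha> $ i)" 
     "pw_cont J (\<lambda>\<alpha>. dcurve X \<alpha> $ i)" "pw_cont J (\<lambda>\<alpha>. dcurve Y \<alpha> $ i)" for i
    using pw_const_comp[OF pw_const_dcurve[OF Xh(1)], of "\<lambda>v. v $ i"] 
      pw_const_comp[OF pw_const_dcurve[OF Yh(1)], of "\<lambda>v. v $ i"]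
    by (simp_all add: pw_cont_continuous pw_const_imp_cont continuous_on_component Xh(2) Yh(2))
  \<comment> \<open>The Simpson weight 4 cancels against the two factors 1/2, one from the midpoint
    curve and one from its derivative.\<close>
  have f_half: "(Y \<alpha> - X \<alpha>) \<bullet> f_half X Y \<alpha> = - (1/6) * (perp (X \<alpha> $ 1 *\<^sub>R dcurve X \<alpha>
      + (X \<alpha> $ 1 + Y \<alpha> $ 1) *\<^sub>R (dcurve X \<alpha> + dcurve Y \<alpha>) + Y \<alpha> $ 1 *\<^sub>R dcurve Y \<alpha>) \<bullet> (Y \<alpha> - X \<alpha>))"
    if "\<alpha> \<in> unit_I" "\<alpha> \<notin> grid J" for \<alpha>
  proof -
    have "dcurve (\<lambda>\<beta>. (1/2) *\<^sub>R (X \<beta> + Y \<beta>)) \<alpha> = (1/2) *\<^sub>R (dcurve X \<alpha> + dcurve Y \<alpha>)"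
      unfolding dcurve_def[of "\<lambda>\<beta>. (1/2) *\<^sub>R (X \<beta> + Y \<beta>)"]
      using Vh_dcurve[OF Xh(1) J that] Vh_dcurve[OF Yh(1) J that]
      by (intro vector_derivative_at has_vector_derivative_add[THEN bounded_linear.has_vector_derivative[OF bounded_linear_scaleR_right]])
    then show ?thesis
      by (simp add: f_half_def inner_e1 inner_commute add_divide_distrib)
  qed
  have i1: "set_integrable lebesgue unit_I (\<lambda>\<alpha>. - ((Y \<alpha> $ 1)\<^sup>2 * dcurve Y \<alpha> $ 2))"
    and i2: "set_integrable lebesgue unit_I (\<lambda>\<alpha>. - ((X \<alpha> $ 1)\<^sup>2 * dcurve X \<alpha> $ 2))"
    and i3: "set_integrable lebesgue unit_I W'"
    and i4: "set_integrable lebesgue unit_I (\<lambda>\<alpha>. - (1/6) * (perp (X \<alpha> $ 1 *\<^sub>R dcurve X \<alpha>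
      + (X \<alpha> $ 1 + Y \<alpha> $ 1) *\<^sub>R (dcurve X \<alpha> + dcurve Y \<alpha>) + Y \<alpha> $ 1 *\<^sub>R dcurve Y \<alpha>) \<bullet> (Y \<alpha> - X \<alpha>)))"
    unfolding W'_def perp_inner power2_eq_square divide_inverse
      vector_add_component vector_minus_component vector_scaleR_component
    by (intro pw_cont_integrable[OF _ J] pw_cont_intros c)+
  have AEg: "AE \<alpha> in lebesgue. \<alpha> \<in> unit_I \<longrightarrow> \<alpha> \<notin> grid J"
    using AE_unit_grid[of J] by eventually_elim simp
  have "{0<..<1} = box 0 (1::real)" "{0..1} = cbox 0 (1::real)" by auto
  note Ioo = has_integral_open_interval[of _ _ 0 "1::real", folded this]
  have Wd: "(W has_vector_derivative W' \<alpha>) (at \<alpha>)" if "\<alpha> \<in> unit_I" "\<alpha> \<notin> grid J" for \<alpha>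
  proof -
    have d: "((\<lambda>\<alpha>. X \<alpha> $ i) has_real_derivative dcurve X \<alpha> $ i) (at \<alpha>)" 
      "((\<lambda>\<alpha>. Y \<alpha> $ i) has_real_derivative dcurve Y \<alpha> $ i) (at \<alpha>)" for i
      using bounded_linear.has_vector_derivative[OF bounded_linear_vec_nth Vh_dcurve[OF Xh(1) J that], of i]
        bounded_linear.has_vector_derivative[OF bounded_linear_vec_nth Vh_dcurve[OF Yh(1) J that], of i]
      by (simp_all add: has_real_derivative_iff_has_vector_derivative)
    show ?thesis
      unfolding W_def has_real_derivative_iff_has_vector_derivative[symmetric]
      apply (rule derivative_eq_intros d refl)+
      apply (simp_all add: W'_def power2_eq_square add_divide_distrib diff_divide_distrib algebra_simps)
      done
  qed
  have "(W' has_integral W 1 - W 0) {0..1}"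
  proof (rule fundamental_theorem_of_calculus_interior_strong[OF finite_grid[of J]])
    show "continuous_on {0..1} W"
      unfolding W_def by (intro continuous_intros Xh Yh) simp
  qed (use Wd in auto)
  \<comment> \<open>Both curves end on the axis, where \<open>r = 0\<close>, so \<open>W\<close>
    vanishes at 0 and 1.\<close>
  then have "(W' has_integral 0) unit_I"
    using Xh(3,4) Yh(3,4) by (simp add: W_def Ioo)
  then have W0: "(LINT \<alpha>:unit_I|lebesgue. W' \<alpha>) = 0"
    using set_lebesgue_integral_eq_integral(2)[OF i3] by (simp add: integral_unique)
  have "enclosed_volume Y - enclosed_volume X
      = pi * (LINT \<alpha>:unit_I|lebesgue. - ((Y \<alpha> $ 1)\<^sup>2 * dcurve Y \<alpha> $ 2) - - ((X \<alpha> $ 1)\<^sup>2 * dcurve X \<alpha> $ 2))"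
    by (simp only: enclosed_volume_alt set_integral_diff(2)[OF i1 i2] right_diff_distrib)
  also have "(LINT \<alpha>:unit_I|lebesgue. - ((Y \<alpha> $ 1)\<^sup>2 * dcurve Y \<alpha> $ 2) - - ((X \<alpha> $ 1)\<^sup>2 * dcurve X \<alpha> $ 2))
      = (LINT \<alpha>:unit_I|lebesgue. 2 * (- (1/6) * (perp (X \<alpha> $ 1 *\<^sub>R dcurve X \<alpha>
      + (X \<alpha> $ 1 + Y \<alpha> $ 1) *\<^sub>R (dcurve X \<alpha> + dcurve Y \<alpha>) + Y \<alpha> $ 1 *\<^sub>R dcurve Y \<alpha>) \<bullet> (Y \<alpha> - X \<alpha>))) + W' \<alpha>)"
    unfolding perp_inner W'_def vector_add_component vector_minus_component vector_scaleR_component real_scaleR_def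
    by (intro set_lebesgue_integral_cong allI impI volume_density_identity) simp
  also have "\<dots> = 2 * (LINT \<alpha>:unit_I|lebesgue. - (1/6) * (perp (X \<alpha> $ 1 *\<^sub>R dcurve X \<alpha>
      + (X \<alpha> $ 1 + Y \<alpha> $ 1) *\<^sub>R (dcurve X \<alpha> + dcurve Y \<alpha>) + Y \<alpha> $ 1 *\<^sub>R dcurve Y \<alpha>) \<bullet> (Y \<alpha> - X \<alpha>)))"
    by (simp only: set_integral_add(2)[OF set_integrable_mult_right[OF i4] i3] W0 set_integral_mult_right add_0_right)
  also have "(LINT \<alpha>:unit_I|lebesgue. - (1/6) * (perp (X \<alpha> $ 1 *\<^sub>R dcurve X \<alpha>
      + (X \<alpha> $ 1 + Y \<alpha> $ 1) *\<^sub>R (dcurve X \<alpha> + dcurve Y \<alpha>) + Y \<alpha> $ 1 *\<^sub>R dcurve Y \<alpha>) \<bullet> (Y \<alpha> - X \<alpha>)))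
      = l2_inner unit_I (\<lambda>\<alpha>. Y \<alpha> - X \<alpha>) (f_half X Y)"
    unfolding l2_inner_def
    by (rule set_integral_cong_AE_lebesgue) (use AEg in eventually_elim, simp add: f_half)
  finally show ?thesis by simp
qed

section \<open>The divergence theorem for sets bounded by lines\<close>

lemma eventually_iff_const:
  assumes "eventually (\<lambda>e. P e \<longleftrightarrow> c) F" "F \<noteq> bot"
  shows "eventually P F \<longleftrightarrow> c"
  using eventually_cong[OF assms(1)] by (simp add: eventually_const_iff assms(2))

text \<open>Between neighbouring exceptional points the set \<open>B\<close> is everything or
  nothing, as recorded by \<open>c\<close>. The cell is half open so that cells tile the line, while
  membership and derivative are only controlled in its interior.\<close>

lemma set_integral_FTC_cell:
  fixes f f' :: "real \<Rightarrow> real"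
  assumes "u < v" "\<And>x. x \<in> {u<..<v} \<Longrightarrow> x \<in> B \<longleftrightarrow> c"
    and f: "continuous_on UNIV f" and int: "set_integrable lborel B f'" and [measurable]: "B \<in> sets borel"
    and d: "\<And>x. x \<in> {u<..<v} \<Longrightarrow> x \<in> B \<Longrightarrow> (f has_real_derivative f' x) (at x)"
  shows "(LINT x:B \<inter> {u..<v}|lborel. f' x) = of_bool c * (f v - f u)"
proof -
  have i: "set_integrable lborel (B \<inter> {u..<v}) f'" "set_integrable lborel (B \<inter> {u<..<v}) f'"
    by (rule set_integrable_subset[OF int]; simp)+
  have "(LINT x:B \<inter> {u..<v}|lborel. f' x) = (LINT x:B \<inter> {u<..<v}|lborel. f' x)"
    unfolding set_lebesgue_integral_def
  proof (rule integral_cong_AE)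
    show "(\<lambda>x. indicat_real (B \<inter> {u..<v}) x *\<^sub>R f' x) \<in> borel_measurable lborel"
      using i(1) unfolding set_integrable_def by (rule borel_measurable_integrable)
    show "(\<lambda>x. indicat_real (B \<inter> {u<..<v}) x *\<^sub>R f' x) \<in> borel_measurable lborel"
      using i(2) unfolding set_integrable_def by (rule borel_measurable_integrable)
    show "AE x in lborel. indicat_real (B \<inter> {u..<v}) x *\<^sub>R f' x = indicat_real (B \<inter> {u<..<v}) x *\<^sub>R f' x"
      using AE_lborel_singleton[of u] by eventually_elim (auto simp: indicator_def)
  qed
  also have "\<dots> = of_bool c * (f v - f u)"
  proof (cases c)
    case True
    then have B: "B \<inter> {u<..<v} = {u<..<v}" using assms(2) by auto
    have "(f' has_integral f v - f u) {u..v}"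
    proof (rule fundamental_theorem_of_calculus_interior)
      show "continuous_on {u..v} f" using f continuous_on_subset by blast
      show "(f has_vector_derivative f' x) (at x)" if "x \<in> {u<..<v}" for x
        using d[OF that] assms(2)[OF that] True by (simp add: has_real_derivative_iff_has_vector_derivative)
    qed (use assms(1) in simp)
    then have "(f' has_integral f v - f u) {u<..<v}"
      using has_integral_open_interval[of f' _ u v] by (simp add: box_real)
    then show ?thesis
      using set_borel_integral_eq_integral(2)[OF i(2)] True unfolding B by (simp add: integral_unique)
  next
    case False
    then have "B \<inter> {u<..<v} = {}" using assms(2) by auto
    then show ?thesis using False by (simp add: set_lebesgue_integral_def)
  qed
  finally show ?thesis .
qed

text \<open>Induction that adds the exceptional points from left to right, with the integral cut off
  at \<open>b\<close>. The factor of \<open>f s\<close> is the jump of the indicator of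
  \<open>B\<close> at \<open>s\<close>; the last term is the end of an interval of \<open>B\<close>
  that is still open at the cut. Points of \<open>S\<close> off the frontier have equal one-sided
  values and contribute 0.\<close>

lemma FTC_open_set_below:
  fixes f f' :: "real \<Rightarrow> real"
  assumes "finite S"
    and B: "open B" "\<And>x. x \<in> B \<Longrightarrow> lo \<le> x"
    and f: "continuous_on UNIV f" and int: "set_integrable lborel B f'"
  shows "\<forall>s\<in>S. s < b \<Longrightarrow> frontier B \<inter> {..b} \<subseteq> S \<Longrightarrow>
    (\<And>x. x \<in> B \<Longrightarrow> x < b \<Longrightarrow> x \<notin> S \<Longrightarrow> (f has_real_derivative f' x) (at x)) \<Longrightarrow>
    (LINT x:B \<inter> {..<b}|lborel. f' x) =
      (\<Sum>s\<in>S. (of_bool (\<forall>\<^sub>F e in at_right 0. s - e \<in> B) - of_bool (\<forall>\<^sub>F e in at_right 0. s + e \<in> B)) * f s)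
      + of_bool (b \<in> B) * f b"
  using assms(1)
proof (induction S arbitrary: b rule: finite_linorder_max_induct)
  case empty
  \<comment> \<open>A point left of all of \<open>B\<close>. The ray up to \<open>b\<close> is
    connected and misses the frontier, so it lies outside \<open>B\<close> together with this
    point.\<close>
  have "min b (lo - 1) \<in> {..b} - B" using B(2) by fastforce
  then have "{..b} - B \<noteq> {}" by blast
  moreover have "{..b} \<inter> frontier B = {}" using empty(2) by blast
  ultimately have "{..b} \<inter> B = {}"
    using connected_Int_frontier[OF connected_Iic] by blast
  moreover from this have "B \<inter> {..<b} = {}" by (auto dest: less_imp_le)
  ultimately show ?case by (auto simp: set_lebesgue_integral_def)
next
  case (insert m A)
  have [measurable]: "B \<in> sets borel" using B(1) by simp
  have mb: "m < b" using insert.prems(1) by simp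
  \<comment> \<open>The induction hypothesis is applied with a cut \<open>b'\<close> strictly
    between the earlier points and \<open>m\<close>. Membership in \<open>B\<close> is then constant
    from \<open>b'\<close> up to \<open>m\<close> and from \<open>m\<close> up to \<open>b\<close>,
    and the boundary term at \<open>b'\<close> cancels.\<close>
  obtain b' where b': "b' < m" "\<forall>a\<in>A. a < b'"
  proof (cases "A = {}")
    case True
    then show ?thesis using that[of "m - 1"] by simp
  next
    case False
    then have "Max A < m" using insert by simp
    then obtain b' where "Max A < b'" "b' < m" using dense by blast
    then show ?thesis using that[of b'] insert False by simp
  qed
  have const: "x \<in> B \<longleftrightarrow> y \<in> B" if "x \<in> I" "y \<in> I" "connected I" "I \<inter> insert m A = {}" "I \<subseteq> {..b}" for x y I
  proof (rule ccontr)
    assume "(x \<in> B) \<noteq> (y \<in> B)"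
    then have "I \<inter> B \<noteq> {}" "I - B \<noteq> {}" using that(1,2) by auto
    then have "I \<inter> frontier B \<noteq> {}"
      using connected_Int_frontier[OF that(3)] by blast
    then obtain w where "w \<in> I" "w \<in> frontier B" by blast
    then show False using that(4,5) insert.prems(2) by auto
  qed
  have 1: "x \<in> B \<longleftrightarrow> b' \<in> B" if "x \<in> {b'..<m}" for x
  proof (rule const[of _ "{b'..<m}"])
    show "{b'..<m} \<inter> insert m A = {}" using b' by fastforce
    show "connected {b'..<m}" by (simp add: convex_connected)
  qed (use that b' mb in auto)
  have 2: "x \<in> B \<longleftrightarrow> b \<in> B" if "x \<in> {m<..b}" for x
  proof (rule const[of _ "{m<..b}"])
    show "{m<..b} \<inter> insert m A = {}" using insert.hyps(2) by fastforce
    show "connected {m<..b}" by (simp add: convex_connected)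
  qed (use that mb in auto)
  have L: "(\<forall>\<^sub>F e in at_right 0. m - e \<in> B) \<longleftrightarrow> b' \<in> B"
  proof (rule eventually_iff_const)
    have "\<forall>\<^sub>F e in at_right 0. e < m - b'" 
      using b' by (intro order_tendstoD(2)[OF tendsto_ident_at]) auto
    moreover have "\<forall>\<^sub>F e in at_right 0. (0::real) < e"
      by (rule eventually_at_right_less)
    ultimately show "\<forall>\<^sub>F e in at_right 0. (m - e \<in> B) = (b' \<in> B)"
      by eventually_elim (rule 1, simp)
  qed simp
  have R: "(\<forall>\<^sub>F e in at_right 0. m + e \<in> B) \<longleftrightarrow> b \<in> B"
  proof (rule eventually_iff_const)
    have "\<forall>\<^sub>F e in at_right 0. e < b - m" 
      using mb by (intro order_tendstoD(2)[OF tendsto_ident_at]) auto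
    moreover have "\<forall>\<^sub>F e in at_right 0. (0::real) < e"
      by (rule eventually_at_right_less)
    ultimately show "\<forall>\<^sub>F e in at_right 0. (m + e \<in> B) = (b \<in> B)"
      by eventually_elim (rule 2, simp)
  qed simp
  have i: "set_integrable lborel (B \<inter> C) f'" if "C \<in> sets borel" for C
    by (rule set_integrable_subset[OF int]) (use that in auto)
  have IH: "(LINT x:B \<inter> {..<b'}|lborel. f' x) =
      (\<Sum>s\<in>A. (of_bool (\<forall>\<^sub>F e in at_right 0. s - e \<in> B) - of_bool (\<forall>\<^sub>F e in at_right 0. s + e \<in> B)) * f s)
      + of_bool (b' \<in> B) * f b'"
  proof (rule insert.IH)
    show "frontier B \<inter> {..b'} \<subseteq> A"
      using insert.prems(2) b' mb by auto
    show "(f has_real_derivative f' x) (at x)" if "x \<in> B" "x < b'" "x \<notin> A" for x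
      using insert.prems(3)[of x] that b' mb by auto
  qed (use b' in simp)
  have I1: "(LINT x:B \<inter> {b'..<m}|lborel. f' x) = of_bool (b' \<in> B) * (f m - f b')"
  proof (rule set_integral_FTC_cell[where f = f and f' = f' and B = B and u = b' and v = m and c = "b' \<in> B"])
    fix x assume x: "x \<in> {b'<..<m}"
    then show "x \<in> B \<longleftrightarrow> b' \<in> B" by (intro 1) simp
    assume "x \<in> B"
    then show "(f has_real_derivative f' x) (at x)"
      using insert.prems(3)[of x] x b' mb by (metis greaterThanLessThan_iff insertE not_less_iff_gr_or_eq order_less_trans)
  qed (use b' f int \<open>B \<in> sets borel\<close> in auto)
  have I2: "(LINT x:B \<inter> {m..<b}|lborel. f' x) = of_bool (b \<in> B) * (f b - f m)"
  proof (rule set_integral_FTC_cell[where f = f and f' = f' and B = B and u = m and v = b and c = "b \<in> B"])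
    fix x assume x: "x \<in> {m<..<b}"
    then show "x \<in> B \<longleftrightarrow> b \<in> B" by (intro 2) simp
    assume "x \<in> B"
    then show "(f has_real_derivative f' x) (at x)"
      using insert.prems(3)[of x] x insert.hyps(2) by (metis greaterThanLessThan_iff insertE not_less_iff_gr_or_eq order_less_trans)
  qed (use mb f int \<open>B \<in> sets borel\<close> in auto)
  have "B \<inter> {..<b} = (B \<inter> {..<b'} \<union> B \<inter> {b'..<m}) \<union> B \<inter> {m..<b}"
    using b' mb by auto
  then have "(LINT x:B \<inter> {..<b}|lborel. f' x) = (LINT x:(B \<inter> {..<b'} \<union> B \<inter> {b'..<m}) \<union> B \<inter> {m..<b}|lborel. f' x)"
    by simp
  also have "\<dots> = (LINT x:B \<inter> {..<b'}|lborel. f' x) + (LINT x:B \<inter> {b'..<m}|lborel. f' x) + (LINT x:B \<inter> {m..<b}|lborel. f' x)"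
  proof -
    have "B \<inter> {..<b'} \<inter> (B \<inter> {b'..<m}) = {}" "(B \<inter> {..<b'} \<union> B \<inter> {b'..<m}) \<inter> (B \<inter> {m..<b}) = {}"
      using b' mb by auto
    then show ?thesis
      using set_integral_Un[OF _ i i] set_integral_Un[OF _ set_integrable_Un[OF i i] i] by simp
  qed
  finally have *: "(LINT x:B \<inter> {..<b}|lborel. f' x) = (LINT x:B \<inter> {..<b'}|lborel. f' x)
    + (LINT x:B \<inter> {b'..<m}|lborel. f' x) + (LINT x:B \<inter> {m..<b}|lborel. f' x)" .
  have "m \<notin> A" using insert.hyps(2) by blast
  then show ?case
    unfolding * IH I1 I2 sum.insert[OF insert.hyps(1) \<open>m \<notin> A\<close>] L R by (simp add: algebra_simps)
qed

lemma FTC_open_set: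
  fixes f f' :: "real \<Rightarrow> real"
  assumes "finite S" "open B" "bounded B" "frontier B \<subseteq> S" "continuous_on UNIV f" "set_integrable lborel B f'"
    and "\<And>x. x \<in> B \<Longrightarrow> x \<notin> S \<Longrightarrow> (f has_real_derivative f' x) (at x)"
  shows "(LINT x:B|lborel. f' x) = (\<Sum>s\<in>S. (of_bool (\<forall>\<^sub>F e in at_right 0. s - e \<in> B)
      - of_bool (\<forall>\<^sub>F e in at_right 0. s + e \<in> B)) * f s)"
proof -
  have "bounded (B \<union> S)" using assms(1,3) by (simp add: finite_imp_bounded)
  then obtain K where K: "\<forall>x\<in>B \<union> S. norm x \<le> K" using bounded_iff by blast
  have *: "x < K + 1 \<and> - K \<le> x" if "x \<in> B \<union> S" for x using bspec[OF K that] by auto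
  then have "B \<inter> {..<K+1} = B" "K + 1 \<notin> B" by fastforce+
  then show ?thesis
    using FTC_open_set_below[OF assms(1,2) _ assms(5,6), of "-K" "K + 1"] * assms(4,7) by auto
qed

text \<open>Both measures agree on boxes. The pair \<open>(i, j)\<close> is kept arbitrary so that
  one Fubini argument serves both partial derivatives.\<close>

lemma lborel_plane_axes:
  fixes i j :: 2
  assumes "i \<noteq> j"
  shows "(lborel :: (real^2) measure) = distr (lborel \<Otimes>\<^sub>M lborel) borel (\<lambda>(s, t). s *\<^sub>R axis i 1 + t *\<^sub>R axis j 1)"
proof (rule lborel_eqI)
  have UN: "UNIV = {i, j}" using assms exhaust_2[of i] exhaust_2[of j] by (auto simp: UNIV_2)
  then have all_ij: "(\<forall>k. P k) \<longleftrightarrow> P i \<and> P j" for P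
    by (metis UNIV_I empty_iff insertE)
  fix l u :: "real^2" assume lu: "\<And>b. b \<in> Basis \<Longrightarrow> l \<bullet> b \<le> u \<bullet> b"
  have le: "l $ k \<le> u $ k" for k using lu[of "axis k 1"] by (simp add: inner_axis axis_in_Basis_iff)
  have m: "(\<lambda>(s, t). s *\<^sub>R axis i 1 + t *\<^sub>R axis j 1 :: real^2) \<in> lborel \<Otimes>\<^sub>M lborel \<rightarrow>\<^sub>M borel"
    by measurable
  have "(\<lambda>(s, t). s *\<^sub>R axis i 1 + t *\<^sub>R axis j 1 :: real^2) -` box l u \<inter> space (lborel \<Otimes>\<^sub>M lborel)
      = {l $ i<..<u $ i} \<times> {l $ j<..<u $ j}"
    using assms by (auto simp: mem_box_cart space_pair_measure all_ij axis_def)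
  then have "emeasure (distr (lborel \<Otimes>\<^sub>M lborel) borel (\<lambda>(s, t). s *\<^sub>R axis i 1 + t *\<^sub>R axis j 1)) (box l u)
     = emeasure (lborel \<Otimes>\<^sub>M lborel) ({l $ i<..<u $ i} \<times> {l $ j<..<u $ j})"
    by (subst emeasure_distr[OF m]) simp_all
  also have "\<dots> = ennreal (u $ i - l $ i) * ennreal (u $ j - l $ j)"
    by (subst lborel.emeasure_pair_measure_Times) (simp_all add: le)
  also have "\<dots> = (\<Prod>k\<in>UNIV. (u - l) $ k)"
    using assms by (simp add: UN ennreal_mult' le)
  also have "\<dots> = (\<Prod>b\<in>Basis. (u - l) \<bullet> b)"
    unfolding Basis_vec_def by (simp add: prod.UNION_disjoint axis_eq_axis inner_axis)
  finally show "emeasure (distr (lborel \<Otimes>\<^sub>M lborel) borel (\<lambda>(s, t). s *\<^sub>R axis i 1 + t *\<^sub>R axis j 1)) (box l u)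
     = (\<Prod>b\<in>Basis. (u - l) \<bullet> b)" .
qed simp

section \<open>One-sided traces at the lines of an arrangement\<close>

text \<open>The one-sided limit of the indicator of \<open>A\<close> at \<open>x\<close> in
  direction \<open>v\<close>, set to 0 where the limit does not exist.\<close>

definition side_trace :: "(real^2) set \<Rightarrow> real^2 \<Rightarrow> real^2 \<Rightarrow> real"
  where "side_trace A x v = of_bool (\<forall>\<^sub>F e in at_right 0. x + e *\<^sub>R v \<in> A)"

text \<open>\<open>c\<close> belongs to the side into which \<open>n\<close> points,
  \<open>c'\<close> to the opposite one. The separating line itself is left free.\<close>

definition sides :: "(real^2) set \<Rightarrow> real^2 \<Rightarrow> real^2 \<Rightarrow> real \<Rightarrow> bool \<Rightarrow> bool \<Rightarrow> bool"
  where "sides A n x \<epsilon> c c' \<longleftrightarrow> (\<forall>y\<in>ball x \<epsilon>. (n \<bullet> (y - x) > 0 \<longrightarrow> (y \<in> A \<longleftrightarrow> c)) \<and> (n \<bullet> (y - x) < 0 \<longrightarrow> (y \<in> A \<longleftrightarrow> c')))"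

lemma eventually_in_ball:
  assumes "\<epsilon> > 0" shows "\<forall>\<^sub>F e in at_right 0. x + e *\<^sub>R v \<in> ball (x::'a::real_normed_vector) \<epsilon>"
proof -
  have "((\<lambda>e. x + e *\<^sub>R v) \<longlongrightarrow> x + 0 *\<^sub>R v) (at_right 0)"
    by (intro tendsto_intros)
  then show ?thesis
    using assms by (simp add: tendsto_iff dist_commute)
qed

lemma side_trace_sides:
  assumes "sides A n x \<epsilon> c c'" "\<epsilon> > 0"
  shows "n \<bullet> v > 0 \<Longrightarrow> side_trace A x v = of_bool c" "n \<bullet> v < 0 \<Longrightarrow> side_trace A x v = of_bool c'"
proof -
  note ev = eventually_in_ball[OF assms(2), of x v] eventually_at_right_less[of 0]
  show "side_trace A x v = of_bool c" if "n \<bullet> v > 0"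
  proof -
    have "\<forall>\<^sub>F e in at_right 0. (x + e *\<^sub>R v \<in> A) = c"
      using ev by eventually_elim (use assms(1) that in \<open>simp add: sides_def\<close>)
    then show ?thesis unfolding side_trace_def by (simp add: eventually_iff_const)
  qed
  show "side_trace A x v = of_bool c'" if "n \<bullet> v < 0"
  proof -
    have "\<forall>\<^sub>F e in at_right 0. (x + e *\<^sub>R v \<in> A) = c'"
      using ev by eventually_elim (use assms(1) that in \<open>simp add: sides_def mult_pos_neg\<close>)
    then show ?thesis unfolding side_trace_def by (simp add: eventually_iff_const)
  qed
qed

text \<open>Points of the same line inside the ball see the same two sides, which is why traces are
  locally constant along a line.\<close>

lemma sides_move:
  assumes "sides A n x \<epsilon> c c'" "y \<in> ball x \<epsilon>" "n \<bullet> y = n \<bullet> x"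
  obtains \<delta> where "\<delta> > 0" "sides A n y \<delta> c c'"
proof -
  obtain \<delta> where \<delta>: "\<delta> > 0" "ball y \<delta> \<subseteq> ball x \<epsilon>"
    using openE[OF open_ball assms(2)] by blast
  then have "sides A n y \<delta> c c'"
    using assms(1,3) unfolding sides_def by (auto simp: inner_diff_right)
  then show ?thesis using that \<delta>(1) by blast
qed

lemma side_trace_outside:
  assumes "x \<notin> closure A" shows "side_trace A x v = 0"
proof -
  obtain \<epsilon> where "\<epsilon> > 0" "ball x \<epsilon> \<subseteq> - closure A"
    using assms open_contains_ball[of "- closure A"] by auto
  then have "\<forall>\<^sub>F e in at_right 0. (x + e *\<^sub>R v \<in> A) = False"
    using eventually_in_ball[of \<epsilon> x v] closure_subset[of A] by (auto elim!: eventually_mono)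
  from eventually_iff_const[OF this] show ?thesis unfolding side_trace_def by simp
qed

text \<open>Identifies the Jacobian between arc length on a line and a coordinate on it with a
  component of its normal.\<close>

lemma perp_component:
  fixes i j :: 2 assumes "i \<noteq> j"
  shows "\<bar>perp v $ j\<bar> = \<bar>v $ i\<bar>"
  using assms exhaust_2[of i] exhaust_2[of j] by (auto simp: perp_def)

lemma inner_perp_self: "v \<bullet> perp v = 0"
  by (simp add: perp_def inner_vec_def sum_2)

lemma inner_perp_perp: "perp v \<bullet> perp w = v \<bullet> w"
  by (simp add: perp_def inner_vec_def sum_2)

lemma norm_perp: "norm (perp v) = norm v"
  by (simp add: norm_eq_sqrt_inner inner_perp_perp)

lemma plane_decompose:
  fixes n x :: "real^2"
  assumes "norm n = 1" shows "x = (n \<bullet> x) *\<^sub>R n + (perp n \<bullet> x) *\<^sub>R perp n"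
proof -
  have n: "n $ 1 * n $ 1 + n $ 2 * n $ 2 = 1"
    using assms by (simp add: norm_eq_sqrt_inner inner_vec_def sum_2)
  have "x $ 1 * (n $ 1 * n $ 1 + n $ 2 * n $ 2) = x $ 1" "x $ 2 * (n $ 1 * n $ 1 + n $ 2 * n $ 2) = x $ 2"
    by (simp_all only: n mult_1_right)
  then show ?thesis
    by (simp add: vec_eq_iff forall_2 perp_def inner_vec_def sum_2 algebra_simps)
qed

text \<open>Boundaries are covered by complete lines instead of segments: distinct lines meet in at most one
  point, so that almost every point of a line lies on no other line, whereas segments may overlap.\<close>

locale line_arrangement =
  fixes \<L> :: "(real^2) set set" and n :: "(real^2) set \<Rightarrow> real^2" and c :: "(real^2) set \<Rightarrow> real"
  assumes finite_lines: "finite \<L>"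
    and norm_n: "H \<in> \<L> \<Longrightarrow> norm (n H) = 1"
    and line_eq: "H \<in> \<L> \<Longrightarrow> H = {x. n H \<bullet> x = c H}"
begin

text \<open>Arc length parametrisation of \<open>H\<close>, since \<open>n H\<close> is a unit
  vector; \<open>\<tau> = 0\<close> is the point closest to the origin.\<close>

definition pt :: "(real^2) set \<Rightarrow> real \<Rightarrow> real^2"
  where "pt H \<tau> = c H *\<^sub>R n H + \<tau> *\<^sub>R perp (n H)"

definition generic :: "(real^2) set \<Rightarrow> real^2 \<Rightarrow> bool"
  where "generic H x \<longleftrightarrow> x \<in> H \<and> (\<forall>H'\<in>\<L>. x \<in> H' \<longrightarrow> H' = H)"

text \<open>At a generic point it is 1 if \<open>A\<close> lies only behind \<open>n H\<close>, -1
  if only ahead, and 0 if both sides agree. Its product with \<open>n H\<close> therefore does not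
  depend on the orientation chosen for the line.\<close>

definition jump :: "(real^2) set \<Rightarrow> (real^2) set \<Rightarrow> real^2 \<Rightarrow> real"
  where "jump A H x = side_trace A x (- n H) - side_trace A x (n H)"

lemma inner_n_n: "H \<in> \<L> \<Longrightarrow> n H \<bullet> n H = 1"
  using norm_n by (simp add: norm_eq_1)

lemma mem_line: "H \<in> \<L> \<Longrightarrow> x \<in> H \<longleftrightarrow> n H \<bullet> x = c H"
  using line_eq by blast

lemma pt_in_line: "H \<in> \<L> \<Longrightarrow> pt H \<tau> \<in> H"
  by (simp add: mem_line pt_def inner_add_right inner_n_n inner_perp_self)

lemma pt_of_line: "H \<in> \<L> \<Longrightarrow> x \<in> H \<Longrightarrow> pt H (perp (n H) \<bullet> x) = x"
  using plane_decompose[OF norm_n, of H x] mem_line by (simp add: pt_def)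

lemma perp_inner_pt: "H \<in> \<L> \<Longrightarrow> perp (n H) \<bullet> pt H \<tau> = \<tau>"
  by (simp add: pt_def inner_add_right inner_perp_perp inner_n_n inner_commute[of "perp _" "n _"] inner_perp_self)

lemma continuous_pt: "continuous_on S (pt H)"
  unfolding pt_def by (intro continuous_intros)

lemma closed_line: "H \<in> \<L> \<Longrightarrow> closed H"
  using line_eq closed_hyperplane by metis

lemma finite_not_generic:
  assumes H: "H \<in> \<L>" shows "finite {\<tau>. \<not> generic H (pt H \<tau>)}"
proof -
  have "finite {\<tau>. pt H \<tau> \<in> H'}" if H': "H' \<in> \<L>" "H' \<noteq> H" for H'
  proof (cases "n H' \<bullet> perp (n H) = 0")
    case False
    have "{\<tau>. pt H \<tau> \<in> H'} \<subseteq> {(c H' - c H * (n H' \<bullet> n H)) / (n H' \<bullet> perp (n H))}"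
      using False by (auto simp: mem_line[OF H'(1)] pt_def inner_add_right field_simps)
    then show ?thesis using finite_subset by blast
  next
    case True
    \<comment> \<open>Parallel lines have the same unit normal up to sign, so a common point would
      make them equal.\<close>
    have n': "n H' = (n H \<bullet> n H') *\<^sub>R n H"
      using plane_decompose[OF norm_n[OF H], of "n H'"] True by (simp add: inner_commute)
    have "\<bar>n H \<bullet> n H'\<bar> = 1"
      using norm_n[OF H'(1)] norm_n[OF H] n' by (metis norm_scaleR mult_1_right)
    then have "n H \<bullet> n H' = 1 \<or> n H \<bullet> n H' = -1" by linarith
    then have n'': "n H' = n H \<or> n H' = - n H" using n' by auto
    have "{\<tau>. pt H \<tau> \<in> H'} = {}"
    proof (rule ccontr)
      assume "{\<tau>. pt H \<tau> \<in> H'} \<noteq> {}"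
      then obtain \<tau> where "pt H \<tau> \<in> H'" by blast
      then have "n H' \<bullet> pt H \<tau> = c H'" "n H \<bullet> pt H \<tau> = c H"
        using mem_line H H' pt_in_line by auto
      then have "H' = H"
        using n'' by (subst line_eq[OF H'(1)], subst line_eq[OF H]) auto
      then show False using H'(2) by simp
    qed
    then show ?thesis by simp
  qed
  then have "finite (\<Union>H'\<in>\<L> - {H}. {\<tau>. pt H \<tau> \<in> H'})"
    using finite_lines by auto
  moreover have "{\<tau>. \<not> generic H (pt H \<tau>)} \<subseteq> (\<Union>H'\<in>\<L> - {H}. {\<tau>. pt H \<tau> \<in> H'})"
    using pt_in_line[OF H] by (auto simp: generic_def)
  ultimately show ?thesis using finite_subset by blast
qed

text \<open>A small ball around a generic point meets no line but \<open>H\<close>. Its two open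
  half discs are convex and contain no frontier point of \<open>A\<close>, so each lies inside or
  outside \<open>A\<close>.\<close>

lemma generic_sides:
  assumes H: "H \<in> \<L>" and x: "generic H x" and A: "frontier A \<subseteq> \<Union>\<L>"
  obtains \<epsilon> a b where "\<epsilon> > 0" "sides A (n H) x \<epsilon> a b" "\<And>H'. H' \<in> \<L> \<Longrightarrow> H' \<noteq> H \<Longrightarrow> H' \<inter> ball x \<epsilon> = {}"
proof -
  have "open (- \<Union>(\<L> - {H}))"
    using finite_lines closed_line by (auto intro!: closed_Union)
  moreover have "x \<in> - \<Union>(\<L> - {H})"
    using x by (auto simp: generic_def)
  ultimately obtain \<epsilon> where \<epsilon>: "\<epsilon> > 0" "ball x \<epsilon> \<subseteq> - \<Union>(\<L> - {H})"
    using open_contains_ball by blast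
  have xH: "n H \<bullet> x = c H" using x mem_line[OF H] by (simp add: generic_def)
  have const: "y \<in> A \<longleftrightarrow> z \<in> A" if "y \<in> S" "z \<in> S" "convex S" "S \<subseteq> ball x \<epsilon>" "S \<inter> H = {}" for S y z
  proof (rule ccontr)
    assume "(y \<in> A) \<noteq> (z \<in> A)"
    then have "S \<inter> A \<noteq> {}" "S - A \<noteq> {}" using that(1,2) by auto
    then have "S \<inter> frontier A \<noteq> {}"
      using connected_Int_frontier[OF convex_connected[OF that(3)]] by blast
    then obtain w where "w \<in> S" "w \<in> frontier A" by blast
    moreover from this obtain H' where "H' \<in> \<L>" "w \<in> H'" using A by blast
    ultimately show False using \<epsilon>(2) that(4,5) by (cases "H' = H") auto
  qed
  \<comment> \<open>For \<open>s = 1\<close> and \<open>s = -1\<close> these are the two open half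
    discs.\<close>
  let ?S = "\<lambda>s::real. ball x \<epsilon> \<inter> {y. s * (n H \<bullet> (y - x)) > 0}"
  have S: "convex (?S s)" "?S s \<inter> H = {}" for s
  proof -
    have eq: "{y. s * (n H \<bullet> (y - x)) > 0} = {y. (s *\<^sub>R n H) \<bullet> y > s * (n H \<bullet> x)}"
      by (auto simp: inner_diff_right algebra_simps)
    show "convex (?S s)" unfolding eq by (intro convex_Int convex_ball convex_halfspace_gt)
    show "?S s \<inter> H = {}" using xH mem_line[OF H] by (auto simp: inner_diff_right)
  qed
  have "\<exists>a. \<forall>y\<in>?S s. y \<in> A \<longleftrightarrow> a" for s
  proof (cases "?S s = {}")
    case False
    then obtain z where "z \<in> ?S s" by blast
    then show ?thesis
      by (intro exI[of _ "z \<in> A"] ballI const[OF _ _ S(1)[of s] Int_lower1 S(2)])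
  qed blast
  from this[of 1] this[of "-1"] obtain a b
    where "\<forall>y\<in>?S 1. y \<in> A \<longleftrightarrow> a" "\<forall>y\<in>?S (-1). y \<in> A \<longleftrightarrow> b"
    by (elim exE)
  then have "sides A (n H) x \<epsilon> a b" by (auto simp: sides_def)
  moreover have "H' \<inter> ball x \<epsilon> = {}" if "H' \<in> \<L>" "H' \<noteq> H" for H'
    using \<epsilon>(2) that by blast
  ultimately show ?thesis by (rule that[OF \<epsilon>(1)])
qed

lemma jump_sides:
  assumes "H \<in> \<L>" "sides A (n H) x \<epsilon> a b" "\<epsilon> > 0"
  shows "jump A H x = of_bool b - of_bool a"
  using side_trace_sides(1)[OF assms(2,3), of "n H"] side_trace_sides(2)[OF assms(2,3), of "- n H"] inner_n_n[OF assms(1)]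
  by (simp add: jump_def)

text \<open>Every transversal direction sees the same two sides as the normal; only the sign of
  crossing matters. Thus axis-parallel traces, as produced by Fubini, become normal jumps.\<close>

lemma side_trace_direction:
  assumes H: "H \<in> \<L>" and x: "generic H x" and A: "frontier A \<subseteq> \<Union>\<L>" and v: "n H \<bullet> v \<noteq> 0"
  shows "side_trace A x (- v) - side_trace A x v = sgn (n H \<bullet> v) * jump A H x"
proof -
  obtain \<epsilon> a b where s: "\<epsilon> > 0" "sides A (n H) x \<epsilon> a b" by (rule generic_sides[OF H x A])
  note st = side_trace_sides[OF s(2,1)]
  show ?thesis
    using v st[of v] st[of "- v"] by (cases "n H \<bullet> v > 0") (auto simp: jump_sides[OF H s(2,1)])
qed

text \<open>Off the finitely many non-generic parameters the jump is locally constant, hence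
  continuous.\<close>

lemma jump_measurable:
  assumes H: "H \<in> \<L>" and A: "frontier A \<subseteq> \<Union>\<L>"
  shows "(\<lambda>\<tau>. jump A H (pt H \<tau>)) \<in> borel_measurable borel"
proof (rule borel_measurable_continuous_countable_exceptions)
  let ?N = "{\<tau>. \<not> generic H (pt H \<tau>)}"
  show "countable ?N" using finite_not_generic[OF H] by (rule countable_finite)
  show "continuous_on (- ?N) (\<lambda>\<tau>. jump A H (pt H \<tau>))"
  proof (rule continuous_at_imp_continuous_on, rule ballI)
    fix \<tau> assume "\<tau> \<in> - ?N"
    then have x: "generic H (pt H \<tau>)" by simp
    obtain \<epsilon> a b where s: "\<epsilon> > 0" "sides A (n H) (pt H \<tau>) \<epsilon> a b" by (rule generic_sides[OF H x A])
    have "open (pt H -` ball (pt H \<tau>) \<epsilon>)"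
      by (rule open_vimage[OF _ continuous_pt]) simp
    moreover have "\<tau> \<in> pt H -` ball (pt H \<tau>) \<epsilon>" using s(1) by simp
    moreover have "jump A H (pt H \<sigma>) = of_bool b - of_bool a" if m: "\<sigma> \<in> pt H -` ball (pt H \<tau>) \<epsilon>" for \<sigma>
    proof -
      have "n H \<bullet> pt H \<sigma> = n H \<bullet> pt H \<tau>"
        using pt_in_line[OF H] mem_line[OF H] by simp
      then obtain \<delta> where "\<delta> > 0" "sides A (n H) (pt H \<sigma>) \<delta> a b"
        by (rule sides_move[OF s(2) m[unfolded vimage_eq]])
      then show ?thesis by (simp add: jump_sides[OF H])
    qed
    ultimately show "isCont (\<lambda>\<tau>. jump A H (pt H \<tau>)) \<tau>"
      by (subst isCont_cong[where g = "\<lambda>_. of_bool b - of_bool a"]) (auto simp: eventually_nhds)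
  qed
qed

text \<open>A continuous function is bounded only on compact sets, but the jump vanishes off
  \<open>closure A\<close> and so confines the integral to a bounded part of the line.\<close>

lemma jump_integrable:
  assumes H: "H \<in> \<L>" and A: "frontier A \<subseteq> \<Union>\<L>" "bounded A" and f: "continuous_on UNIV f"
  shows "integrable lborel (\<lambda>\<tau>. jump A H (pt H \<tau>) * f (pt H \<tau>) :: real)"
proof -
  obtain K where K: "\<And>x. x \<in> closure A \<Longrightarrow> norm x \<le> K"
    using A(2) bounded_closure bounded_iff by metis
  have zero: "jump A H (pt H \<tau>) = 0" if "\<tau> \<notin> {-K..K}" for \<tau>
  proof -
    have "\<bar>\<tau>\<bar> \<le> norm (pt H \<tau>)"
      using Cauchy_Schwarz_ineq2[of "perp (n H)" "pt H \<tau>"] perp_inner_pt[OF H] norm_n[OF H] norm_perp[of "n H"] by simp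
    then have "pt H \<tau> \<notin> closure A" using K that by fastforce
    then show ?thesis by (simp add: jump_def side_trace_outside)
  qed
  have fp: "continuous_on S (\<lambda>\<tau>. f (pt H \<tau>))" for S
    by (rule continuous_on_compose2[OF f continuous_pt]) simp
  have "set_integrable lborel {-K..K} (\<lambda>\<tau>. f (pt H \<tau>))"
    by (rule borel_integrable_atLeastAtMost'[OF fp])
  then have "integrable lborel (\<lambda>\<tau>. indicator {-K..K} \<tau> *\<^sub>R f (pt H \<tau>))"
    by (simp add: set_integrable_def)
  then show ?thesis
  proof (rule Bochner_Integration.integrable_bound)
    show "(\<lambda>\<tau>. jump A H (pt H \<tau>) * f (pt H \<tau>)) \<in> borel_measurable lborel"
      using borel_measurable_times[OF jump_measurable[OF H A(1)] borel_measurable_continuous_onI[OF fp]] by simp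
    show "AE \<tau> in lborel. norm (jump A H (pt H \<tau>) * f (pt H \<tau>)) \<le> norm (indicat_real {- K..K} \<tau> *\<^sub>R f (pt H \<tau>))"
    proof (rule AE_I2)
      fix \<tau>
      have "\<bar>jump A H (pt H \<tau>)\<bar> \<le> 1" by (simp add: jump_def side_trace_def)
      then show "norm (jump A H (pt H \<tau>) * f (pt H \<tau>)) \<le> norm (indicat_real {- K..K} \<tau> *\<^sub>R f (pt H \<tau>))"
        using zero[of \<tau>] by (auto simp: indicator_def abs_mult mult_left_le_one_le)
    qed
  qed
qed

end

section \<open>The divergence theorem by Fubini\<close>

context line_arrangement begin

text \<open>Fubini: on almost every line in direction \<open>axis i 1\<close>, the set \<open>A\<close> is a finite union of
  intervals whose end points are generic points of the arrangement.\<close>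

theorem integral_partial_derivative:
  fixes f f' :: "real^2 \<Rightarrow> real"
  assumes A: "open A" "bounded A" "frontier A \<subseteq> \<Union>\<L>"
    and f: "continuous_on UNIV f" and f': "set_integrable lborel A f'"
    and d: "\<And>x. x \<in> A \<Longrightarrow> x \<notin> \<Union>\<L> \<Longrightarrow> ((\<lambda>s. f (x + s *\<^sub>R axis i 1)) has_real_derivative f' x) (at 0)"
  shows "(LINT x:A|lborel. f' x) = (\<Sum>H\<in>\<L>. LINT \<tau>|lborel. jump A H (pt H \<tau>) * f (pt H \<tau>) * n H $ i)"
proof -
  define j :: 2 where "j = (if i = 1 then 2 else 1)"
  have ij: "i \<noteq> j" by (simp add: j_def)
  define emb where "emb s t = s *\<^sub>R axis i 1 + t *\<^sub>R axis j (1::real)" for s t :: real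
  have UN: "UNIV = {i, j}" using ij exhaust_2[of i] exhaust_2[of j] by (auto simp: UNIV_2)
  have n_emb: "w \<bullet> emb s t = w $ i * s + w $ j * t" for w s t
    by (simp add: emb_def inner_add_right inner_axis mult.commute)
  have emb_comp: "emb s t $ i = s" "emb s t $ j = t" for s t
    using ij by (simp_all add: emb_def axis_def)
  have emb_eq: "x = emb (x $ i) (x $ j)" for x
  proof -
    have "x $ k = emb (x $ i) (x $ j) $ k" for k
    proof -
      have "k = i \<or> k = j" using UN by blast
      then show ?thesis using emb_comp[of "x $ i" "x $ j"] by auto
    qed
    then show ?thesis unfolding vec_eq_iff by blast
  qed
  have emb_cont: "continuous_on S (\<lambda>s. emb s t)" for S t unfolding emb_def by (intro continuous_intros)
  \<comment> \<open>The lines transversal to the direction of integration. The others have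
    \<open>n H $ i = 0\<close>, so they can be added back at the end at no cost.\<close>
  define L' where "L' = {H \<in> \<L>. n H $ i \<noteq> 0}"
  have finL': "finite L'" "L' \<subseteq> \<L>" using finite_lines by (auto simp: L'_def)
  \<comment> \<open>\<open>sx H t\<close> is the coordinate at which the line at level
    \<open>t\<close> in direction \<open>i\<close> crosses \<open>H\<close>, and
    \<open>q H t\<close> the crossing point.\<close>
  define sx where "sx H t = (c H - n H $ j * t) / n H $ i" for H t
  define q where "q H t = emb (sx H t) t" for H t
  \<comment> \<open>The coordinate \<open>j\<close> of \<open>pt H \<tau>\<close> is
    \<open>t0 H + k H * \<tau>\<close>, the substitution that turns integrals over the level
    \<open>t\<close> into integrals over arc length.\<close>
  define k where "k H = perp (n H) $ j" for H
  define t0 where "t0 H = c H * n H $ j" for H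
  have k: "\<bar>k H\<bar> = \<bar>n H $ i\<bar>" for H unfolding k_def by (rule perp_component[OF ij])
  have on_line: "emb s t \<in> H \<longleftrightarrow> s = sx H t" if "H \<in> L'" for H s t
    using that finL' by (auto simp: mem_line n_emb sx_def L'_def field_simps)
  have pt_q: "q H (t0 H + k H * \<tau>) = pt H \<tau>" if H: "H \<in> L'" for H \<tau>
  proof -
    have "pt H \<tau> $ j = t0 H + k H * \<tau>" by (simp add: pt_def t0_def k_def)
    then have "pt H \<tau> = emb (pt H \<tau> $ i) (t0 H + k H * \<tau>)" using emb_eq[of "pt H \<tau>"] by simp
    moreover from this have "pt H \<tau> $ i = sx H (t0 H + k H * \<tau>)"
      using on_line[OF H] pt_in_line[of H \<tau>] H finL' by (metis subsetD)
    ultimately show ?thesis by (simp add: q_def)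
  qed
  \<comment> \<open>Levels at which the integration line coincides with a line of the arrangement or
    crosses one at a non-generic point. There are finitely many of them.\<close>
  define bad where "bad = (\<Union>H\<in>\<L> - L'. {t. n H $ j * t = c H}) \<union> (\<Union>H\<in>L'. (\<lambda>\<tau>. t0 H + k H * \<tau>) ` {\<tau>. \<not> generic H (pt H \<tau>)})"
  have "finite {t. n H $ j * t = c H}" if "H \<in> \<L> - L'" for H
  proof -
    have "n H \<noteq> 0" using norm_n[of H] that by auto
    then have "n H $ j \<noteq> 0" using that emb_eq[of "n H"] by (auto simp: L'_def emb_def)
    then have "{t. n H $ j * t = c H} \<subseteq> {c H / n H $ j}" by (auto simp: field_simps)
    then show ?thesis using finite_subset by blast
  qed
  then have finbad: "finite bad"
    unfolding bad_def using finite_lines finL' finite_not_generic by auto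
  have good1: "\<exists>H\<in>L'. s = sx H t" if g: "t \<notin> bad" "emb s t \<in> \<Union>\<L>" for s t
  proof -
    obtain H where H: "H \<in> \<L>" "emb s t \<in> H" using g by blast
    have "H \<in> L'"
    proof (rule ccontr)
      assume "H \<notin> L'"
      moreover from this have "n H $ j * t = c H"
        using H by (simp add: mem_line[OF H(1)] n_emb L'_def)
      ultimately show False using g(1) H(1) by (auto simp: bad_def)
    qed
    then show ?thesis using H(2) on_line by blast
  qed
  have good2: "generic H (q H t)" if "t \<notin> bad" "H \<in> L'" for H t
  proof -
    have "k H \<noteq> 0" using k[of H] that by (auto simp: L'_def)
    then have t: "t = t0 H + k H * ((t - t0 H) / k H)" by simp
    have "generic H (pt H ((t - t0 H) / k H))"
    proof (rule ccontr)
      assume "\<not> generic H (pt H ((t - t0 H) / k H))"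
      then have "t \<in> (\<lambda>\<tau>. t0 H + k H * \<tau>) ` {\<tau>. \<not> generic H (pt H \<tau>)}"
        by (intro image_eqI[where x = "(t - t0 H) / k H"] t CollectI)
      then show False using that unfolding bad_def by blast
    qed
    then show ?thesis using pt_q[OF that(2)] t by metis
  qed
  have inj: "inj_on (\<lambda>H. sx H t) L'" if "t \<notin> bad" for t
  proof (rule inj_onI)
    fix H H' assume H: "H \<in> L'" "H' \<in> L'" "sx H t = sx H' t"
    then have "q H t \<in> H'" using on_line[OF H(2)] by (simp add: q_def)
    then show "H = H'" using good2[OF that H(1)] H(2) finL' by (auto simp: generic_def)
  qed
  \<comment> \<open>At a good level distinct lines give distinct crossing points, so the sum over
    exceptional points of the one-dimensional theorem can be reindexed by lines.\<close>
  have inner_integral: "(LINT s|lborel. indicator A (emb s t) * f' (emb s t))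
      = (\<Sum>H\<in>L'. sgn (n H $ i) * (jump A H (q H t) * f (q H t)))"
    if t: "t \<notin> bad" and int: "integrable lborel (\<lambda>s. indicator A (emb s t) * f' (emb s t))" for t
  proof -
    define B where "B = (\<lambda>s. emb s t) -` A"
    have ind: "indicator A (emb s t) = indicat_real B s" for s by (simp add: B_def indicator_def)
    have "open B" unfolding B_def by (rule open_vimage[OF A(1) emb_cont])
    moreover have "bounded B"
    proof -
      obtain K where "\<forall>x\<in>A. norm x \<le> K" using A(2) bounded_iff by blast
      then have "\<forall>s\<in>B. norm s \<le> K"
        using component_le_norm_cart[of "emb _ t" i] by (auto simp: B_def emb_comp intro: order_trans)
      then show ?thesis using bounded_iff by blast
    qed
    moreover have "frontier B \<subseteq> (\<lambda>H. sx H t) ` L'"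
    proof
      fix s assume s: "s \<in> frontier B"
      have "closure B \<subseteq> (\<lambda>s. emb s t) -` closure A"
        unfolding B_def using closure_subset[of A]
        by (intro closure_minimal closed_vimage emb_cont) auto
      then have "emb s t \<in> closure A" "emb s t \<notin> A"
        using s \<open>open B\<close> by (auto simp: frontier_def interior_open B_def)
      then have "emb s t \<in> frontier A" using A(1) by (simp add: frontier_def interior_open)
      then show "s \<in> (\<lambda>H. sx H t) ` L'" using good1[OF t, of s] A(3) by auto
    qed
    moreover have "continuous_on UNIV (\<lambda>s. f (emb s t))"
      by (rule continuous_on_compose2[OF f emb_cont]) simp
    moreover have "set_integrable lborel B (\<lambda>s. f' (emb s t))"
      using int by (simp add: set_integrable_def ind)
    moreover have "((\<lambda>s. f (emb s t)) has_real_derivative f' (emb s t)) (at s)"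
      if "s \<in> B" "s \<notin> (\<lambda>H. sx H t) ` L'" for s
    proof -
      have "emb s t \<notin> \<Union>\<L>" using good1[OF t] that(2) by blast
      then have "((\<lambda>h. f (emb s t + h *\<^sub>R axis i 1)) has_real_derivative f' (emb s t)) (at 0)"
        using d that(1) by (simp add: B_def)
      moreover have "emb s t + h *\<^sub>R axis i 1 = emb (h + s) t" for h by (simp add: emb_def algebra_simps)
      ultimately show ?thesis using DERIV_shift[of "\<lambda>s. f (emb s t)" _ 0 s] by simp
    qed
    ultimately have "(LINT s:B|lborel. f' (emb s t)) = (\<Sum>s\<in>(\<lambda>H. sx H t) ` L'. (of_bool (\<forall>\<^sub>F e in at_right 0. s - e \<in> B)
      - of_bool (\<forall>\<^sub>F e in at_right 0. s + e \<in> B)) * f (emb s t))"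
      using finL' by (intro FTC_open_set) auto
    also have "\<dots> = (\<Sum>H\<in>L'. (of_bool (\<forall>\<^sub>F e in at_right 0. sx H t - e \<in> B)
      - of_bool (\<forall>\<^sub>F e in at_right 0. sx H t + e \<in> B)) * f (q H t))"
      by (subst sum.reindex[OF inj[OF t]]) (simp add: q_def)
    also have "\<dots> = (\<Sum>H\<in>L'. sgn (n H $ i) * (jump A H (q H t) * f (q H t)))"
    proof (rule sum.cong[OF refl])
      fix H assume H: "H \<in> L'"
      have "of_bool (\<forall>\<^sub>F e in at_right 0. sx H t - e \<in> B) = side_trace A (q H t) (- axis i 1)"
        "of_bool (\<forall>\<^sub>F e in at_right 0. sx H t + e \<in> B) = side_trace A (q H t) (axis i 1)"
        unfolding side_trace_def B_def q_def emb_def by (simp_all add: algebra_simps)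
      moreover have "side_trace A (q H t) (- axis i 1) - side_trace A (q H t) (axis i 1) = sgn (n H \<bullet> axis i 1) * jump A H (q H t)"
        using H finL' by (intro side_trace_direction good2[OF t H] A(3)) (auto simp: inner_axis L'_def)
      ultimately show "(of_bool (\<forall>\<^sub>F e in at_right 0. sx H t - e \<in> B)
          - of_bool (\<forall>\<^sub>F e in at_right 0. sx H t + e \<in> B)) * f (q H t) = sgn (n H $ i) * (jump A H (q H t) * f (q H t))"
        by (simp add: inner_axis)
    qed
    finally show ?thesis by (simp add: ind set_lebesgue_integral_def)
  qed
  \<comment> \<open>The substitution contributes \<open>\<bar>n H $ i\<bar>\<close>, which joins
    with the sign of crossing to the normal component \<open>n H $ i\<close>.\<close>
  have line: "integrable lborel (\<lambda>t. jump A H (q H t) * f (q H t))" (is ?I)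
    "sgn (n H $ i) * (LINT t|lborel. jump A H (q H t) * f (q H t)) = (LINT \<tau>|lborel. jump A H (pt H \<tau>) * f (pt H \<tau>) * n H $ i)" (is ?E)
    if H: "H \<in> L'" for H
  proof -
    have k0: "k H \<noteq> 0" using k[of H] H by (auto simp: L'_def)
    have HL: "H \<in> \<L>" using H finL' by blast
    have "integrable lborel (\<lambda>\<tau>. jump A H (q H (t0 H + k H * \<tau>)) * f (q H (t0 H + k H * \<tau>)))"
      using jump_integrable[OF HL A(3,2) f] by (simp add: pt_q[OF H])
    then show ?I
      using lborel_integrable_real_affine_iff[OF k0, of "\<lambda>t. jump A H (q H t) * f (q H t)" "t0 H"] by simp
    have "(LINT t|lborel. jump A H (q H t) * f (q H t))
        = \<bar>n H $ i\<bar> * (LINT \<tau>|lborel. jump A H (pt H \<tau>) * f (pt H \<tau>))"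
      using lborel_integral_real_affine[OF k0, of "\<lambda>t. jump A H (q H t) * f (q H t)" "t0 H"] 
      by (simp add: pt_q[OF H] k)
    then show ?E
      by (simp add: sgn_mult_abs mult.assoc[symmetric])
  qed
  have intA: "integrable lborel (\<lambda>x. indicator A x * f' x)"
    using f' by (simp add: set_integrable_def)
  have m: "(\<lambda>(s, t). emb s t) \<in> lborel \<Otimes>\<^sub>M lborel \<rightarrow>\<^sub>M borel"
    unfolding emb_def by measurable
  note dst = lborel_plane_axes[OF ij, folded emb_def]
  have meas: "(\<lambda>x. indicator A x * f' x) \<in> borel_measurable borel"
    using borel_measurable_integrable[OF intA] by simp
  have intP: "integrable (lborel \<Otimes>\<^sub>M lborel) (\<lambda>(s, t). indicator A (emb s t) * f' (emb s t))"
    using intA[unfolded dst] integrable_distr_eq[OF m meas] by (simp add: case_prod_unfold)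
  have "(LINT x:A|lborel. f' x) = (LINT x|distr (lborel \<Otimes>\<^sub>M lborel) borel (\<lambda>(s, t). emb s t). indicator A x * f' x)"
    by (simp add: set_lebesgue_integral_def flip: dst)
  also have "\<dots> = integral\<^sup>L (lborel \<Otimes>\<^sub>M lborel) (\<lambda>(s, t). indicator A (emb s t) * f' (emb s t))"
    by (subst integral_distr[OF m meas]) (simp add: case_prod_unfold)
  also have "\<dots> = (LINT t|lborel. LINT s|lborel. indicator A (emb s t) * f' (emb s t))"
    using lborel_pair.integral_snd[OF intP] by simp
  also have "\<dots> = (LINT t|lborel. (\<Sum>H\<in>L'. sgn (n H $ i) * (jump A H (q H t) * f (q H t))))"
  proof (rule integral_cong_AE)
    show "(\<lambda>t. LINT s|lborel. indicator A (emb s t) * f' (emb s t)) \<in> borel_measurable lborel"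
      using lborel_pair.integrable_snd[OF intP] by (rule borel_measurable_integrable)
    show "(\<lambda>t. \<Sum>H\<in>L'. sgn (n H $ i) * (jump A H (q H t) * f (q H t))) \<in> borel_measurable lborel"
      by (intro borel_measurable_sum borel_measurable_times borel_measurable_const 
          borel_measurable_integrable line(1)) (simp_all add: line(1))
    have "AE t in lborel. t \<notin> bad"
      using finbad by (intro AE_not_in finite_imp_null_set_lborel)
    then show "AE t in lborel. (LINT s|lborel. indicator A (emb s t) * f' (emb s t))
        = (\<Sum>H\<in>L'. sgn (n H $ i) * (jump A H (q H t) * f (q H t)))"
      using lborel_pair.AE_integrable_snd[OF intP] by eventually_elim (rule inner_integral)
  qed
  also have "\<dots> = (\<Sum>H\<in>L'. sgn (n H $ i) * (LINT t|lborel. jump A H (q H t) * f (q H t)))"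
    using line(1) by (subst Bochner_Integration.integral_sum) auto
  also have "\<dots> = (\<Sum>H\<in>L'. LINT \<tau>|lborel. jump A H (pt H \<tau>) * f (pt H \<tau>) * n H $ i)"
    by (intro sum.cong refl line(2))
  also have "\<dots> = (\<Sum>H\<in>\<L>. LINT \<tau>|lborel. jump A H (pt H \<tau>) * f (pt H \<tau>) * n H $ i)"
    using finite_lines by (intro sum.mono_neutral_left) (auto simp: L'_def)
  finally show ?thesis .
qed

text \<open>The partial derivative formula is summed over the components. Where the jump is nonzero
  at a generic point, jump times \<open>n H\<close> is the outer normal and \<tau> is arc length, so
  that the right-hand side is the boundary flux.\<close>

theorem integral_divergence:
  fixes F :: "real^2 \<Rightarrow> real^2" and D :: "2 \<Rightarrow> real^2 \<Rightarrow> real"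
  assumes A: "open A" "bounded A" "frontier A \<subseteq> \<Union>\<L>"
    and F: "continuous_on UNIV F" and D: "\<And>i. set_integrable lborel A (D i)"
    and d: "\<And>i x. x \<in> A \<Longrightarrow> x \<notin> \<Union>\<L> \<Longrightarrow> ((\<lambda>s. F (x + s *\<^sub>R axis i 1) $ i) has_real_derivative D i x) (at 0)"
  shows "(LINT x:A|lborel. \<Sum>i\<in>UNIV. D i x) = (\<Sum>H\<in>\<L>. LINT \<tau>|lborel. jump A H (pt H \<tau>) * (F (pt H \<tau>) \<bullet> n H))"
proof -
  have Fi: "continuous_on UNIV (\<lambda>x. F x $ i)" for i using F by (intro continuous_intros)
  have "(LINT x:A|lborel. \<Sum>i\<in>UNIV. D i x) = (\<Sum>i\<in>UNIV. (LINT x:A|lborel. D i x))"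
    by (simp add: UNIV_2 set_integral_add(2)[OF D D])
  also have "\<dots> = (\<Sum>i\<in>UNIV. \<Sum>H\<in>\<L>. LINT \<tau>|lborel. jump A H (pt H \<tau>) * F (pt H \<tau>) $ i * n H $ i)"
    by (intro sum.cong refl integral_partial_derivative A Fi D d)
  also have "\<dots> = (\<Sum>H\<in>\<L>. \<Sum>i\<in>UNIV. LINT \<tau>|lborel. jump A H (pt H \<tau>) * F (pt H \<tau>) $ i * n H $ i)"
    by (rule sum.swap)
  also have "\<dots> = (\<Sum>H\<in>\<L>. LINT \<tau>|lborel. (\<Sum>i\<in>UNIV. jump A H (pt H \<tau>) * F (pt H \<tau>) $ i * n H $ i))"
    by (intro sum.cong refl Bochner_Integration.integral_sum[symmetric] integrable_mult_left jump_integrable A Fi)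
  also have "\<dots> = (\<Sum>H\<in>\<L>. LINT \<tau>|lborel. jump A H (pt H \<tau>) * (F (pt H \<tau>) \<bullet> n H))"
    by (simp add: inner_vec_def sum_distrib_left mult.assoc)
  finally show ?thesis .
qed

end

section \<open>The flux of a finite element velocity\<close>

text \<open>Stated on the whole plane because a finite element function agrees on each triangle with
  a global polynomial, whose gradient is bounded on the closed triangle.\<close>

definition C1 :: "(real^2 \<Rightarrow> real) \<Rightarrow> bool"
  where "C1 f \<longleftrightarrow> (\<exists>g. (\<forall>x. (f has_derivative (\<lambda>h. g x \<bullet> h)) (at x)) \<and> continuous_on UNIV g)"

lemma C1_const: "C1 (\<lambda>x. a)"
proof -
  have "((\<lambda>x. a) has_derivative (\<lambda>h. 0 \<bullet> h)) (at x)" for x :: "real^2"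
    unfolding inner_zero_left by (rule has_derivative_const)
  then show ?thesis
    unfolding C1_def by (intro exI[of _ "\<lambda>x. 0"] conjI allI continuous_on_const)
qed

lemma C1_component: "C1 (\<lambda>x. x $ i)"
proof -
  have "((\<lambda>x. x $ i) has_derivative (\<lambda>h. axis i 1 \<bullet> h)) (at x)" for x :: "real^2"
    unfolding inner_axis' real_inner_1_left
    by (rule bounded_linear_imp_has_derivative[OF bounded_linear_vec_nth])
  then show ?thesis
    unfolding C1_def by (intro exI[of _ "\<lambda>x. axis i 1"] conjI allI continuous_on_const)
qed

lemma C1_add: 
  assumes "C1 f" "C1 f'" shows "C1 (\<lambda>x. f x + f' x)"
proof -
  obtain g where g: "\<And>x. (f has_derivative (\<lambda>h. g x \<bullet> h)) (at x)" "continuous_on UNIV g"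
    using assms(1) unfolding C1_def by auto
  obtain g' where g': "\<And>x. (f' has_derivative (\<lambda>h. g' x \<bullet> h)) (at x)" "continuous_on UNIV g'"
    using assms(2) unfolding C1_def by auto
  have "((\<lambda>x. f x + f' x) has_derivative (\<lambda>h. (g x + g' x) \<bullet> h)) (at x)" for x
    using has_derivative_add[OF g(1) g'(1), of x] by (simp add: inner_add_left)
  moreover have "continuous_on UNIV (\<lambda>x. g x + g' x)"
    using g(2) g'(2) by (intro continuous_intros)
  ultimately show ?thesis unfolding C1_def by (intro exI[of _ "\<lambda>x. g x + g' x"]) simp
qed

lemma C1_continuous: 
  assumes "C1 f" shows "continuous_on S f"
proof -
  obtain g where g: "\<And>x. (f has_derivative (\<lambda>h. g x \<bullet> h)) (at x)"
    using assms unfolding C1_def by auto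
  show ?thesis
    by (rule has_derivative_continuous_on[where f' = "\<lambda>x h. g x \<bullet> h"]) (rule has_derivative_at_withinI[OF g])
qed

lemma C1_mult: 
  assumes "C1 f" "C1 f'" shows "C1 (\<lambda>x. f x * f' x)"
proof -
  obtain g where g: "\<And>x. (f has_derivative (\<lambda>h. g x \<bullet> h)) (at x)" "continuous_on UNIV g"
    using assms(1) unfolding C1_def by auto
  obtain g' where g': "\<And>x. (f' has_derivative (\<lambda>h. g' x \<bullet> h)) (at x)" "continuous_on UNIV g'"
    using assms(2) unfolding C1_def by auto
  have "((\<lambda>x. f x * f' x) has_derivative (\<lambda>h. (f x *\<^sub>R g' x + f' x *\<^sub>R g x) \<bullet> h)) (at x)" for x
    using has_derivative_mult[OF g(1) g'(1), of x] by (simp add: inner_add_left mult.commute)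
  moreover have "continuous_on UNIV (\<lambda>x. f x *\<^sub>R g' x + f' x *\<^sub>R g x)"
    using g(2) g'(2) C1_continuous assms by (intro continuous_intros) auto
  ultimately show ?thesis unfolding C1_def by (intro exI[of _ "\<lambda>x. f x *\<^sub>R g' x + f' x *\<^sub>R g x"]) simp
qed

lemma C1_power: "C1 f \<Longrightarrow> C1 (\<lambda>x. f x ^ k)"
  by (induction k) (auto intro: C1_const C1_mult)

lemma C1_sum: "(\<And>i. i \<in> I \<Longrightarrow> C1 (f i)) \<Longrightarrow> C1 (\<lambda>x. \<Sum>i\<in>I. f i x)"
  by (induction I rule: infinite_finite_induct) (auto intro: C1_const C1_add)

lemma FE_C1:
  assumes "f \<in> FE R \<T> k" "K \<in> \<T>"
  shows "\<exists>p. C1 p \<and> (\<forall>x\<in>K. f x = p x)"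
proof -
  obtain c :: "nat \<Rightarrow> nat \<Rightarrow> real"
    where "\<forall>x\<in>K. f x = (\<Sum>i\<le>k. \<Sum>j\<le>k - i. c i j * (x $ 1) ^ i * (x $ 2) ^ j)"
    using assms unfolding FE_def by blast
  moreover have "C1 (\<lambda>x. \<Sum>i\<le>k. \<Sum>j\<le>k - i. c i j * (x $ 1) ^ i * (x $ 2) ^ j)"
    by (intro C1_sum C1_mult C1_power C1_component C1_const)
  ultimately show ?thesis by (intro exI[of _ "\<lambda>x. \<Sum>i\<le>k. \<Sum>j\<le>k - i. c i j * (x $ 1) ^ i * (x $ 2) ^ j"]) simp
qed

lemma mesh_compact:
  assumes "is_mesh R \<T>" "K \<in> \<T>" shows "compact K"
proof -
  have "2 simplex K" using assms by (simp add: is_mesh_def)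
  from simplex_vertices(2,3)[OF this] show ?thesis using finite_imp_compact_convex_hull by metis
qed

text \<open>The cutoff discards the edges of the mesh, where the classical derivative is unspecified, and so
  makes the function Borel measurable.\<close>

definition weighted_pd :: "(real^2) set set \<Rightarrow> (real^2 \<Rightarrow> real^2) \<Rightarrow> 2 \<Rightarrow> real^2 \<Rightarrow> real"
  where "weighted_pd \<T> u i x = indicator (\<Union>K\<in>\<T>. interior K) x * pd i (\<lambda>y. y $ 1 *\<^sub>R u y) x $ i"

lemma weighted_field_derivative:
  assumes u: "u \<in> FEvec R \<T> k" and K: "K \<in> \<T>"
  obtains g where "\<And>i. continuous_on UNIV (g i)"
    "\<And>x. x \<in> interior K \<Longrightarrow> ((\<lambda>y. y $ 1 *\<^sub>R u y) has_derivative (\<lambda>h. \<chi> i. g i x \<bullet> h)) (at x)"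
proof -
  have "\<exists>g. continuous_on UNIV g \<and> (\<forall>x\<in>interior K. ((\<lambda>y. y $ 1 * u y $ i) has_derivative (\<lambda>h. g x \<bullet> h)) (at x))" for i
  proof -
    have "(\<lambda>x. u x $ i) \<in> FE R \<T> k" using u by (simp add: FEvec_def)
    then obtain p where p: "C1 p" "\<forall>x\<in>K. u x $ i = p x" using FE_C1 K by blast
    then have "C1 (\<lambda>x. x $ 1 * p x)" by (intro C1_mult C1_component)
    then obtain g where g: "\<And>x. ((\<lambda>x. x $ 1 * p x) has_derivative (\<lambda>h. g x \<bullet> h)) (at x)" "continuous_on UNIV g"
      unfolding C1_def by auto
    have "((\<lambda>y. y $ 1 * u y $ i) has_derivative (\<lambda>h. g x \<bullet> h)) (at x)" if "x \<in> interior K" for x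
      by (rule has_derivative_transform_within_open[OF g(1) open_interior that])
        (use p(2) interior_subset[of K] in auto)
    then show ?thesis using g(2) by blast
  qed
  then have "\<exists>g. \<forall>i. continuous_on UNIV (g i) \<and>
      (\<forall>x\<in>interior K. ((\<lambda>y. y $ 1 * u y $ i) has_derivative (\<lambda>h. g i x \<bullet> h)) (at x))"
    by (intro choice allI)
  then obtain g where g: "\<And>i. continuous_on UNIV (g i)"
    "\<And>i x. x \<in> interior K \<Longrightarrow> ((\<lambda>y. y $ 1 * u y $ i) has_derivative (\<lambda>h. g i x \<bullet> h)) (at x)"
    by auto
  have "((\<lambda>y. y $ 1 *\<^sub>R u y) has_derivative (\<lambda>h. \<chi> i. g i x \<bullet> h)) (at x)" if "x \<in> interior K" for x
    by (subst has_derivative_componentwise_within) 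
      (auto simp: Basis_vec_def inner_axis g(2)[OF that])
  then show ?thesis using that g(1) by blast
qed

lemma pd_weighted:
  assumes "((\<lambda>y. y $ 1 *\<^sub>R u y) has_derivative (\<lambda>h. \<chi> i. g i x \<bullet> h)) (at x)"
  shows "pd i (\<lambda>y. y $ 1 *\<^sub>R u y) x $ i = g i x $ i"
  unfolding pd_def frechet_derivative_at[OF assms, symmetric] by (simp add: inner_axis)

text \<open>On each open triangle the function is the restriction of one that is continuous on the
  whole plane, hence bounded on the compact triangle; finitely many triangles give a common
  bound.\<close>

lemma weighted_pd_measurable_bounded:
  assumes mesh: "is_mesh R \<T>" and u: "u \<in> FEvec R \<T> k"
  shows "weighted_pd \<T> u i \<in> borel_measurable borel" "\<exists>B. \<forall>x. \<bar>weighted_pd \<T> u i x\<bar> \<le> B"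
proof -
  let ?p = "\<lambda>x. pd i (\<lambda>y. y $ 1 *\<^sub>R u y) x $ i"
  have fin: "finite \<T>" using mesh by (simp add: is_mesh_def triangulation_def)
  have K: "continuous_on (interior K) ?p \<and> bounded (?p ` interior K)" if K: "K \<in> \<T>" for K
  proof -
    obtain g where g: "\<And>i. continuous_on UNIV (g i)"
      "\<And>x. x \<in> interior K \<Longrightarrow> ((\<lambda>y. y $ 1 *\<^sub>R u y) has_derivative (\<lambda>h. \<chi> i. g i x \<bullet> h)) (at x)"
      by (rule weighted_field_derivative[OF u K]) blast
    have eq: "?p x = g i x $ i" if "x \<in> interior K" for x
      using pd_weighted[where g = g, OF g(2)[OF that]] .
    have c: "continuous_on S (\<lambda>x. g i x $ i)" for S
      using continuous_on_subset[OF g(1)] by (intro continuous_intros) auto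
    have "compact ((\<lambda>x. g i x $ i) ` K)"
      using c mesh_compact[OF mesh K] by (rule compact_continuous_image)
    then have "bounded ((\<lambda>x. g i x $ i) ` interior K)"
      by (rule bounded_subset[OF compact_imp_bounded]) (use interior_subset in auto)
    then show ?thesis
      using continuous_on_cong[OF refl eq, of "interior K" ] c image_cong[OF refl eq, of "interior K"] by simp
  qed
  have "continuous_on (\<Union>K\<in>\<T>. interior K) ?p"
    using K by (intro continuous_on_open_UN) auto
  then have "(\<lambda>x. indicator (\<Union>K\<in>\<T>. interior K) x *\<^sub>R ?p x) \<in> borel_measurable borel"
    by (intro borel_measurable_continuous_on_indicator borel_open open_UN ballI open_interior)
  then show "weighted_pd \<T> u i \<in> borel_measurable borel"
    by (simp add: weighted_pd_def[abs_def])
  have "bounded (\<Union>K\<in>\<T>. ?p ` interior K)"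
    using fin K by (intro bounded_UN) auto
  then obtain B where B: "\<forall>y\<in>(\<Union>K\<in>\<T>. ?p ` interior K). norm y \<le> B"
    using bounded_iff by blast
  have "\<bar>weighted_pd \<T> u i x\<bar> \<le> max B 0" for x
  proof (cases "x \<in> (\<Union>K\<in>\<T>. interior K)")
    case True
    then show ?thesis using B by (auto simp: weighted_pd_def le_max_iff_disj)
  qed (simp add: weighted_pd_def)
  then show "\<exists>B. \<forall>x. \<bar>weighted_pd \<T> u i x\<bar> \<le> B" by blast
qed

lemma weighted_pd_integrable:
  assumes "is_mesh R \<T>" "u \<in> FEvec R \<T> k" "open A" "bounded A"
  shows "set_integrable lborel A (weighted_pd \<T> u i)"
proof -
  obtain B where "\<forall>x. \<bar>weighted_pd \<T> u i x\<bar> \<le> B"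
    using weighted_pd_measurable_bounded(2)[OF assms(1,2)] by blast
  then show ?thesis
    unfolding set_integrable_def
    using weighted_pd_measurable_bounded(1)[OF assms(1,2)] assms(3) emeasure_bounded_finite[OF assms(4)]
    by (intro integrableI_bounded_set_indicator[where B = B]) auto
qed

lemma mesh_interior_cover:
  assumes "is_mesh R \<T>" "x \<in> closure R" "\<And>K. K \<in> \<T> \<Longrightarrow> x \<notin> frontier K"
  obtains K where "K \<in> \<T>" "x \<in> interior K"
proof -
  obtain K where K: "K \<in> \<T>" "x \<in> K" using assms(1,2) by (auto simp: is_mesh_def)
  then have "x \<in> interior K" using assms(3)[OF K(1)] closure_subset[of K] by (auto simp: frontier_def)
  then show ?thesis using that K(1) by blast
qed

context line_arrangement begin

lemma negligible_lines: "negligible (\<Union>\<L>)"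
proof (intro negligible_Union finite_lines)
  fix H assume H: "H \<in> \<L>"
  have "n H \<noteq> 0" using norm_n[OF H] by auto
  then show "negligible H" using negligible_hyperplane[of "n H" "c H"] line_eq[OF H] by simp
qed

lemma AE_lines: "AE x in lebesgue. x \<notin> \<Union>\<L>"
  using negligible_lines by (intro AE_not_in) (simp add: negligible_iff_null_sets)

lemma divergence_AE:
  assumes "is_mesh R \<T>" "\<forall>K\<in>\<T>. frontier K \<subseteq> \<Union>\<L>"
  shows "AE x in lebesgue. x \<in> R \<longrightarrow> divergence (\<lambda>x. x $ 1 *\<^sub>R u x) x = (\<Sum>i\<in>UNIV. weighted_pd \<T> u i x)"
  using AE_lines
proof (eventually_elim, intro impI)
  fix x assume x: "x \<notin> \<Union>\<L>" "x \<in> R"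
  have "x \<in> closure R" using x closure_subset by blast
  then obtain K where "K \<in> \<T>" "x \<in> interior K"
    using mesh_interior_cover[OF assms(1)] assms(2) x(1) by blast
  then have "x \<in> (\<Union>K\<in>\<T>. interior K)" by blast
  then show "divergence (\<lambda>x. x $ 1 *\<^sub>R u x) x = (\<Sum>i\<in>UNIV. weighted_pd \<T> u i x)"
    by (simp add: divergence_def weighted_pd_def)
qed

text \<open>The Borel version is bounded and hence integrable over \<open>R\<close>; the classical
  divergence equals it off the lines, and completeness carries integrability over.\<close>

lemma divergence_integrable:
  assumes mesh: "is_mesh R \<T>" and cover: "\<forall>K\<in>\<T>. frontier K \<subseteq> \<Union>\<L>"
    and u: "u \<in> FEvec R \<T> k" and R: "open R" "bounded R"
  shows "set_integrable lebesgue R (divergence (\<lambda>x. x $ 1 *\<^sub>R u x))"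
proof -
  have "set_integrable lborel R (\<lambda>x. \<Sum>i\<in>UNIV. weighted_pd \<T> u i x)"
    by (simp add: UNIV_2 set_integral_add(1) weighted_pd_integrable[OF mesh u R])
  then have i: "integrable lborel (\<lambda>x. indicator R x *\<^sub>R (\<Sum>i\<in>UNIV. weighted_pd \<T> u i x))"
    unfolding set_integrable_def .
  have I: "integrable lebesgue (\<lambda>x. indicator R x *\<^sub>R (\<Sum>i\<in>UNIV. weighted_pd \<T> u i x))"
    using i by (rule integrable_completion[THEN iffD2, OF borel_measurable_integrable[OF i]])
  have AE: "AE x in lebesgue. indicator R x *\<^sub>R (\<Sum>i\<in>UNIV. weighted_pd \<T> u i x)
      = indicator R x *\<^sub>R divergence (\<lambda>x. x $ 1 *\<^sub>R u x) x"
    using divergence_AE[OF mesh cover, of u] by eventually_elim (simp add: indicator_def)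
  show ?thesis
    unfolding set_integrable_def
    by (rule integrable_cong_AE_imp[OF I borel_measurable_lebesgue_AE[OF borel_measurable_integrable[OF I] AE] AE])
qed

text \<open>\<open>A\<close> need not respect the mesh: mesh edges lie on lines of the arrangement,
  off which the weighted field is differentiable, and across which it is continuous.
  \<open>V\<close> supplies values on the parts of the lines outside the domain.\<close>

lemma integral_divergence_FE:
  assumes mesh: "is_mesh R \<T>" and cover: "\<forall>K\<in>\<T>. frontier K \<subseteq> \<Union>\<L>"
    and u: "u \<in> FEvec R \<T> k" and R: "open R" "bounded R"
    and A: "open A" "A \<subseteq> R" "frontier A \<subseteq> \<Union>\<L>"
    and V: "continuous_on UNIV V" "\<And>x. x \<in> closure R \<Longrightarrow> V x = u x"
  shows "(LINT x:A|lebesgue. divergence (\<lambda>x. x $ 1 *\<^sub>R u x) x)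
    = (\<Sum>H\<in>\<L>. LINT \<tau>|lborel. jump A H (pt H \<tau>) * ((pt H \<tau> $ 1 *\<^sub>R V (pt H \<tau>)) \<bullet> n H))"
proof -
  have bA: "bounded A" using A(2) R(2) bounded_subset by blast
  note int = weighted_pd_integrable[OF mesh u A(1) bA]
  have "(LINT x:A|lebesgue. divergence (\<lambda>x. x $ 1 *\<^sub>R u x) x) = (LINT x:A|lebesgue. (\<Sum>i\<in>UNIV. weighted_pd \<T> u i x))"
    by (rule set_integral_cong_AE_lebesgue)
      (use divergence_AE[OF mesh cover, of u] in \<open>eventually_elim, use A(2) in auto\<close>)
  also have "\<dots> = (LINT x:A|lborel. (\<Sum>i\<in>UNIV. weighted_pd \<T> u i x))"
    unfolding set_lebesgue_integral_def
    using A(1) weighted_pd_measurable_bounded(1)[OF mesh u]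
    by (intro integral_completion borel_measurable_scaleR borel_measurable_sum) auto
  also have "\<dots> = (\<Sum>H\<in>\<L>. LINT \<tau>|lborel. jump A H (pt H \<tau>) * ((pt H \<tau> $ 1 *\<^sub>R V (pt H \<tau>)) \<bullet> n H))"
  proof (rule integral_divergence[OF A(1) bA A(3) _ int])
    show "continuous_on UNIV (\<lambda>x. x $ 1 *\<^sub>R V x)"
      using V(1) by (intro continuous_intros)
    fix i x assume x: "x \<in> A" "x \<notin> \<Union>\<L>"
    then have "x \<in> R" "x \<in> closure R" using A(2) closure_subset by auto
    then obtain K where K: "K \<in> \<T>" "x \<in> interior K"
      using mesh_interior_cover[OF mesh] cover x(2) by blast
    obtain g where g: "\<And>x. x \<in> interior K \<Longrightarrow> ((\<lambda>y. y $ 1 *\<^sub>R u y) has_derivative (\<lambda>h. \<chi> i. g i x \<bullet> h)) (at x)"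
      by (rule weighted_field_derivative[OF u K(1)]) blast
    have "((\<lambda>y. y $ 1 *\<^sub>R V y) has_derivative (\<lambda>h. \<chi> i. g i x \<bullet> h)) (at x)"
      by (rule has_derivative_transform_within_open[OF g[OF K(2)] R(1) \<open>x \<in> R\<close>])
        (use V(2) closure_subset[of R] in auto)
    then have "((\<lambda>y. y $ 1 *\<^sub>R V y) has_derivative (\<lambda>h. \<chi> i. g i x \<bullet> h)) (at (x + 0 *\<^sub>R axis i 1))"
      by simp
    moreover have "((\<lambda>s. x + s *\<^sub>R axis i 1) has_derivative (\<lambda>s. s *\<^sub>R axis i 1)) (at 0)"
      by (auto intro!: derivative_eq_intros)
    ultimately have "((\<lambda>s. (x + s *\<^sub>R axis i 1) $ 1 *\<^sub>R V (x + s *\<^sub>R axis i 1)) has_derivative (\<lambda>s. \<chi> k. g k x \<bullet> (s *\<^sub>R axis i 1))) (at 0)"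
      by (rule has_derivative_compose[where g = "\<lambda>y. y $ 1 *\<^sub>R V y", rotated])
    then have "((\<lambda>s. ((x + s *\<^sub>R axis i 1) $ 1 *\<^sub>R V (x + s *\<^sub>R axis i 1)) $ i) has_derivative (\<lambda>s. (\<chi> k. g k x \<bullet> (s *\<^sub>R axis i 1)) $ i)) (at 0)"
      by (rule bounded_linear.has_derivative[OF bounded_linear_vec_nth])
    moreover have "weighted_pd \<T> u i x = g i x $ i"
      using pd_weighted[where g = g, OF g[OF K(2)]] K by (auto simp: weighted_pd_def indicator_def)
    ultimately show "((\<lambda>s. ((x + s *\<^sub>R axis i 1) $ 1 *\<^sub>R V (x + s *\<^sub>R axis i 1)) $ i) has_real_derivative weighted_pd \<T> u i x) (at 0)"
      by (simp add: has_field_derivative_def inner_axis mult_commute_abs)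
  qed
  finally show ?thesis .
qed

end

section \<open>Lines through given segments, and outer normals\<close>

lemma segment_in_line:
  fixes a b :: "real^2"
  shows "\<exists>m d. norm m = 1 \<and> closed_segment a b \<subseteq> {x. m \<bullet> x = d}"
proof (cases "a = b")
  case True
  then show ?thesis by (intro exI[of _ "axis 1 1"] exI[of _ "axis 1 1 \<bullet> a"]) (simp add: norm_axis_1)
next
  case False
  define m where "m = (1 / norm (b - a)) *\<^sub>R perp (b - a)"
  have "norm m = 1" using False by (simp add: m_def norm_perp)
  moreover have "m \<bullet> (b - a) = 0" using inner_perp_self[of "b - a"] by (simp add: m_def inner_commute)
  then have "closed_segment a b \<subseteq> {x. m \<bullet> x = m \<bullet> a}"
    by (auto simp: closed_segment_def inner_add_right inner_diff_right left_diff_distrib)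
  ultimately show ?thesis by blast
qed

lemma line_arrangement_of_segments:
  fixes E :: "((real^2) \<times> (real^2)) set"
  assumes "finite E"
  obtains \<L> n c where "line_arrangement \<L> n c" "\<And>a b. (a, b) \<in> E \<Longrightarrow> \<exists>H\<in>\<L>. closed_segment a b \<subseteq> H"
proof -
  have "\<forall>p::(real^2) \<times> (real^2). \<exists>q. norm (fst q) = 1 \<and> closed_segment (fst p) (snd p) \<subseteq> {x. fst q \<bullet> x = (snd q :: real)}"
  proof
    fix p :: "(real^2) \<times> (real^2)"
    obtain m d where "norm m = 1" "closed_segment (fst p) (snd p) \<subseteq> {x. m \<bullet> x = d}"
      using segment_in_line by blast
    then show "\<exists>q. norm (fst q) = 1 \<and> closed_segment (fst p) (snd p) \<subseteq> {x. fst q \<bullet> x = (snd q :: real)}"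
      by (intro exI[of _ "(m, d)"]) simp
  qed
  from choice[OF this] obtain f :: "(real^2) \<times> (real^2) \<Rightarrow> (real^2) \<times> real" where
    f': "\<forall>p. norm (fst (f p)) = 1 \<and> closed_segment (fst p) (snd p) \<subseteq> {x. fst (f p) \<bullet> x = snd (f p)}"
    by (elim exE)
  then have f: "norm (fst (f p)) = 1" "closed_segment (fst p) (snd p) \<subseteq> {x. fst (f p) \<bullet> x = snd (f p)}" for p
    by blast+
  define h where "h p = {x. fst (f p) \<bullet> x = snd (f p)}" for p
  \<comment> \<open>Collinear segments give the same line, possibly with opposite normals.
    \<open>r\<close> selects one segment per line, so that normal and offset become functions of the
    line.\<close>
  define r where "r H = (SOME p. h p = H)" for H
  have r: "h (r (h p)) = h p" for p unfolding r_def by (rule someI) simp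
  have "line_arrangement (h ` E) (\<lambda>H. fst (f (r H))) (\<lambda>H. snd (f (r H)))"
  proof
    show "finite (h ` E)" using assms by simp
    fix H assume "H \<in> h ` E"
    then obtain p where H: "H = h p" by blast
    show "norm (fst (f (r H))) = 1" by (rule f(1))
    show "H = {x. fst (f (r H)) \<bullet> x = snd (f (r H))}" using r[of p] unfolding H h_def[of "r (h p)"] by (rule sym)
  qed
  moreover have "\<exists>H\<in>h ` E. closed_segment a b \<subseteq> H" if "(a, b) \<in> E" for a b
    using f(2)[of "(a, b)"] that by (intro bexI[of _ "h (a, b)"]) (auto simp: h_def)
  ultimately show ?thesis using that by blast
qed

text \<open>An open set that misses one half disc contains no point of the diameter, since a
  neighbourhood of such a point would reach into that half.\<close>

lemma sides_half_disc:
  assumes A: "open A" and s: "sides A m x \<epsilon> False True" and m: "norm m = 1" "\<epsilon> > 0"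
  shows "is_outer_normal A x m" "x \<in> frontier A"
proof -
  have mm: "m \<bullet> m = 1" using m by (simp add: norm_eq_1)
  have boundary: "y \<notin> A" if y: "y \<in> ball x \<epsilon>" "m \<bullet> (y - x) = 0" for y
  proof
    assume "y \<in> A"
    then have "y \<in> A \<inter> ball x \<epsilon>" using y by blast
    moreover have "open (A \<inter> ball x \<epsilon>)" using A by auto
    ultimately obtain \<delta> where \<delta>: "\<delta> > 0" "ball y \<delta> \<subseteq> A \<inter> ball x \<epsilon>"
      using openE by blast
    define z where "z = y + (\<delta>/2) *\<^sub>R m"
    have "z \<in> ball y \<delta>" using \<delta>(1) m by (simp add: z_def dist_norm)
    then have "z \<in> A" "z \<in> ball x \<epsilon>" using \<delta>(2) by auto
    moreover have "m \<bullet> (z - x) > 0"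
      using y(2) \<delta>(1) by (simp add: z_def inner_add_right inner_diff_right mm)
    ultimately show False using s unfolding sides_def by blast
  qed
  have "A \<inter> ball x \<epsilon> = {y \<in> ball x \<epsilon>. (y - x) \<bullet> m < 0}"
  proof (intro set_eqI)
    fix y
    show "y \<in> A \<inter> ball x \<epsilon> \<longleftrightarrow> y \<in> {y \<in> ball x \<epsilon>. (y - x) \<bullet> m < 0}"
      using s boundary[of y] unfolding sides_def inner_commute[of _ m]
      by (cases "m \<bullet> (y - x)" "0::real" rule: linorder_cases) auto
  qed
  then show "is_outer_normal A x m" unfolding is_outer_normal_def using m by blast
  have "x \<notin> A" using boundary[of x] m by simp
  moreover have "x \<in> closure A"
  proof (rule ccontr)
    assume "x \<notin> closure A"
    then have "side_trace A x (- m) = 0" by (rule side_trace_outside)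
    moreover have "side_trace A x (- m) = 1" using side_trace_sides(2)[OF s m(2), of "- m"] mm by simp
    ultimately show False by simp
  qed
  ultimately show "x \<in> frontier A" using A by (simp add: frontier_def interior_open)
qed

lemma is_outer_normal_local:
  assumes "is_outer_normal A x m" "\<delta> > 0" "A \<inter> ball x \<delta> = B \<inter> ball x \<delta>"
  shows "is_outer_normal B x m"
proof -
  obtain e where e: "norm m = 1" "e > 0" "A \<inter> ball x e = {y \<in> ball x e. (y - x) \<bullet> m < 0}"
    using assms(1) unfolding is_outer_normal_def by blast
  have "B \<inter> ball x (min e \<delta>) = {y \<in> ball x (min e \<delta>). (y - x) \<bullet> m < 0}"
  proof (intro set_eqI)
    fix y
    show "y \<in> B \<inter> ball x (min e \<delta>) \<longleftrightarrow> y \<in> {y \<in> ball x (min e \<delta>). (y - x) \<bullet> m < 0}"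
    proof (cases "y \<in> ball x (min e \<delta>)")
      case True
      then have "y \<in> ball x e" "y \<in> ball x \<delta>" by auto
      then have "y \<in> B \<longleftrightarrow> (y - x) \<bullet> m < 0" using e(3) assms(3) by blast
      then show ?thesis using True by blast
    qed auto
  qed
  then show ?thesis unfolding is_outer_normal_def using e assms(2) by (intro conjI exI[of _ "min e \<delta>"]) auto
qed

context line_arrangement begin

text \<open>A nonzero jump means that exactly one side belongs to \<open>A\<close>; its sign turns
  \<open>n H\<close> towards the other side.\<close>

lemma jump_outer_normal:
  assumes H: "H \<in> \<L>" and x: "generic H x" and A: "open A" "frontier A \<subseteq> \<Union>\<L>" and j: "jump A H x \<noteq> 0"
  shows "is_outer_normal A x (jump A H x *\<^sub>R n H)" "x \<in> frontier A"
proof -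
  obtain \<epsilon> a b where s: "\<epsilon> > 0" "sides A (n H) x \<epsilon> a b" by (rule generic_sides[OF H x A(2)])
  have ab: "a \<noteq> b" "jump A H x = of_bool b - of_bool a" using j jump_sides[OF H s(2,1)] by auto
  have "sides A (jump A H x *\<^sub>R n H) x \<epsilon> False True"
    using s(2) ab unfolding sides_def by (cases a) auto
  moreover have "norm (jump A H x *\<^sub>R n H) = 1"
    using ab norm_n[OF H] by (cases a) auto
  ultimately show "is_outer_normal A x (jump A H x *\<^sub>R n H)" "x \<in> frontier A"
    using sides_half_disc[OF A(1) _ _ s(1)] by blast+
qed

lemma AE_generic:
  assumes "H \<in> \<L>" "finite N" shows "AE \<tau> in lborel. generic H (pt H \<tau>) \<and> pt H \<tau> \<notin> N"
proof -
  have "finite {\<tau>. pt H \<tau> \<in> N}"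
  proof (rule finite_subset)
    show "{\<tau>. pt H \<tau> \<in> N} \<subseteq> (\<lambda>x. perp (n H) \<bullet> x) ` N"
    proof
      fix \<tau> assume "\<tau> \<in> {\<tau>. pt H \<tau> \<in> N}"
      then show "\<tau> \<in> (\<lambda>x. perp (n H) \<bullet> x) ` N"
        by (intro image_eqI[of _ _ "pt H \<tau>"]) (simp_all add: perp_inner_pt[OF assms(1)])
    qed
  qed (use assms(2) in simp)
  then have "AE \<tau> in lborel. \<tau> \<notin> {\<tau>. \<not> generic H (pt H \<tau>)} \<union> {\<tau>. pt H \<tau> \<in> N}"
    using finite_not_generic[OF assms(1)] by (intro AE_not_in finite_imp_null_set_lborel) simp
  then show ?thesis by eventually_elim simp
qed

text \<open>Crossings of lines, where no outer normal is provided, correspond to finitely many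
  parameters on each line and so do not affect the integrals.\<close>

lemma flux_zero:
  assumes A: "open A" "frontier A \<subseteq> \<Union>\<L>"
    and F: "\<And>x m. x \<in> frontier A \<Longrightarrow> is_outer_normal A x m \<Longrightarrow> F x \<bullet> m = 0"
  shows "(\<Sum>H\<in>\<L>. LINT \<tau>|lborel. jump A H (pt H \<tau>) * (F (pt H \<tau>) \<bullet> n H)) = 0"
proof (rule sum.neutral, rule ballI, rule integral_eq_zero_AE)
  fix H assume H: "H \<in> \<L>"
  show "AE \<tau> in lborel. jump A H (pt H \<tau>) * (F (pt H \<tau>) \<bullet> n H) = 0"
    using AE_generic[OF H finite.emptyI]
  proof eventually_elim
    fix \<tau> assume "generic H (pt H \<tau>) \<and> pt H \<tau> \<notin> {}"
    then have g: "generic H (pt H \<tau>)" by blast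
    show "jump A H (pt H \<tau>) * (F (pt H \<tau>) \<bullet> n H) = 0"
    proof (cases "jump A H (pt H \<tau>) = 0")
      case False
      have "F (pt H \<tau>) \<bullet> (jump A H (pt H \<tau>) *\<^sub>R n H) = 0"
        using jump_outer_normal[OF H g A False] F by blast
      then show ?thesis by simp
    qed simp
  qed
qed

end

section \<open>The boundary of the inner phase\<close>

text \<open>The frontier of the inside of a closed set lies in that set, and the axis part of this
  set already belongs to \<open>frontier R\<close>.\<close>

lemma frontier_inner_phase:
  assumes R: "open R" and C: "closed (X ` {0..1} \<union> axis_boundary R)"
  shows "open (inner_phase R X)" "inner_phase R X \<subseteq> R" 
    "frontier (inner_phase R X) \<subseteq> frontier R \<union> X ` {0..1}"
proof -
  have "open (inside (X ` {0..1} \<union> axis_boundary R))" using C by (rule open_inside)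
  then show "open (inner_phase R X)" using R by (simp add: inner_phase_def open_Int)
  show "inner_phase R X \<subseteq> R" by (simp add: inner_phase_def)
  have "frontier (inner_phase R X) \<subseteq> frontier R \<union> frontier (inside (X ` {0..1} \<union> axis_boundary R))"
    unfolding inner_phase_def by (rule frontier_Int_subset)
  also have "\<dots> \<subseteq> frontier R \<union> (X ` {0..1} \<union> axis_boundary R)"
    using frontier_inside_subset[OF C] by blast
  also have "\<dots> \<subseteq> frontier R \<union> X ` {0..1}" by (auto simp: axis_boundary_def)
  finally show "frontier (inner_phase R X) \<subseteq> frontier R \<union> X ` {0..1}" .
qed

lemma closed_axis_boundary: "closed (axis_boundary R)"
proof -
  have "axis_boundary R = frontier R \<inter> {x. e1 \<bullet> x = 0}"
    by (auto simp: axis_boundary_def inner_axis')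
  then show ?thesis by (simp add: closed_Int closed_hyperplane)
qed

text \<open>Away from the curve and the axis such a point lies in the open set
  \<open>inside\<close>, so the inner phase and \<open>R\<close> coincide near it.\<close>

lemma inner_phase_outer_normal:
  assumes x: "x \<in> frontier (inner_phase R X)" "x \<notin> X ` {0..1}" "x $ 1 \<noteq> 0"
    and C: "closed (X ` {0..1} \<union> axis_boundary R)"
    and m: "is_outer_normal (inner_phase R X) x m"
  shows "is_outer_normal R x m"
proof -
  let ?I = "inside (X ` {0..1} \<union> axis_boundary R)"
  have "x \<notin> X ` {0..1} \<union> axis_boundary R" using x(2,3) by (auto simp: axis_boundary_def)
  then have "x \<notin> frontier ?I" using frontier_inside_subset[OF C] by blast
  moreover have "x \<in> closure ?I"
    using x(1) closure_mono[of "inner_phase R X" ?I] by (auto simp: frontier_def inner_phase_def)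
  ultimately have "x \<in> ?I" using open_inside[OF C] by (simp add: frontier_def interior_open)
  then obtain \<delta> where \<delta>: "\<delta> > 0" "ball x \<delta> \<subseteq> ?I" using openE[OF open_inside[OF C]] by blast
  show ?thesis
    by (rule is_outer_normal_local[OF m \<delta>(1)]) (use \<delta>(2) in \<open>auto simp: inner_phase_def\<close>)
qed

section \<open>Cells of the curve and their segments\<close>

lemma Vh_cell_affine:
  assumes "X \<in> Vh J" "j \<in> {1..J}"
  obtains a b where "\<And>\<alpha>. \<alpha> \<in> {(real j - 1) / real J .. real j / real J} \<Longrightarrow> X \<alpha> = a + \<alpha> *\<^sub>R b"
    "\<And>\<alpha>. \<alpha> \<in> cell J j \<Longrightarrow> dcurve X \<alpha> = b"
proof -
  obtain a b where ab: "\<And>\<alpha>. \<alpha> \<in> {(real j - 1) / real J .. real j / real J} \<Longrightarrow> X \<alpha> = a + \<alpha> *\<^sub>R b"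
    using assms unfolding Vh_def by blast
  have "dcurve X \<alpha> = b" if \<alpha>: "\<alpha> \<in> cell J j" for \<alpha>
    unfolding dcurve_def
  proof (rule vector_derivative_at, rule has_vector_derivative_transform_within_open[where S = "cell J j"])
    show "((\<lambda>\<alpha>. a + \<alpha> *\<^sub>R b) has_vector_derivative b) (at \<alpha>)"
      by (auto intro!: derivative_eq_intros)
    show "a + \<beta> *\<^sub>R b = X \<beta>" if "\<beta> \<in> cell J j" for \<beta>
      using that by (intro ab[symmetric]) simp
  qed (use \<alpha> in auto)
  then show ?thesis using that ab by blast
qed

lemma cell_nonempty:
  assumes "j \<in> {1..J}" shows "(real j - 1) / real J < real j / real J"
  using assms by (simp add: divide_strict_right_mono)

lemma cell_disjoint_grid:
  assumes "j \<in> {1..J}" "\<alpha> \<in> cell J j" shows "\<alpha> \<notin> grid J"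
proof
  assume "\<alpha> \<in> grid J"
  then obtain k where "\<alpha> = real k / real J" by (auto simp: grid_def)
  then have "real j < real (Suc k)" "real k < real j" using assms by (auto simp: divide_less_cancel)
  then show False unfolding of_nat_less_iff by linarith
qed

lemma cell_unique:
  assumes "j \<in> {1..J}" "\<alpha> \<in> cell J j" "k \<in> {1..J}" "\<alpha> \<in> cell J k" shows "j = k"
proof -
  have "(real j - 1) / real J < real k / real J" "(real k - 1) / real J < real j / real J"
    using assms by auto
  then have "real j < real (Suc k)" "real k < real (Suc j)"
    using assms(1) by (auto simp: divide_less_cancel)
  then show ?thesis unfolding of_nat_less_iff by linarith
qed

lemma curve_image_cells:
  assumes "J \<ge> 1" shows "X ` {0..1} \<subseteq> (\<Union>j\<in>{1..J}. X ` cell J j) \<union> X ` grid J"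
proof
  fix x assume "x \<in> X ` {0..1}"
  then obtain \<alpha> where \<alpha>: "\<alpha> \<in> {0..1}" "x = X \<alpha>" by blast
  have "0 \<in> grid J" unfolding grid_def by (rule image_eqI[of _ _ 0]) auto
  moreover have "1 \<in> grid J" unfolding grid_def by (rule image_eqI[of _ _ J]) (use assms in auto)
  ultimately have "\<alpha> \<in> grid J \<or> \<alpha> \<in> unit_I - grid J"
    using \<alpha>(1) by (cases "\<alpha> = 0 \<or> \<alpha> = 1") auto
  then show "x \<in> (\<Union>j\<in>{1..J}. X ` cell J j) \<union> X ` grid J"
    using unit_I_cells[OF assms] \<alpha>(2) by blast
qed

lemma curve_image_segments:
  fixes X :: "real \<Rightarrow> real^2"
  assumes "X \<in> Vh J" "J \<ge> 1"
  shows "X ` {0..1} \<subseteq> (\<Union>j\<in>{1..J}. closed_segment (X ((real j - 1) / real J)) (X (real j / real J)))"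
    "j \<in> {1..J} \<Longrightarrow> X ` cell J j \<subseteq> closed_segment (X ((real j - 1) / real J)) (X (real j / real J))"
proof -
  have seg: "X \<alpha> \<in> closed_segment (X ((real j - 1) / real J)) (X (real j / real J))"
    if j: "j \<in> {1..J}" and \<alpha>: "\<alpha> \<in> {(real j - 1) / real J .. real j / real J}" for j \<alpha>
  proof -
    obtain a b where ab: "\<And>\<alpha>. \<alpha> \<in> {(real j - 1) / real J .. real j / real J} \<Longrightarrow> X \<alpha> = a + \<alpha> *\<^sub>R b"
      by (rule Vh_cell_affine[OF assms(1) j]) blast
    have le: "(real j - 1) / real J \<le> real j / real J" using cell_nonempty[OF j] by simp
    have "\<alpha> \<in> closed_segment ((real j - 1) / real J) (real j / real J)"
      using \<alpha> le by (simp add: closed_segment_eq_real_ivl)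
    then obtain u where u: "0 \<le> u" "u \<le> 1" "\<alpha> = (1 - u) * ((real j - 1) / real J) + u * (real j / real J)"
      by (auto simp: closed_segment_def)
    have "X \<alpha> = (1 - u) *\<^sub>R X ((real j - 1) / real J) + u *\<^sub>R X (real j / real J)"
      using \<alpha> le by (simp only: ab[OF \<alpha>] ab[of "(real j - 1) / real J"] ab[of "real j / real J"] atLeastAtMost_iff order_refl simp_thms)
        (simp add: u(3) algebra_simps flip: scaleR_add_left)
    then show ?thesis using u(1,2) by (auto simp: closed_segment_def)
  qed
  show "j \<in> {1..J} \<Longrightarrow> X ` cell J j \<subseteq> closed_segment (X ((real j - 1) / real J)) (X (real j / real J))"
    using seg[of j] by auto
  show "X ` {0..1} \<subseteq> (\<Union>j\<in>{1..J}. closed_segment (X ((real j - 1) / real J)) (X (real j / real J)))"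
  proof
    fix x assume "x \<in> X ` {0..1}"
    then obtain \<alpha> where \<alpha>: "\<alpha> \<in> {0..1}" "x = X \<alpha>" by blast
    \<comment> \<open>At \<open>\<alpha> = 0\<close> the ceiling would give the index 0, which is no
      cell; that point belongs to the first one.\<close>
    define j where "j = (if \<alpha> = 0 then 1 else nat \<lceil>\<alpha> * real J\<rceil>)"
    have J: "real J > 0" using assms(2) by simp
    have "j \<in> {1..J} \<and> \<alpha> \<in> {(real j - 1) / real J .. real j / real J}"
    proof (cases "\<alpha> = 0")
      case False
      have pos: "0 < \<alpha> * real J" "\<alpha> * real J \<le> real J" using \<alpha>(1) False J by (auto simp: mult_left_le_one_le)
      have "real j \<ge> \<alpha> * real J" "real j - 1 < \<alpha> * real J" "j \<ge> 1" "j \<le> J"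
        unfolding j_def using pos False by (simp_all, linarith+)
      then show ?thesis using J by (simp add: field_simps)
    qed (use assms(2) in \<open>simp add: j_def\<close>)
    then show "x \<in> (\<Union>j\<in>{1..J}. closed_segment (X ((real j - 1) / real J)) (X (real j / real J)))"
      using seg \<alpha>(2) by blast
  qed
qed

section \<open>Flux through the curve\<close>

context line_arrangement begin

text \<open>Each cell of the curve lies on a line of the arrangement and is run through at constant
  speed, so the line integrals can be regrouped by cells and substituted. \<open>cross\<close>
  determines the jump on the curve, \<open>rest\<close> removes everything off it.\<close>

lemma flux_through_curve:
  fixes F :: "real^2 \<Rightarrow> real^2"
  assumes X: "X \<in> Vh J" and J: "J \<ge> 1" and inj: "inj_on X unit_I"
    and cover: "\<And>j. j \<in> {1..J} \<Longrightarrow> \<exists>H\<in>\<L>. X ` cell J j \<subseteq> H"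
    and A: "bounded A" "frontier A \<subseteq> \<Union>\<L>"
    and cross: "\<And>\<alpha>. \<alpha> \<in> unit_I \<Longrightarrow> \<alpha> \<notin> grid J \<Longrightarrow>
      side_trace A (X \<alpha>) (normal X \<alpha>) = 0 \<and> side_trace A (X \<alpha>) (- normal X \<alpha>) = 1"
    and F: "continuous_on UNIV F"
    and rest: "\<And>H x. H \<in> \<L> \<Longrightarrow> generic H x \<Longrightarrow> x \<notin> X ` {0..1} \<Longrightarrow> jump A H x * (F x \<bullet> n H) = 0"
  shows "(\<Sum>H\<in>\<L>. LINT \<tau>|lborel. jump A H (pt H \<tau>) * (F (pt H \<tau>) \<bullet> n H))
    = (LINT \<alpha>:unit_I|lebesgue. (F (X \<alpha>) \<bullet> normal X \<alpha>) * norm (dcurve X \<alpha>))"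
proof -
  \<comment> \<open>A sample point of each cell, at which the derivative and the normal, constant on
    the cell, are read off.\<close>
  define mid where "mid j = (real j - 1/2) / real J" for j
  have mid: "mid j \<in> cell J j" if "j \<in> {1..J}" for j
    using that by (auto simp: mid_def divide_strict_right_mono)
  define \<nu> where "\<nu> j = normal X (mid j)" for j
  define b where "b j = dcurve X (mid j)" for j
  define L where "L j = (SOME H. H \<in> \<L> \<and> X ` cell J j \<subseteq> H)" for j
  have L: "L j \<in> \<L>" "X ` cell J j \<subseteq> L j" if "j \<in> {1..J}" for j
    using someI_ex[of "\<lambda>H. H \<in> \<L> \<and> X ` cell J j \<subseteq> H"] cover[OF that] unfolding L_def[symmetric] by blast+
  have dc: "dcurve X \<alpha> = b j" if "j \<in> {1..J}" "\<alpha> \<in> cell J j" for j \<alpha>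
    using Vh_cell_affine[OF X that(1)] mid[OF that(1)] that(2) unfolding b_def by metis
  have nc: "normal X \<alpha> = \<nu> j" if "j \<in> {1..J}" "\<alpha> \<in> cell J j" for j \<alpha>
    using dc[OF that] dc[OF that(1) mid[OF that(1)]] by (simp add: \<nu>_def normal_def tangent_def)
  have aff: "\<exists>a. \<forall>\<alpha>\<in>cell J j. X \<alpha> = a + \<alpha> *\<^sub>R b j" if j: "j \<in> {1..J}" for j
  proof -
    obtain a b' where ab: "\<And>\<alpha>. \<alpha> \<in> {(real j - 1) / real J .. real j / real J} \<Longrightarrow> X \<alpha> = a + \<alpha> *\<^sub>R b'"
      "\<And>\<alpha>. \<alpha> \<in> cell J j \<Longrightarrow> dcurve X \<alpha> = b'"
      by (rule Vh_cell_affine[OF X j]) blast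
    have "b' = b j" using ab(2)[OF mid[OF j]] by (simp add: b_def)
    then show ?thesis using ab(1) by (intro exI[of _ a]) auto
  qed
  \<comment> \<open>A cell with zero derivative would be mapped to a single point, against
    injectivity.\<close>
  have bn: "b j \<noteq> 0" if j: "j \<in> {1..J}" for j
  proof
    assume "b j = 0"
    then obtain a where a: "\<forall>\<alpha>\<in>cell J j. X \<alpha> = a" using aff[OF j] by auto
    obtain \<beta> where \<beta>: "mid j < \<beta>" "\<beta> < real j / real J" using mid[OF j] dense by auto
    then have "\<beta> \<in> cell J j" using mid[OF j] by auto
    then have "X \<beta> = X (mid j)" "\<beta> \<in> unit_I" "mid j \<in> unit_I" using a mid[OF j] cell_subset[OF j] by auto
    then show False using inj \<beta>(1) by (metis inj_onD less_irrefl)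
  qed
  \<comment> \<open>Signed speed of the curve along its line; the sign compares the orientation of
    the curve with that of the parametrisation \<open>pt\<close>.\<close>
  define s where "s j = perp (n (L j)) \<bullet> b j" for j
  have parallel: "n (L j) \<bullet> b j = 0" if j: "j \<in> {1..J}" for j
  proof -
    obtain a where a: "\<forall>\<alpha>\<in>cell J j. X \<alpha> = a + \<alpha> *\<^sub>R b j" using aff[OF j] by blast
    obtain \<beta> where \<beta>: "mid j < \<beta>" "\<beta> < real j / real J" using mid[OF j] dense by auto
    then have "\<beta> \<in> cell J j" using mid[OF j] by auto
    then have "n (L j) \<bullet> (a + \<beta> *\<^sub>R b j) = c (L j)" "n (L j) \<bullet> (a + mid j *\<^sub>R b j) = c (L j)"
      using L[OF j] mem_line[OF L(1)[OF j]] a mid[OF j] by (auto simp: image_subset_iff)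
    then have "(\<beta> - mid j) * (n (L j) \<bullet> b j) = 0"
      unfolding inner_add_right inner_scaleR_right left_diff_distrib by linarith
    then show ?thesis using \<beta>(1) by simp
  qed
  have b_s: "b j = s j *\<^sub>R perp (n (L j))" if j: "j \<in> {1..J}" for j
    using plane_decompose[OF norm_n[OF L(1)[OF j]], of "b j"] parallel[OF j] by (simp add: s_def)
  have s: "\<bar>s j\<bar> = norm (b j)" "s j \<noteq> 0" if j: "j \<in> {1..J}" for j
  proof -
    show "\<bar>s j\<bar> = norm (b j)"
      using arg_cong[OF b_s[OF j], of norm] norm_n[OF L(1)[OF j]] by (simp add: norm_perp)
    then show "s j \<noteq> 0" using bn[OF j] by auto
  qed
  have \<nu>: "\<nu> j = sgn (s j) *\<^sub>R n (L j)" if j: "j \<in> {1..J}" for j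
  proof -
    have "norm (b j) *\<^sub>R \<nu> j = - perp (b j)"
      using norm_dcurve_normal[of X "mid j"] by (simp add: b_def \<nu>_def)
    also have "\<dots> = s j *\<^sub>R n (L j)"
      by (subst b_s[OF j]) (simp add: perp_def vec_eq_iff forall_2)
    also have "\<dots> = norm (b j) *\<^sub>R (sgn (s j) *\<^sub>R n (L j))"
      using s(1)[OF j] by (metis abs_mult_sgn scaleR_scaleR)
    finally show ?thesis
      using bn[OF j] scaleR_cancel_left[of "norm (b j)"] by (simp del: scaleR_scaleR)
  qed
  \<comment> \<open>The share of cell \<open>j\<close> in the flux density at
    \<open>x\<close>.\<close>
  define \<psi> where "\<psi> j x = indicat_real (X ` cell J j) x * (F x \<bullet> \<nu> j)" for j x
  \<comment> \<open>On a cell the parameter of the line is an affine function of \<alpha> with slope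
    \<open>s j\<close>.\<close>
  have pt_cell: "\<exists>t0. \<forall>\<alpha>. (\<alpha> \<in> cell J j \<longrightarrow> pt (L j) (t0 + s j * \<alpha>) = X \<alpha>) \<and> (pt (L j) (t0 + s j * \<alpha>) \<in> X ` cell J j \<longleftrightarrow> \<alpha> \<in> cell J j)"
    if j: "j \<in> {1..J}" for j
  proof -
    obtain a where a: "\<forall>\<alpha>\<in>cell J j. X \<alpha> = a + \<alpha> *\<^sub>R b j" using aff[OF j] by blast
    define t0 where "t0 = perp (n (L j)) \<bullet> a"
    have X_pt: "pt (L j) (t0 + s j * \<alpha>) = X \<alpha>" if \<alpha>: "\<alpha> \<in> cell J j" for \<alpha>
    proof -
      have "X \<alpha> \<in> L j" using L(2)[OF j] \<alpha> by blast
      moreover have "perp (n (L j)) \<bullet> X \<alpha> = t0 + s j * \<alpha>"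
        using a \<alpha> by (simp add: inner_add_right t0_def s_def)
      ultimately show ?thesis using pt_of_line[OF L(1)[OF j], of "X \<alpha>"] by simp
    qed
    have "\<alpha> \<in> cell J j" if "pt (L j) (t0 + s j * \<alpha>) \<in> X ` cell J j" for \<alpha>
    proof -
      obtain \<beta> where \<beta>: "\<beta> \<in> cell J j" "pt (L j) (t0 + s j * \<alpha>) = X \<beta>" using \<open>pt (L j) (t0 + s j * \<alpha>) \<in> X ` cell J j\<close> by blast
      then have "perp (n (L j)) \<bullet> pt (L j) (t0 + s j * \<alpha>) = perp (n (L j)) \<bullet> pt (L j) (t0 + s j * \<beta>)"
        using X_pt by simp
      then show ?thesis using perp_inner_pt[OF L(1)[OF j]] s(2)[OF j] \<beta>(1) by simp
    qed
    moreover have "pt (L j) (t0 + s j * \<alpha>) \<in> X ` cell J j" if "\<alpha> \<in> cell J j" for \<alpha>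
      using that X_pt[OF that] by (intro image_eqI)
    ultimately show ?thesis using X_pt by (intro exI[of _ t0] allI conjI impI iffI)
  qed
  \<comment> \<open>By injectivity at most one cell passes through a point of the curve that is not
    a node, and at a generic point its line must be \<open>H\<close>. Hence at most one summand is
    nonzero.\<close>
  have pointwise: "jump A H x * (F x \<bullet> n H) = (\<Sum>j\<in>{j\<in>{1..J}. L j = H}. \<psi> j x)"
    if H: "H \<in> \<L>" and x: "generic H x" "x \<notin> X ` grid J" for H x
  proof (cases "\<exists>j\<in>{1..J}. x \<in> X ` cell J j")
    case True
    then obtain k \<alpha> where k: "k \<in> {1..J}" "\<alpha> \<in> cell J k" "x = X \<alpha>" by blast
    have \<alpha>: "\<alpha> \<in> unit_I" "\<alpha> \<notin> grid J"
      using subsetD[OF cell_subset[OF k(1)] k(2)] cell_disjoint_grid[OF k(1,2)] by blast+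
    have "x \<in> L k" using L(2)[OF k(1)] k(2,3) by blast
    then have LH: "L k = H"
      using x(1) L(1)[OF k(1)] unfolding generic_def by blast
    have "x \<notin> X ` cell J j" if j: "j \<in> {1..J}" "j \<noteq> k" for j
    proof
      assume "x \<in> X ` cell J j"
      then obtain \<beta> where \<beta>: "\<beta> \<in> cell J j" "X \<beta> = X \<alpha>" using k(3) by auto
      then have "\<beta> = \<alpha>" using inj_onD[OF inj \<beta>(2) subsetD[OF cell_subset[OF j(1)] \<beta>(1)] \<alpha>(1)] by blast
      then show False using cell_unique[OF j(1) _ k(1,2)] \<beta>(1) j(2) by simp
    qed
    then have "\<psi> j x = 0" if "j \<in> {j\<in>{1..J}. L j = H} - {k}" for j
      using that by (auto simp: \<psi>_def)
    then have "(\<Sum>j\<in>{j\<in>{1..J}. L j = H}. \<psi> j x) = \<psi> k x"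
      using k(1) LH by (subst sum.remove[of _ k]) auto
    also have "\<dots> = F x \<bullet> \<nu> k" using k by (auto simp: \<psi>_def)
    also have "\<dots> = sgn (s k) * (F x \<bullet> n H)" by (simp add: \<nu>[OF k(1)] LH)
    \<comment> \<open>The set \<open>A\<close> lies behind the curve normal \<open>\<nu> k\<close>,
      which is \<open>sgn (s k)\<close> times the normal of the line; so the jump measured along the
      normal of the line carries this sign.\<close>
    also have "sgn (s k) = jump A H x"
    proof -
      have sg: "sgn (s k) * sgn (s k) = 1" using s(2)[OF k(1)] by (simp add: sgn_if)
      have nn: "n H \<bullet> \<nu> k = sgn (s k)" by (simp add: \<nu>[OF k(1)] LH inner_n_n[OF H])
      then have "side_trace A x (- \<nu> k) - side_trace A x (\<nu> k) = sgn (sgn (s k)) * jump A H x"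
        using side_trace_direction[OF H x(1) A(2), of "\<nu> k"] s(2)[OF k(1)] by (simp add: sgn_zero_iff)
      moreover have "side_trace A x (\<nu> k) = 0" "side_trace A x (- \<nu> k) = 1"
        using cross[OF \<alpha>] nc[OF k(1,2)] k(3) by auto
      ultimately have "1 = sgn (s k) * jump A H x" by simp
      then have "sgn (s k) * 1 = sgn (s k) * (sgn (s k) * jump A H x)" by (rule arg_cong)
      then show ?thesis by (simp only: mult.assoc[symmetric] sg mult_1_left mult_1_right)
    qed
    finally show ?thesis by simp
  next
    case False
    then have "x \<notin> X ` {0..1}" using curve_image_cells[OF J, of X] x(2) by blast
    then have "jump A H x * (F x \<bullet> n H) = 0" by (rule rest[OF H x(1)])
    then show ?thesis using False by (auto simp: \<psi>_def)
  qed
  have cF: "continuous_on S (\<lambda>x. F x \<bullet> v)" for S v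
    using continuous_on_subset[OF F] by (intro continuous_intros) auto
  have Xc: "continuous_on {0..1} X" using X by (simp add: Vh_def)
  have cell_int: "set_integrable lborel (cell J j) (\<lambda>\<alpha>. F (X \<alpha>) \<bullet> \<nu> j)" if j: "j \<in> {1..J}" for j
  proof -
    have "continuous_on {(real j - 1) / real J .. real j / real J} (\<lambda>\<alpha>. F (X \<alpha>) \<bullet> \<nu> j)"
      by (rule continuous_on_compose2[OF cF[of UNIV] Vh_continuous_affine[OF Xc j]]) simp
    then have "set_integrable lborel {(real j - 1) / real J .. real j / real J} (\<lambda>\<alpha>. F (X \<alpha>) \<bullet> \<nu> j)"
      by (rule borel_integrable_atLeastAtMost')
    then show ?thesis by (rule set_integrable_subset) auto
  qed
  have line_int: "integrable lborel (\<lambda>\<tau>. \<psi> j (pt (L j) \<tau>))"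
    "(LINT \<tau>|lborel. \<psi> j (pt (L j) \<tau>)) = (LINT \<alpha>:cell J j|lborel. (F (X \<alpha>) \<bullet> normal X \<alpha>) * norm (dcurve X \<alpha>))"
    if j: "j \<in> {1..J}" for j
  proof -
    obtain t0 where t0: "\<And>\<alpha>. \<alpha> \<in> cell J j \<Longrightarrow> pt (L j) (t0 + s j * \<alpha>) = X \<alpha>"
      "\<And>\<alpha>. pt (L j) (t0 + s j * \<alpha>) \<in> X ` cell J j \<longleftrightarrow> \<alpha> \<in> cell J j"
      using pt_cell[OF j] by blast
    have eq: "\<psi> j (pt (L j) (t0 + s j * \<alpha>)) = indicat_real (cell J j) \<alpha> *\<^sub>R (F (X \<alpha>) \<bullet> \<nu> j)" for \<alpha>
      using t0(1)[of \<alpha>] t0(2)[of \<alpha>] by (simp add: \<psi>_def indicator_def)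
    show "integrable lborel (\<lambda>\<tau>. \<psi> j (pt (L j) \<tau>))"
      using lborel_integrable_real_affine_iff[OF s(2)[OF j], of "\<lambda>\<tau>. \<psi> j (pt (L j) \<tau>)" t0] cell_int[OF j]
      by (simp only: eq set_integrable_def)
    have "(LINT \<tau>|lborel. \<psi> j (pt (L j) \<tau>)) = norm (b j) * (LINT \<alpha>:cell J j|lborel. F (X \<alpha>) \<bullet> \<nu> j)"
      using lborel_integral_real_affine[OF s(2)[OF j], of "\<lambda>\<tau>. \<psi> j (pt (L j) \<tau>)" t0] s(1)[OF j]
      by (simp only: eq set_lebesgue_integral_def real_scaleR_def)
    also have "\<dots> = (LINT \<alpha>:cell J j|lborel. (F (X \<alpha>) \<bullet> \<nu> j) * norm (b j))"
      by simp
    also have "\<dots> = (LINT \<alpha>:cell J j|lborel. (F (X \<alpha>) \<bullet> normal X \<alpha>) * norm (dcurve X \<alpha>))"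
      by (intro set_lebesgue_integral_cong) (auto simp: dc[OF j] nc[OF j])
    finally show "(LINT \<tau>|lborel. \<psi> j (pt (L j) \<tau>)) = (LINT \<alpha>:cell J j|lborel. (F (X \<alpha>) \<bullet> normal X \<alpha>) * norm (dcurve X \<alpha>))" .
  qed
  have "(LINT \<tau>|lborel. jump A H (pt H \<tau>) * (F (pt H \<tau>) \<bullet> n H)) = (\<Sum>j\<in>{j\<in>{1..J}. L j = H}. LINT \<tau>|lborel. \<psi> j (pt (L j) \<tau>))"
    if H: "H \<in> \<L>" for H
  proof -
    have i: "integrable lborel (\<lambda>\<tau>. \<psi> j (pt H \<tau>))" if "j \<in> {j\<in>{1..J}. L j = H}" for j
      using that line_int(1)[of j] by auto
    have "(LINT \<tau>|lborel. jump A H (pt H \<tau>) * (F (pt H \<tau>) \<bullet> n H)) = (LINT \<tau>|lborel. (\<Sum>j\<in>{j\<in>{1..J}. L j = H}. \<psi> j (pt H \<tau>)))"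
    proof (rule integral_cong_AE)
      show "(\<lambda>\<tau>. jump A H (pt H \<tau>) * (F (pt H \<tau>) \<bullet> n H)) \<in> borel_measurable lborel"
        by (rule borel_measurable_integrable[OF jump_integrable[OF H A(2,1) cF]])
      show "(\<lambda>\<tau>. \<Sum>j\<in>{j\<in>{1..J}. L j = H}. \<psi> j (pt H \<tau>)) \<in> borel_measurable lborel"
        by (rule borel_measurable_sum) (rule borel_measurable_integrable[OF i])
      show "AE \<tau> in lborel. jump A H (pt H \<tau>) * (F (pt H \<tau>) \<bullet> n H) = (\<Sum>j\<in>{j\<in>{1..J}. L j = H}. \<psi> j (pt H \<tau>))"
        using AE_generic[OF H finite_imageI[OF finite_grid], of X J] by eventually_elim (rule pointwise[OF H], auto)
    qed
    also have "\<dots> = (\<Sum>j\<in>{j\<in>{1..J}. L j = H}. LINT \<tau>|lborel. \<psi> j (pt H \<tau>))"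
      by (rule Bochner_Integration.integral_sum[OF i])
    also have "\<dots> = (\<Sum>j\<in>{j\<in>{1..J}. L j = H}. LINT \<tau>|lborel. \<psi> j (pt (L j) \<tau>))"
      by (rule sum.cong) auto
    finally show ?thesis .
  qed
  then have "(\<Sum>H\<in>\<L>. LINT \<tau>|lborel. jump A H (pt H \<tau>) * (F (pt H \<tau>) \<bullet> n H))
    = (\<Sum>H\<in>\<L>. \<Sum>j\<in>{j\<in>{1..J}. L j = H}. LINT \<tau>|lborel. \<psi> j (pt (L j) \<tau>))"
    by (intro sum.cong refl)
  \<comment> \<open>The choice \<open>L\<close> assigns every cell to exactly one line, even if
    several cells are collinear.\<close>
  also have "\<dots> = (\<Sum>j\<in>{1..J}. LINT \<tau>|lborel. \<psi> j (pt (L j) \<tau>))"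
    using L(1) finite_lines by (intro sum.group) auto
  also have "\<dots> = (\<Sum>j\<in>{1..J}. (LINT \<alpha>:cell J j|lborel. (F (X \<alpha>) \<bullet> normal X \<alpha>) * norm (dcurve X \<alpha>)))"
    by (intro sum.cong refl line_int(2))
  also have "\<dots> = (LINT \<alpha>:(\<Union>j\<in>{1..J}. cell J j)|lborel. (F (X \<alpha>) \<bullet> normal X \<alpha>) * norm (dcurve X \<alpha>))"
  proof (rule set_integral_finite_Union[symmetric])
    show "disjoint_family_on (cell J) {1..J}"
      unfolding disjoint_family_on_def using cell_unique by blast
    fix j assume j: "j \<in> {1..J}"
    have "set_integrable lborel (cell J j) (\<lambda>\<alpha>. (F (X \<alpha>) \<bullet> \<nu> j) * norm (b j))"
      using cell_int[OF j] by simp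
    then show "set_integrable lborel (cell J j) (\<lambda>\<alpha>. (F (X \<alpha>) \<bullet> normal X \<alpha>) * norm (dcurve X \<alpha>))"
      by (rule set_integrable_cong[THEN iffD1, rotated -1]) (auto simp: dc[OF j] nc[OF j])
  qed auto
  also have "\<dots> = (LINT \<alpha>:(\<Union>j\<in>{1..J}. cell J j)|lebesgue. (F (X \<alpha>) \<bullet> normal X \<alpha>) * norm (dcurve X \<alpha>))"
  proof -
    have "set_integrable lborel (\<Union>j\<in>{1..J}. cell J j) (\<lambda>\<alpha>. (F (X \<alpha>) \<bullet> normal X \<alpha>) * norm (dcurve X \<alpha>))"
    proof (rule set_integrable_UN)
      fix j assume j: "j \<in> {1..J}"
      have "set_integrable lborel (cell J j) (\<lambda>\<alpha>. (F (X \<alpha>) \<bullet> \<nu> j) * norm (b j))"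
        using cell_int[OF j] by simp
      then show "set_integrable lborel (cell J j) (\<lambda>\<alpha>. (F (X \<alpha>) \<bullet> normal X \<alpha>) * norm (dcurve X \<alpha>))"
        by (rule set_integrable_cong[THEN iffD1, rotated -1]) (auto simp: dc[OF j] nc[OF j])
    qed auto
    then show ?thesis
      unfolding set_lebesgue_integral_def set_integrable_def
      by (intro integral_completion[symmetric]) (rule borel_measurable_integrable, simp)
  qed
  also have "\<dots> = (LINT \<alpha>:unit_I|lebesgue. (F (X \<alpha>) \<bullet> normal X \<alpha>) * norm (dcurve X \<alpha>))"
    unfolding set_lebesgue_integral_def
  proof (rule integral_cong_AE_lebesgue)
    have sub: "(\<Union>j\<in>{1..J}. cell J j) \<subseteq> unit_I" by (intro UN_least cell_subset)
    show "AE \<alpha> in lebesgue. indicat_real (\<Union>j\<in>{1..J}. cell J j) \<alpha> *\<^sub>R ((F (X \<alpha>) \<bullet> normal X \<alpha>) * norm (dcurve X \<alpha>))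
      = indicat_real unit_I \<alpha> *\<^sub>R ((F (X \<alpha>) \<bullet> normal X \<alpha>) * norm (dcurve X \<alpha>))"
      using AE_unit_grid[of J]
    proof eventually_elim
      fix \<alpha> assume "\<alpha> \<notin> grid J"
      then have "\<alpha> \<in> (\<Union>j\<in>{1..J}. cell J j) \<longleftrightarrow> \<alpha> \<in> unit_I" using unit_I_cells[OF J] sub by blast
      then show "indicat_real (\<Union>j\<in>{1..J}. cell J j) \<alpha> *\<^sub>R ((F (X \<alpha>) \<bullet> normal X \<alpha>) * norm (dcurve X \<alpha>))
        = indicat_real unit_I \<alpha> *\<^sub>R ((F (X \<alpha>) \<bullet> normal X \<alpha>) * norm (dcurve X \<alpha>))"
        unfolding indicator_def by (simp only:)
    qed
  qed
  finally show ?thesis .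
qed

end

lemma mesh_edges:
  assumes "is_mesh R \<T>"
  shows "\<exists>E. finite E \<and> (\<forall>K\<in>\<T>. frontier K \<subseteq> (\<Union>(a, b)\<in>E. closed_segment a b))"
proof -
  let ?V = "\<lambda>K. {v. v extreme_point_of K}"
  have K: "finite (?V K) \<and> frontier K \<subseteq> (\<Union>(a, b)\<in>?V K \<times> ?V K. closed_segment a b)" if "K \<in> \<T>" for K
  proof -
    have "2 simplex K" using assms that by (simp add: is_mesh_def)
    then obtain C where C: "\<not> affine_dependent C" "card C = 3" "K = convex hull C"
      by (auto simp: simplex_def)
    obtain a b c where abc: "C = {a, b, c}" using C(2) by (auto simp: card_3_iff)
    have V: "?V K = C" using C extreme_point_of_convex_hull_affine_independent by blast
    have "frontier K = closed_segment a b \<union> closed_segment b c \<union> closed_segment c a"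
      unfolding C(3) abc by (rule frontier_of_triangle) simp
    then show ?thesis unfolding V abc by auto
  qed
  have "finite \<T>" using assms by (simp add: is_mesh_def triangulation_def)
  then have "finite (\<Union>K\<in>\<T>. ?V K \<times> ?V K)" using K by auto
  moreover have "frontier K \<subseteq> (\<Union>(a, b)\<in>(\<Union>K\<in>\<T>. ?V K \<times> ?V K). closed_segment a b)" if "K \<in> \<T>" for K
    using K[OF that] that by blast
  ultimately show ?thesis by blast
qed

lemma divides_side_trace:
  assumes "divides X R" "\<alpha> \<in> unit_I" "X differentiable (at \<alpha>)"
  shows "side_trace (inner_phase R X) (X \<alpha>) (normal X \<alpha>) = 0 \<and> side_trace (inner_phase R X) (X \<alpha>) (- normal X \<alpha>) = 1"
proof -
  have ev: "\<forall>\<^sub>F e in at_right 0. X \<alpha> + e *\<^sub>R normal X \<alpha> \<in> outer_phase R X \<and> X \<alpha> - e *\<^sub>R normal X \<alpha> \<in> inner_phase R X"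
    using assms unfolding divides_def by blast
  have "\<forall>\<^sub>F e in at_right 0. (X \<alpha> + e *\<^sub>R normal X \<alpha> \<in> inner_phase R X) = False"
    using ev by eventually_elim (simp add: outer_phase_def)
  from eventually_iff_const[OF this]
  have "side_trace (inner_phase R X) (X \<alpha>) (normal X \<alpha>) = 0" by (simp add: side_trace_def)
  moreover have "\<forall>\<^sub>F e in at_right 0. (X \<alpha> + e *\<^sub>R (- normal X \<alpha>) \<in> inner_phase R X) = True"
    using ev by eventually_elim simp
  from eventually_iff_const[OF this]
  have "side_trace (inner_phase R X) (X \<alpha>) (- normal X \<alpha>) = 1" by (simp add: side_trace_def)
  ultimately show ?thesis by blast
qed

text \<open>Three reasons for the three boundary parts: the velocity vanishes on \<open>D1\<close>,
  its normal component on \<open>D2\<close>, and the weight \<open>r\<close> on the axis.\<close>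

lemma discrete_velocity_boundary:
  assumes "u \<in> discrete_velocities R D1 D2 \<T>" "frontier R = D1 \<union> D2 \<union> axis_boundary R"
    and "x \<in> frontier R" "is_outer_normal R x m"
  shows "(x $ 1 *\<^sub>R u x) \<bullet> m = 0"
proof -
  have "x \<in> D1 \<or> x \<in> D2 \<or> x \<in> axis_boundary R" using assms(2,3) by blast
  then show ?thesis
    using assms(1,4) by (elim disjE) (auto simp: discrete_velocities_def velocity_space_def axis_boundary_def)
qed

text \<open>The constant \<open>omega\<close> multiplies the total flux through the boundary of
  \<open>R\<close>, which is 0. What is left is the divergence integral over the inner phase, to
  which only the curve contributes, with its normal pointing outwards.\<close>

proposition flux_through_phase_boundary:
  assumes R: "polygonal_domain R" and fr: "frontier R = D1 \<union> D2 \<union> axis_boundary R"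
    and mesh: "is_mesh R \<T>" and u: "u \<in> discrete_velocities R D1 D2 \<T>"
    and X: "X \<in> Vh J" and J: "J \<ge> 1" and div: "divides X R"
  shows "l2_inner R (divergence (\<lambda>x. x $ 1 *\<^sub>R u x)) (phase_function R X)
    = l2_inner unit_I (\<lambda>\<alpha>. (X \<alpha> \<bullet> e1) *\<^sub>R u (X \<alpha>)) (\<lambda>\<alpha>. norm (dcurve X \<alpha>) *\<^sub>R normal X \<alpha>)"
proof -
  have oR: "open R" and bR: "bounded R" using R by (auto simp: polygonal_domain_def)
  obtain E1 where E1: "finite E1" "frontier R = (\<Union>(a, b)\<in>E1. closed_segment a b)"
    using R by (auto simp: polygonal_domain_def)
  define E2 where "E2 = (\<lambda>j. (X ((real j - 1) / real J), X (real j / real J))) ` {1..J}"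
  obtain E3 where E3: "finite E3" "\<forall>K\<in>\<T>. frontier K \<subseteq> (\<Union>(a, b)\<in>E3. closed_segment a b)"
    using mesh_edges[OF mesh] by blast
  \<comment> \<open>Edges of the domain, segments of the curve and edges of the mesh are treated
    alike, by one common arrangement.\<close>
  have "finite (E1 \<union> E2 \<union> E3)" using E1(1) E3(1) by (simp add: E2_def)
  then obtain \<L> n c where LA: "line_arrangement \<L> n c"
    and seg: "\<And>a b. (a, b) \<in> E1 \<union> E2 \<union> E3 \<Longrightarrow> \<exists>H\<in>\<L>. closed_segment a b \<subseteq> H"
    by (rule line_arrangement_of_segments) blast
  interpret line_arrangement \<L> n c by (rule LA)
  have frR: "frontier R \<subseteq> \<Union>\<L>"
    unfolding E1(2) using seg by blast
  have frK: "\<forall>K\<in>\<T>. frontier K \<subseteq> \<Union>\<L>"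
  proof
    fix K assume "K \<in> \<T>"
    then have "frontier K \<subseteq> (\<Union>(a, b)\<in>E3. closed_segment a b)" using E3(2) by blast
    also have "\<dots> \<subseteq> \<Union>\<L>" using seg by blast
    finally show "frontier K \<subseteq> \<Union>\<L>" .
  qed
  have seg2: "\<exists>H\<in>\<L>. closed_segment (X ((real j - 1) / real J)) (X (real j / real J)) \<subseteq> H" if "j \<in> {1..J}" for j
    using seg that by (simp add: E2_def)
  have cellL: "\<exists>H\<in>\<L>. X ` cell J j \<subseteq> H" if "j \<in> {1..J}" for j
    using seg2[OF that] curve_image_segments(2)[OF X J that] by blast
  have XL: "X ` {0..1} \<subseteq> \<Union>\<L>"
    using curve_image_segments(1)[OF X J] seg2 by blast
  let ?A = "inner_phase R X"
  have Xc: "continuous_on {0..1} X" using X by (simp add: Vh_def)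
  have C: "closed (X ` {0..1} \<union> axis_boundary R)"
    using compact_imp_closed[OF compact_continuous_image[OF Xc compact_Icc]] closed_axis_boundary by (rule closed_Un)
  note A = frontier_inner_phase[OF oR C]
  have frA: "frontier ?A \<subseteq> \<Union>\<L>" using A(3) frR XL by blast
  have bA: "bounded ?A" using A(2) bR bounded_subset by blast
  have uFE: "u \<in> FEvec R \<T> 2" and uc: "continuous_on (closure R) u"
    using u by (auto simp: discrete_velocities_def velocity_space_def)
  \<comment> \<open>The velocity is controlled only on \<open>closure R\<close>, while line
    integrals run over complete lines. Any continuous extension serves, since the jump is 0 outside
    the closure.\<close>
  obtain V where V: "continuous_on UNIV V" "\<And>x. x \<in> closure R \<Longrightarrow> V x = u x"
    by (rule Tietze_unbounded[OF uc, of UNIV]) (auto simp: closed_closedin[symmetric])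
  let ?F = "\<lambda>x. x $ 1 *\<^sub>R V x"
  have Fc: "continuous_on UNIV ?F" using V(1) by (intro continuous_intros)
  have FR: "?F x \<bullet> m = 0" if "x \<in> frontier R" "is_outer_normal R x m" for x m
  proof -
    have "V x = u x" using V(2) that(1) by (simp add: frontier_def)
    then show ?thesis using discrete_velocity_boundary[OF u fr that] by simp
  qed
  let ?div = "divergence (\<lambda>x. x $ 1 *\<^sub>R u x)"
  note int = divergence_integrable[OF mesh frK uFE oR bR]
  have R0: "(LINT x:R|lebesgue. ?div x) = 0"
    using integral_divergence_FE[OF mesh frK uFE oR bR oR subset_refl frR V] flux_zero[OF oR frR, of ?F] FR by simp
  have XR: "X \<alpha> \<in> closure R" if "\<alpha> \<in> unit_I" for \<alpha>
  proof -
    have "X ` unit_I \<subseteq> R" using div by (simp add: divides_def)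
    then show ?thesis using that closure_subset[of R] by blast
  qed
  have "(LINT x:?A|lebesgue. ?div x) = (LINT \<alpha>:unit_I|lebesgue. (?F (X \<alpha>) \<bullet> normal X \<alpha>) * norm (dcurve X \<alpha>))"
  proof (rule trans[OF integral_divergence_FE[OF mesh frK uFE oR bR A(1,2) frA V] flux_through_curve[OF X J _ cellL bA frA _ Fc]])
    show "inj_on X unit_I" using div by (simp add: divides_def)
    show "side_trace ?A (X \<alpha>) (normal X \<alpha>) = 0 \<and> side_trace ?A (X \<alpha>) (- normal X \<alpha>) = 1"
      if "\<alpha> \<in> unit_I" "\<alpha> \<notin> grid J" for \<alpha>
      using divides_side_trace[OF div that(1) differentiableI_vector[OF Vh_dcurve[OF X J that]]] .
    fix H x assume H: "H \<in> \<L>" "generic H x" "x \<notin> X ` {0..1}"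
    show "jump ?A H x * (?F x \<bullet> n H) = 0"
    \<comment> \<open>On the axis the weight removes the flux; off the axis and the curve the outer
      normal of the phase is one of the domain.\<close>
    proof (cases "jump ?A H x = 0 \<or> x $ 1 = 0")
      case False
      note j = jump_outer_normal[OF H(1,2) A(1) frA]
      have "is_outer_normal R x (jump ?A H x *\<^sub>R n H)"
        using inner_phase_outer_normal[OF _ H(3) _ C] j False by blast
      moreover have "x \<in> frontier R" using j(2) A(3) H(3) False by blast
      ultimately have "?F x \<bullet> (jump ?A H x *\<^sub>R n H) = 0" by (rule FR[rotated])
      then show ?thesis by simp
    qed auto
  qed
  also have "\<dots> = l2_inner unit_I (\<lambda>\<alpha>. (X \<alpha> \<bullet> e1) *\<^sub>R u (X \<alpha>)) (\<lambda>\<alpha>. norm (dcurve X \<alpha>) *\<^sub>R normal X \<alpha>)"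
    unfolding l2_inner_def
    by (rule set_lebesgue_integral_cong) (auto simp: V(2) XR inner_e1)
  finally have flux: "(LINT x:?A|lebesgue. ?div x) = \<dots>" .
  have int': "set_integrable lebesgue ?A ?div"
    by (rule set_integrable_subset[OF int]) (use A in auto)
  have "l2_inner R ?div (phase_function R X) = (LINT x:R|lebesgue. ?div x * indicator ?A x - omega R X * ?div x)"
    unfolding l2_inner_def by (simp add: phase_function_def algebra_simps)
  also have "\<dots> = (LINT x:R|lebesgue. ?div x * indicator ?A x) - (LINT x:R|lebesgue. omega R X * ?div x)"
  proof (rule set_integral_diff(2))
    have "(\<lambda>x. indicat_real R x *\<^sub>R (?div x * indicator ?A x)) = (\<lambda>x. indicat_real ?A x *\<^sub>R ?div x)"
      using A(2) by (auto simp: fun_eq_iff split: split_indicator)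
    then show "set_integrable lebesgue R (\<lambda>x. ?div x * indicator ?A x)"
      using int' by (simp add: set_integrable_def)
    show "set_integrable lebesgue R (\<lambda>x. omega R X * ?div x)"
      using int by (rule set_integrable_mult_right)
  qed
  also have "(LINT x:R|lebesgue. ?div x * indicator ?A x) = (LINT x:?A|lebesgue. ?div x)"
    unfolding set_lebesgue_integral_def
    by (rule Bochner_Integration.integral_cong) (use A(2) in \<open>auto simp: indicator_def\<close>)
  also have "(LINT x:R|lebesgue. omega R X * ?div x) = 0"
    using R0 by simp
  finally show ?thesis using flux by simp
qed

section \<open>Integrability of bulk terms and the kinetic energy\<close>

lemma FEvec_continuous: "u \<in> FEvec R \<T> k \<Longrightarrow> continuous_on (closure R) u"
  using continuous_on_vec_lambda[of "closure R" "\<lambda>i x. u x $ i"] by (simp add: FEvec_def FE_def)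

lemma continuous_bounded_integrable:
  fixes f :: "real^2 \<Rightarrow> real"
  assumes "continuous_on (closure R) f" "bounded R" "open R"
  shows "set_integrable lebesgue R f"
proof -
  have "integrable lborel (\<lambda>x. indicator (closure R) x *\<^sub>R f x)"
    using assms by (intro borel_integrable_compact) (auto simp: compact_eq_bounded_closed bounded_closure)
  then have "set_integrable lebesgue (closure R) f"
    unfolding set_integrable_def by (subst integrable_completion) (auto intro: borel_measurable_integrable)
  then show ?thesis
    by (rule set_integrable_subset) (use assms(3) closure_subset in auto)
qed

text \<open>The common form of \<open>phase_coeff\<close> and \<open>average0\<close>: constants on
  open triangles and 0 on the edges.\<close>

definition step_function :: "(real^2) set set \<Rightarrow> (real^2 \<Rightarrow> real) \<Rightarrow> bool"
  where "step_function \<T> \<rho> \<longleftrightarrow> (\<exists>k. \<rho> = (\<lambda>x. \<Sum>K\<in>\<T>. indicator (interior K) x * k K))"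

lemma step_function_phase_coeff: "step_function \<T> (phase_coeff R \<T> X cm cp)"
  unfolding step_function_def phase_coeff_def
  by (rule exI[of _ "\<lambda>K. if interior K \<subseteq> inner_phase R X then cm
     else if interior K \<subseteq> outer_phase R X then cp else (cm + cp) / 2"]) (rule refl)

lemma step_function_average0: "step_function \<T> (average0 \<T> f)"
  unfolding step_function_def average0_def
  by (rule exI[of _ "\<lambda>K. (LINT y:interior K|lebesgue. f y) / measure lebesgue (interior K)"]) (rule refl)

lemma phase_coeff_nonneg: "cm > 0 \<Longrightarrow> cp > 0 \<Longrightarrow> phase_coeff R \<T> X cm cp x \<ge> 0"
  unfolding phase_coeff_def by (intro sum_nonneg mult_nonneg_nonneg) auto

lemma average0_nonneg: "(\<And>x. f x \<ge> 0) \<Longrightarrow> average0 \<T> f x \<ge> 0"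
  unfolding average0_def set_lebesgue_integral_def
  by (intro sum_nonneg mult_nonneg_nonneg divide_nonneg_nonneg Bochner_Integration.integral_nonneg) auto

lemma step_integrable:
  assumes "step_function \<T> \<rho>" "continuous_on (closure R) f" "bounded R" "open R"
  shows "set_integrable lebesgue R (\<lambda>x. \<rho> x * f x)"
proof -
  obtain k where k: "\<rho> = (\<lambda>x. \<Sum>K\<in>\<T>. indicator (interior K) x * k K)"
    using assms(1) unfolding step_function_def by blast
  have "integrable lebesgue (\<lambda>x. \<Sum>K\<in>\<T>. k K *\<^sub>R (indicat_real (interior K) x *\<^sub>R (indicat_real R x *\<^sub>R f x)))"
    using continuous_bounded_integrable[OF assms(2-4)] unfolding set_integrable_def
    by (intro Bochner_Integration.integrable_sum integrable_scaleR_right)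
      (rule integrable_mult_indicator, simp_all)
  moreover have "(\<Sum>K\<in>\<T>. k K *\<^sub>R (indicat_real (interior K) x *\<^sub>R (indicat_real R x *\<^sub>R f x))) = indicat_real R x *\<^sub>R (\<rho> x * f x)" for x
    by (simp add: k sum_distrib_left sum_distrib_right mult_ac)
  ultimately show ?thesis by (simp add: set_integrable_def)
qed

text \<open>Testing the averaged time differences with \<open>u\<close> gives half of \<open>\<rho>
  |u|\<^sup>2 - \<sigma> |v|\<^sup>2 + \<sigma> |u - v|\<^sup>2\<close>, weighted by
  \<open>r\<close>. The mean of the two differences in the scheme is what completes the square when
  the density changes in time.\<close>

lemma kinetic_energy_increment:
  fixes u v :: "real^2 \<Rightarrow> real^2"
  assumes R: "bounded R" "open R" "R \<subseteq> {x. x $ 1 > 0}"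
    and uv: "continuous_on (closure R) u" "continuous_on (closure R) v"
    and \<rho>: "step_function \<T> \<rho>" "step_function \<T> \<sigma>" and nonneg: "\<And>x. \<sigma> x \<ge> 0" and dt: "dt > 0"
  shows "1/2 * l2_inner R (\<lambda>x. \<rho> x * (norm (u x))\<^sup>2) (\<lambda>x. x $ 1) - 1/2 * l2_inner R (\<lambda>x. \<sigma> x * (norm (v x))\<^sup>2) (\<lambda>x. x $ 1)
    \<le> dt * (1/2 * (l2_inner R (\<lambda>x. (\<rho> x *\<^sub>R u x - \<sigma> x *\<^sub>R v x) /\<^sub>R dt) (\<lambda>x. x $ 1 *\<^sub>R u x)
           + l2_inner R (\<lambda>x. \<sigma> x *\<^sub>R ((u x - v x) /\<^sub>R dt)) (\<lambda>x. x $ 1 *\<^sub>R u x)))"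
proof -
  have i: "set_integrable lebesgue R (\<lambda>x. \<theta> x * (x $ 1 * (w x \<bullet> w' x)))"
    if "step_function \<T> \<theta>" "continuous_on (closure R) w" "continuous_on (closure R) w'" for \<theta> and w w' :: "real^2 \<Rightarrow> real^2"
    by (rule step_integrable[OF that(1) _ R(1,2)]) (intro continuous_intros that)
  define I where "I \<theta> w w' = (LINT x:R|lebesgue. \<theta> x * (x $ 1 * (w x \<bullet> w' x)))" for \<theta> and w w' :: "real^2 \<Rightarrow> real^2"
  note a = i[OF \<rho>(1) uv(1) uv(1)] and b = i[OF \<rho>(2) uv(2) uv(1)] and c = i[OF \<rho>(2) uv(1) uv(1)] and d = i[OF \<rho>(2) uv(2) uv(2)]
  have 1: "l2_inner R (\<lambda>x. \<rho> x * (norm (u x))\<^sup>2) (\<lambda>x. x $ 1) = I \<rho> u u"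
    "l2_inner R (\<lambda>x. \<sigma> x * (norm (v x))\<^sup>2) (\<lambda>x. x $ 1) = I \<sigma> v v"
    by (simp_all add: l2_inner_def I_def power2_norm_eq_inner mult_ac)
  have "l2_inner R (\<lambda>x. (\<rho> x *\<^sub>R u x - \<sigma> x *\<^sub>R v x) /\<^sub>R dt) (\<lambda>x. x $ 1 *\<^sub>R u x)
    = (LINT x:R|lebesgue. inverse dt * (\<rho> x * (x $ 1 * (u x \<bullet> u x)) - \<sigma> x * (x $ 1 * (v x \<bullet> u x))))"
    unfolding l2_inner_def by (simp add: inner_diff_left algebra_simps)
  also have "\<dots> = inverse dt * (I \<rho> u u - I \<sigma> v u)"
    unfolding I_def set_integral_diff(2)[OF a b, symmetric] by simp
  finally have 2: "l2_inner R (\<lambda>x. (\<rho> x *\<^sub>R u x - \<sigma> x *\<^sub>R v x) /\<^sub>R dt) (\<lambda>x. x $ 1 *\<^sub>R u x) = inverse dt * (I \<rho> u u - I \<sigma> v u)" .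
  have "l2_inner R (\<lambda>x. \<sigma> x *\<^sub>R ((u x - v x) /\<^sub>R dt)) (\<lambda>x. x $ 1 *\<^sub>R u x)
    = (LINT x:R|lebesgue. inverse dt * (\<sigma> x * (x $ 1 * (u x \<bullet> u x)) - \<sigma> x * (x $ 1 * (v x \<bullet> u x))))"
    unfolding l2_inner_def by (simp add: inner_diff_left algebra_simps)
  also have "\<dots> = inverse dt * (I \<sigma> u u - I \<sigma> v u)"
    unfolding I_def set_integral_diff(2)[OF c b, symmetric] by simp
  finally have 3: "l2_inner R (\<lambda>x. \<sigma> x *\<^sub>R ((u x - v x) /\<^sub>R dt)) (\<lambda>x. x $ 1 *\<^sub>R u x) = inverse dt * (I \<sigma> u u - I \<sigma> v u)" .
  \<comment> \<open>The term that is dropped in the estimate; it is nonnegative because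
    \<open>r > 0\<close> on \<open>R\<close>.\<close>
  have "0 \<le> (LINT x:R|lebesgue. \<sigma> x * (x $ 1 * ((u x - v x) \<bullet> (u x - v x))))"
    unfolding set_lebesgue_integral_def
    using nonneg R(3) by (intro Bochner_Integration.integral_nonneg) (auto simp: indicator_def intro!: mult_nonneg_nonneg)
  also have "\<dots> = (LINT x:R|lebesgue. (\<sigma> x * (x $ 1 * (u x \<bullet> u x)) - 2 * (\<sigma> x * (x $ 1 * (v x \<bullet> u x)))) + \<sigma> x * (x $ 1 * (v x \<bullet> v x)))"
    by (simp add: inner_diff_left inner_diff_right inner_commute[of "u _" "v _"] algebra_simps)
  also have "\<dots> = I \<sigma> u u - 2 * I \<sigma> v u + I \<sigma> v v"
    unfolding I_def set_integral_add(2)[OF set_integral_diff(1)[OF c set_integrable_mult_right[OF b]] d]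
      set_integral_diff(2)[OF c set_integrable_mult_right[OF b]] by simp
  finally have 4: "2 * I \<sigma> v u \<le> I \<sigma> u u + I \<sigma> v v" by simp
  have 5: "dt * (1/2 * (inverse dt * (I \<rho> u u - I \<sigma> v u) + inverse dt * (I \<sigma> u u - I \<sigma> v u)))
      = 1/2 * (I \<rho> u u + I \<sigma> u u - 2 * I \<sigma> v u)"
    using dt by (simp add: field_simps)
  have "I \<rho> u u - I \<sigma> v v \<le> I \<rho> u u + I \<sigma> u u - 2 * I \<sigma> v u" using 4 by linarith
  then show ?thesis unfolding 1 2 3 5 by simp
qed

lemma l2_norm_squared: "(l2_norm S f)\<^sup>2 = l2_inner S f f"
proof -
  have "l2_inner S f f \<ge> 0"
    unfolding l2_inner_def set_lebesgue_integral_def by (intro Bochner_Integration.integral_nonneg) auto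
  then show ?thesis by (simp add: l2_norm_def)
qed

lemma quad_norm_squared:
  assumes "is_quadrature \<T> Q wt"
  shows "(quad_norm \<T> Q wt f)\<^sup>2 = quad_inner \<T> Q wt f f"
proof -
  have "quad_inner \<T> Q wt f f \<ge> 0"
    unfolding quad_inner_def using assms
    by (intro sum_nonneg mult_nonneg_nonneg[OF _ zero_le_square]) (auto simp: is_quadrature_def)
  then show ?thesis by (simp add: quad_norm_def)
qed

section \<open>Stability and volume conservation\<close>

theorem theorem2:
  fixes R D1 D2 :: "(real^2) set"
    and \<rho>m \<rho>p \<mu>m \<mu>p \<gamma> T dt :: real
    and g :: "real^2 \<Rightarrow> real^2"
    and M J :: nat
    and \<T> :: "nat \<Rightarrow> (real^2) set set"
    and PP :: "nat \<Rightarrow> (real^2 \<Rightarrow> real) set"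
    and Q :: "nat \<Rightarrow> (real^2) set \<Rightarrow> (real^2) set"
    and wt :: "nat \<Rightarrow> (real^2) set \<Rightarrow> real^2 \<Rightarrow> real"
    and \<rho> \<mu> \<rho>I :: "nat \<Rightarrow> real^2 \<Rightarrow> real"
    and U UI :: "nat \<Rightarrow> real^2 \<Rightarrow> real^2"
    and P :: "nat \<Rightarrow> real^2 \<Rightarrow> real"
    and X :: "nat \<Rightarrow> real \<Rightarrow> real^2"
    and \<kappa> :: "nat \<Rightarrow> real \<Rightarrow> real"
  assumes domain: "polygonal_domain R" "R \<subseteq> {x. x $ 1 > 0}"
      "frontier R = D1 \<union> D2 \<union> axis_boundary R"
    and constants: "\<rho>m > 0" "\<rho>p > 0" "\<mu>m > 0" "\<mu>p > 0" "\<gamma> > 0"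
    and time_steps: "T > 0" "M \<ge> 1" "dt = T / real M"
    and J: "J \<ge> 1"
    and curves: "\<And>m. m \<le> M \<Longrightarrow> X m \<in> Vh_bd J"
      "\<And>m \<alpha>. m \<le> M \<Longrightarrow> \<alpha> \<in> unit_I \<Longrightarrow> X m \<alpha> \<bullet> e1 > 0"
      "\<And>m \<alpha>. m \<le> M \<Longrightarrow> \<alpha> \<in> unit_I \<Longrightarrow> X m differentiable (at \<alpha>) \<Longrightarrow> norm (dcurve (X m) \<alpha>) > 0"
      "\<And>m. m < M \<Longrightarrow> divides (X m) R"
    and meshes: "\<And>m. m < M \<Longrightarrow> is_mesh R (\<T> m)"
    and pressures: "\<And>m. m < M \<Longrightarrow>
      PP m = P1_pressures R (\<T> m) \<or> PP m = enriched_pressures R (\<T> m) (X m)"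
    and quadrature: "\<And>m. m < M \<Longrightarrow> is_quadrature (\<T> m) (Q m) (wt m)"
    and density: "\<And>m. m < M \<Longrightarrow> \<rho> m = phase_coeff R (\<T> m) (X m) \<rho>m \<rho>p"
    and viscosity: "\<And>m. m < M \<Longrightarrow> \<mu> m = phase_coeff R (\<T> m) (X m) \<mu>m \<mu>p"
    and interpolants: "\<And>m. m < M \<Longrightarrow> \<rho>I m = average0 (\<T> m) (prev \<rho> m)"
      "\<And>m. m < M \<Longrightarrow> UI m = lagrange2 R (\<T> m) (U m)"
    and initial: "U 0 \<in> discrete_velocities R D1 D2 (\<T> 0)"
    and solution_spaces: "\<And>m. m < M \<Longrightarrow> U (Suc m) \<in> discrete_velocities R D1 D2 (\<T> m)"
      "\<And>m. m < M \<Longrightarrow> P (Suc m) \<in> PP m"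
      "\<And>m. m < M \<Longrightarrow> \<kappa> (Suc m) \<in> Vh J"
    and momentum: "\<And>m w. m < M \<Longrightarrow> w \<in> discrete_velocities R D1 D2 (\<T> m) \<Longrightarrow>
      1/2 * (l2_inner R (\<lambda>x. (\<rho> m x *\<^sub>R U (Suc m) x - \<rho>I m x *\<^sub>R UI m x) /\<^sub>R dt) (\<lambda>x. x $ 1 *\<^sub>R w x)
           + l2_inner R (\<lambda>x. \<rho>I m x *\<^sub>R ((U (Suc m) x - UI m x) /\<^sub>R dt)) (\<lambda>x. x $ 1 *\<^sub>R w x))
      + adv_form R (\<rho> m) (UI m) (U (Suc m)) w
      + 2 * l2_inner R (\<lambda>x. \<mu> m x *\<^sub>R sym_grad (U (Suc m)) x) (\<lambda>x. x $ 1 *\<^sub>R sym_grad w x)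
      + 2 * quad_inner (\<T> m) (Q m) (wt m) (\<lambda>x. \<mu> m x / x $ 1 * (U (Suc m) x \<bullet> e1)) (\<lambda>x. w x \<bullet> e1)
      - l2_inner R (P (Suc m)) (divergence (\<lambda>x. x $ 1 *\<^sub>R w x))
      - \<gamma> * l2_inner unit_I (\<lambda>\<alpha>. (X m \<alpha> \<bullet> e1) * \<kappa> (Suc m) \<alpha>)
              (\<lambda>\<alpha>. (normal (X m) \<alpha> \<bullet> w (X m \<alpha>)) * norm (dcurve (X m) \<alpha>))
      = l2_inner R (\<lambda>x. \<rho> m x *\<^sub>R g x) (\<lambda>x. x $ 1 *\<^sub>R w x)"
    and incompressibility: "\<And>m q. m < M \<Longrightarrow> q \<in> PP m \<Longrightarrow>
      l2_inner R (divergence (\<lambda>x. x $ 1 *\<^sub>R U (Suc m) x)) q = 0"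
    and kinematic: "\<And>m \<zeta>. m < M \<Longrightarrow> \<zeta> \<in> Vh J \<Longrightarrow>
      1/dt * l2_inner unit_I (\<lambda>\<alpha>. X (Suc m) \<alpha> - X m \<alpha>) (\<lambda>\<alpha>. \<zeta> \<alpha> *\<^sub>R f_half (X m) (X (Suc m)) \<alpha>)
      - l2_inner unit_I (\<lambda>\<alpha>. (X m \<alpha> \<bullet> e1) *\<^sub>R U (Suc m) (X m \<alpha>))
          (\<lambda>\<alpha>. (\<zeta> \<alpha> * norm (dcurve (X m) \<alpha>)) *\<^sub>R normal (X m) \<alpha>) = 0"
    and curvature: "\<And>m \<eta>. m < M \<Longrightarrow> \<eta> \<in> Vh_bd J \<Longrightarrow>
      l2_inner unit_I (\<lambda>\<alpha>. \<kappa> (Suc m) \<alpha> *\<^sub>R f_half (X m) (X (Suc m)) \<alpha>) \<eta>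
      + l2_inner unit_I (\<lambda>\<alpha>. \<eta> \<alpha> \<bullet> e1) (\<lambda>\<alpha>. norm (dcurve (X (Suc m)) \<alpha>))
      + l2_inner unit_I (\<lambda>\<alpha>. (X m \<alpha> \<bullet> e1) *\<^sub>R dcurve (X (Suc m)) \<alpha>)
          (\<lambda>\<alpha>. dcurve \<eta> \<alpha> /\<^sub>R norm (dcurve (X m) \<alpha>)) = 0"
  shows
    "(\<forall>m<M.
        1 / (2*pi) * energy R \<gamma> (\<rho> m) (U (Suc m)) (X (Suc m))
        + 2 * dt * ((l2_norm R (\<lambda>x. sqrt (\<mu> m x * x $ 1) *\<^sub>R sym_grad (U (Suc m)) x))\<^sup>2
           + (quad_norm (\<T> m) (Q m) (wt m) (\<lambda>x. sqrt (\<mu> m x / x $ 1) * (U (Suc m) x \<bullet> e1)))\<^sup>2)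
        \<le> 1 / (2*pi) * energy R \<gamma> (\<rho>I m) (UI m) (X m)
          + dt * l2_inner R (\<lambda>x. (\<rho> m x * x $ 1) *\<^sub>R g x) (U (Suc m)))
     \<and>
     ((\<forall>m<M. energy R \<gamma> (\<rho>I m) (UI m) (X m) \<le> energy R \<gamma> (prev \<rho> m) (U m) (X m)) \<longrightarrow>
      (\<forall>k<M.
        1 / (2*pi) * energy R \<gamma> (\<rho> k) (U (Suc k)) (X (Suc k))
        + 2 * dt * (\<Sum>m\<le>k.
             (l2_norm R (\<lambda>x. sqrt (\<mu> m x * x $ 1) *\<^sub>R sym_grad (U (Suc m)) x))\<^sup>2
           + (quad_norm (\<T> m) (Q m) (wt m) (\<lambda>x. sqrt (\<mu> m x / x $ 1) * (U (Suc m) x \<bullet> e1)))\<^sup>2)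
        \<le> 1 / (2*pi) * energy R \<gamma> (\<rho> 0) (U 0) (X 0)
          + dt * (\<Sum>m\<le>k. l2_inner R (\<lambda>x. (\<rho> m x * x $ 1) *\<^sub>R g x) (U (Suc m)))))
     \<and>
     ((\<forall>m<M. phase_function R (X m) \<in> PP m) \<longrightarrow>
      (\<forall>m<M. enclosed_volume (X (Suc m)) = enclosed_volume (X m)))"
proof -
  have dt: "dt > 0" using time_steps by simp
  have oR: "open R" and bR: "bounded R" and regular: "interior (closure R) = R"
    using domain(1) by (auto simp: polygonal_domain_def)
  have Rsets: "R \<in> sets lebesgue" using oR by simp
  have pos_rho: "\<rho> m x \<ge> 0" and pos_mu: "\<mu> m x \<ge> 0" if "m < M" for m x
    using density[OF that] viscosity[OF that] phase_coeff_nonneg constants by auto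
  have step_ineq: "1 / (2*pi) * energy R \<gamma> (\<rho> m) (U (Suc m)) (X (Suc m))
        + 2 * dt * ((l2_norm R (\<lambda>x. sqrt (\<mu> m x * x $ 1) *\<^sub>R sym_grad (U (Suc m)) x))\<^sup>2
           + (quad_norm (\<T> m) (Q m) (wt m) (\<lambda>x. sqrt (\<mu> m x / x $ 1) * (U (Suc m) x \<bullet> e1)))\<^sup>2)
        \<le> 1 / (2*pi) * energy R \<gamma> (\<rho>I m) (UI m) (X m)
          + dt * l2_inner R (\<lambda>x. (\<rho> m x * x $ 1) *\<^sub>R g x) (U (Suc m))" if m: "m < M" for m
  proof -
    let ?u = "U (Suc m)" and ?v = "UI m" and ?X = "X m" and ?Y = "X (Suc m)"
    have sm: "Suc m \<le> M" and mM: "m \<le> M" using m by auto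
    note mesh = meshes[OF m]
    have uc: "continuous_on (closure R) ?u"
      using solution_spaces(1)[OF m] by (auto simp: discrete_velocities_def velocity_space_def)
    have vc: "continuous_on (closure R) ?v"
      using FEvec_continuous[OF lagrange2_in_FEvec[OF mesh]] interpolants(2)[OF m] by simp
    have pos_rhoI: "\<rho>I m x \<ge> 0" for x
    proof -
      \<comment> \<open>At \<open>m = 0\<close> the convention
        \<open>prev \<rho> 0 = \<rho> 0\<close> matches the truncated subtraction
        \<open>m - 1 = 0\<close>.\<close>
      have "prev \<rho> m y \<ge> 0" for y
        using pos_rho[of "m - 1" y] m by (cases m) (auto simp: prev_def)
      then show ?thesis unfolding interpolants(1)[OF m] by (rule average0_nonneg)
    qed
    have X: "?X \<in> Vh J" "?Y \<in> Vh J" using Vh_bdD(1) curves(1) sm mM by blast+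
    define kin where "kin = 1/2 * (l2_inner R (\<lambda>x. (\<rho> m x *\<^sub>R ?u x - \<rho>I m x *\<^sub>R ?v x) /\<^sub>R dt) (\<lambda>x. x $ 1 *\<^sub>R ?u x)
           + l2_inner R (\<lambda>x. \<rho>I m x *\<^sub>R ((?u x - ?v x) /\<^sub>R dt)) (\<lambda>x. x $ 1 *\<^sub>R ?u x))"
    define Ku where "Ku = l2_inner R (\<lambda>x. \<rho> m x * (norm (?u x))\<^sup>2) (\<lambda>x. x $ 1)"
    define Kv where "Kv = l2_inner R (\<lambda>x. \<rho>I m x * (norm (?v x))\<^sup>2) (\<lambda>x. x $ 1)"
    have kin: "1/2 * Ku - 1/2 * Kv \<le> dt * kin"
      unfolding kin_def Ku_def Kv_def
      by (rule kinetic_energy_increment[where \<T> = "\<T> m", OF bR oR domain(2) uc vc _ _ pos_rhoI dt])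
        (simp_all add: density[OF m] interpolants(1)[OF m] step_function_phase_coeff step_function_average0)
    \<comment> \<open>The form is antisymmetric in its last two arguments, so its integrand vanishes
      when they coincide.\<close>
    have adv: "adv_form R (\<rho> m) ?v ?u ?u = 0"
      by (simp add: adv_form_def l2_inner_def)
    define D where "D = (l2_norm R (\<lambda>x. sqrt (\<mu> m x * x $ 1) *\<^sub>R sym_grad ?u x))\<^sup>2"
    have D: "l2_inner R (\<lambda>x. \<mu> m x *\<^sub>R sym_grad ?u x) (\<lambda>x. x $ 1 *\<^sub>R sym_grad ?u x) = D"
      unfolding D_def l2_norm_squared l2_inner_def
    proof (rule set_lebesgue_integral_cong[OF Rsets], intro allI impI)
      fix x assume "x \<in> R"
      then have "\<mu> m x * x $ 1 \<ge> 0" using domain(2) pos_mu[OF m, of x] by auto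
      then show "(\<mu> m x *\<^sub>R sym_grad ?u x) \<bullet> (x $ 1 *\<^sub>R sym_grad ?u x)
        = (sqrt (\<mu> m x * x $ 1) *\<^sub>R sym_grad ?u x) \<bullet> (sqrt (\<mu> m x * x $ 1) *\<^sub>R sym_grad ?u x)"
        by (simp add: mult.assoc[symmetric])
    qed
    define S where "S = (quad_norm (\<T> m) (Q m) (wt m) (\<lambda>x. sqrt (\<mu> m x / x $ 1) * (?u x \<bullet> e1)))\<^sup>2"
    have S: "quad_inner (\<T> m) (Q m) (wt m) (\<lambda>x. \<mu> m x / x $ 1 * (?u x \<bullet> e1)) (\<lambda>x. ?u x \<bullet> e1) = S"
      unfolding S_def quad_norm_squared[OF quadrature[OF m]] quad_inner_def
    proof (intro sum.cong refl)
      fix K x assume K: "K \<in> \<T> m" "x \<in> Q m K"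
      \<comment> \<open>Sampling points are interior to a triangle, and
        \<open>interior (closure R) = R\<close> places them in \<open>R\<close>. Thus
        \<open>r > 0\<close> there and the root of the weight squares back.\<close>
      have "interior K \<subseteq> interior (closure R)"
        using mesh K(1) by (intro interior_mono) (auto simp: is_mesh_def)
      then have "x \<in> R"
        using K quadrature[OF m] regular by (auto simp: is_quadrature_def)
      then have "\<mu> m x / x $ 1 \<ge> 0" using domain(2) pos_mu[OF m, of x] by auto
      then have "sqrt (\<mu> m x / x $ 1) * sqrt (\<mu> m x / x $ 1) = \<mu> m x / x $ 1"
        by (simp only: real_sqrt_mult_self abs_of_nonneg)
      moreover have "a * c * c = b * c * (b * c)" if "b * b = a" for a b c :: real
        unfolding that[symmetric] by (simp only: mult_ac)
      ultimately have "\<mu> m x / x $ 1 * (?u x \<bullet> e1) * (?u x \<bullet> e1)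
          = sqrt (\<mu> m x / x $ 1) * (?u x \<bullet> e1) * (sqrt (\<mu> m x / x $ 1) * (?u x \<bullet> e1))"
        by blast
      then show "wt m K x * (\<mu> m x / x $ 1 * (?u x \<bullet> e1) * (?u x \<bullet> e1))
          = wt m K x * (sqrt (\<mu> m x / x $ 1) * (?u x \<bullet> e1) * (sqrt (\<mu> m x / x $ 1) * (?u x \<bullet> e1)))"
        by (rule arg_cong)
    qed
    \<comment> \<open>The new pressure is itself an admissible test function for
      incompressibility.\<close>
    have pr: "l2_inner R (P (Suc m)) (divergence (\<lambda>x. x $ 1 *\<^sub>R ?u x)) = 0"
      using incompressibility[OF m solution_spaces(2)[OF m]] by (simp add: l2_inner_def mult.commute)
    define curv where "curv = l2_inner unit_I (\<lambda>\<alpha>. (?X \<alpha> \<bullet> e1) * \<kappa> (Suc m) \<alpha>)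
              (\<lambda>\<alpha>. (normal ?X \<alpha> \<bullet> ?u (?X \<alpha>)) * norm (dcurve ?X \<alpha>))"
    define W where "W = l2_inner unit_I (\<lambda>\<alpha>. \<kappa> (Suc m) \<alpha> *\<^sub>R f_half ?X ?Y \<alpha>) (\<lambda>\<alpha>. ?Y \<alpha> - ?X \<alpha>)"
    have "l2_inner unit_I (\<lambda>\<alpha>. (?X \<alpha> \<bullet> e1) *\<^sub>R ?u (?X \<alpha>)) (\<lambda>\<alpha>. (\<kappa> (Suc m) \<alpha> * norm (dcurve ?X \<alpha>)) *\<^sub>R normal ?X \<alpha>) = curv"
      unfolding curv_def l2_inner_def by (simp add: inner_commute mult_ac)
    moreover have "l2_inner unit_I (\<lambda>\<alpha>. ?Y \<alpha> - ?X \<alpha>) (\<lambda>\<alpha>. \<kappa> (Suc m) \<alpha> *\<^sub>R f_half ?X ?Y \<alpha>) = W"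
      unfolding W_def l2_inner_def by (simp add: inner_commute)
    \<comment> \<open>The kinematic equation tested with the new curvature.\<close>
    ultimately have curv: "curv = W / dt"
      using kinematic[OF m solution_spaces(3)[OF m]] by simp
    define S1 where "S1 = l2_inner unit_I (\<lambda>\<alpha>. ?Y \<alpha> \<bullet> e1) (\<lambda>\<alpha>. norm (dcurve ?Y \<alpha>))"
    define S0 where "S0 = l2_inner unit_I (\<lambda>\<alpha>. ?X \<alpha> \<bullet> e1) (\<lambda>\<alpha>. norm (dcurve ?X \<alpha>))"
    \<comment> \<open>The curvature equation tested with \<open>?Y - ?X\<close> equates the upper
      bound of the area increment with \<open>- W\<close>.\<close>
    have "S1 - S0 \<le> - W"
      using area_decrease[OF X J curves(2)[OF mM] curves(3)[OF mM]]
        curvature[OF m Vh_bd_diff[OF curves(1)[OF sm] curves(1)[OF mM]]]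
      unfolding S1_def S0_def W_def by simp
    then have "\<gamma> * (S1 - S0) \<le> \<gamma> * (- W)" using constants(5) by (intro mult_left_mono) simp_all
    moreover have force: "l2_inner R (\<lambda>x. \<rho> m x *\<^sub>R g x) (\<lambda>x. x $ 1 *\<^sub>R ?u x) = l2_inner R (\<lambda>x. (\<rho> m x * x $ 1) *\<^sub>R g x) ?u"
      unfolding l2_inner_def by (simp add: mult_ac)
    define G where "G = l2_inner R (\<lambda>x. (\<rho> m x * x $ 1) *\<^sub>R g x) ?u"
    have "kin + 2 * D + 2 * S - \<gamma> * (W / dt) = G"
      using momentum[OF m solution_spaces(1)[OF m]]
      unfolding kin_def[symmetric] adv D S pr curv_def[symmetric] force G_def[symmetric] curv by simp
    then have "dt * (kin + 2 * D + 2 * S - \<gamma> * (W / dt)) = dt * G" by simp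
    then have "dt * kin + 2 * dt * (D + S) - \<gamma> * W = dt * G"
      using dt by (simp add: algebra_simps)
    ultimately have "1/2 * Ku + \<gamma> * S1 + 2 * dt * (D + S) \<le> 1/2 * Kv + \<gamma> * S0 + dt * G"
      using kin by (simp add: right_diff_distrib)
    moreover have "1 / (2*pi) * energy R \<gamma> (\<rho> m) ?u ?Y = 1/2 * Ku + \<gamma> * S1"
      "1 / (2*pi) * energy R \<gamma> (\<rho>I m) ?v ?X = 1/2 * Kv + \<gamma> * S0"
      by (simp_all add: energy_def Ku_def Kv_def S1_def S0_def field_simps)
    ultimately show ?thesis unfolding D_def[symmetric] S_def[symmetric] G_def[symmetric] by linarith
  qed
  have energy_sum: "1 / (2*pi) * energy R \<gamma> (\<rho> k) (U (Suc k)) (X (Suc k))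
        + 2 * dt * (\<Sum>m\<le>k.
             (l2_norm R (\<lambda>x. sqrt (\<mu> m x * x $ 1) *\<^sub>R sym_grad (U (Suc m)) x))\<^sup>2
           + (quad_norm (\<T> m) (Q m) (wt m) (\<lambda>x. sqrt (\<mu> m x / x $ 1) * (U (Suc m) x \<bullet> e1)))\<^sup>2)
        \<le> 1 / (2*pi) * energy R \<gamma> (\<rho> 0) (U 0) (X 0)
          + dt * (\<Sum>m\<le>k. l2_inner R (\<lambda>x. (\<rho> m x * x $ 1) *\<^sub>R g x) (U (Suc m)))"
    if interp: "\<forall>m<M. energy R \<gamma> (\<rho>I m) (UI m) (X m) \<le> energy R \<gamma> (prev \<rho> m) (U m) (X m)" and k: "k < M" for k
    using k
  proof (induction k)
    case 0
    have "1 / (2*pi) * energy R \<gamma> (\<rho>I 0) (UI 0) (X 0) \<le> 1 / (2*pi) * energy R \<gamma> (\<rho> 0) (U 0) (X 0)"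
      using interp 0 by (intro mult_left_mono) (auto simp: prev_def)
    then show ?case using step_ineq[OF 0] by simp
  next
    case (Suc k)
    \<comment> \<open>Since \<open>prev \<rho> (Suc k) = \<rho> k\<close>, the bound is the energy
      on the left of the previous step, and the sum telescopes.\<close>
    have "1 / (2*pi) * energy R \<gamma> (\<rho>I (Suc k)) (UI (Suc k)) (X (Suc k)) \<le> 1 / (2*pi) * energy R \<gamma> (\<rho> k) (U (Suc k)) (X (Suc k))"
      using interp Suc.prems by (intro mult_left_mono) (auto simp: prev_def)
    then show ?case using step_ineq[OF Suc.prems] Suc.IH Suc.prems by (simp add: distrib_left)
  qed
  have volume: "enclosed_volume (X (Suc m)) = enclosed_volume (X m)"
    if phase: "\<forall>m<M. phase_function R (X m) \<in> PP m" and m: "m < M" for m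
  proof -
    have X: "X m \<in> Vh_bd J" "X (Suc m) \<in> Vh_bd J" using curves(1) m by auto
    \<comment> \<open>Incompressibility with the phase function as test function says that the
      weighted flux through the curve is 0.\<close>
    have "l2_inner unit_I (\<lambda>\<alpha>. (X m \<alpha> \<bullet> e1) *\<^sub>R U (Suc m) (X m \<alpha>)) (\<lambda>\<alpha>. norm (dcurve (X m) \<alpha>) *\<^sub>R normal (X m) \<alpha>) = 0"
      using flux_through_phase_boundary[OF domain(1,3) meshes[OF m] solution_spaces(1)[OF m] Vh_bdD(1)[OF X(1)] J curves(4)[OF m]]
        incompressibility[OF m] phase m by simp
    \<comment> \<open>With the test function 1 the kinematic equation relates this flux to the
      displacement paired with \<open>f_half\<close>, that is, to the change of volume.\<close>
    moreover have "(\<lambda>\<alpha>. 1) \<in> Vh J"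
      unfolding Vh_def
      by (intro CollectI conjI ballI continuous_on_const) (rule exI[of _ 1], rule exI[of _ 0], simp)
    note kinematic[OF m this]
    ultimately have "l2_inner unit_I (\<lambda>\<alpha>. X (Suc m) \<alpha> - X m \<alpha>) (f_half (X m) (X (Suc m))) = 0"
      using dt by simp
    then show ?thesis using enclosed_volume_diff[OF X J] by simp
  qed
  show ?thesis using step_ineq energy_sum volume by blast
qed

end
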